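(* Let $U$ and $V$ be Noetherian schemes satisfying $G_1$ and $S_2$, and let $f\colon U\to V$ be an étale morphism. If $\mathcal{F}$ is an $\mathcal{O}_V$-module which is locally free of rank $1$ at the generic points of $V$, then $f^*\mathcal{F}$ is locally free of rank $1$ at the generic points of $U$.
   Context: A generic point of a scheme $X$ means a generic point of an irreducible component of $X$ (in the Zariski topology). An $\mathcal{O}_X$-module $\mathcal{F}$ is locally free of rank $1$ at the generic points of $X$ if for every generic point $\eta$ of $X$ the stalk $\mathcal{F}_\eta$ is isomorphic to $\mathcal{O}_{X,\eta}$ as an $\mathcal{O}_{X,\eta}$-module. A Noetherian scheme $X$ satisfies $G_1$ if $\mathcal{O}_{X,x}$ is a Gorenstein local ring for every $x\in X$ with $\dim\mathcal{O}_{X,x}\le 1$; it satisfies $S_2$ if $\operatorname{depth}\mathcal{O}_{X,x}\ge\min(2,\dim\mathcal{O}_{X,x})$ for every $x\in X$. *)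

theory Defs
  imports "HOL-Algebra.Algebra" "HOL-Analysis.Abstract_Topology" "HOL-Library.Extended_Nat"
begin

section \<open>Commutative algebra\<close>

subsection \<open>Local rings\<close>

definition local_ring :: "'a ring \<Rightarrow> bool"
  where "local_ring R \<longleftrightarrow> cring R \<and> (\<exists>!I. maximalideal I R)"

definition max_ideal :: "'a ring \<Rightarrow> 'a set"
  where "max_ideal R = (THE I. maximalideal I R)"

definition local_hom :: "('a \<Rightarrow> 'b) \<Rightarrow> 'a ring \<Rightarrow> 'b ring \<Rightarrow> bool"
  where "local_hom \<phi> A B \<longleftrightarrow> \<phi> \<in> ring_hom A B \<and> \<phi> ` max_ideal A \<subseteq> max_ideal B"

definition residue_field :: "'a ring \<Rightarrow> 'a set ring"
  where "residue_field R = R Quot max_ideal R"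

text \<open>For the zero ring, which never occurs as a local ring, this gives 0.\<close>

definition krull_dim :: "'a ring \<Rightarrow> enat"
  where "krull_dim R =
    Sup {enat n | n. \<exists>p. (\<forall>i\<le>n. primeideal (p i) R) \<and> (\<forall>i<n. p i \<subset> p (Suc i))}"

definition regular_sequence :: "'a ring \<Rightarrow> 'a list \<Rightarrow> bool"
  where "regular_sequence R as \<longleftrightarrow>
    set as \<subseteq> carrier R \<and>
    (\<forall>i<length as. \<forall>x\<in>carrier R.
       as ! i \<otimes>\<^bsub>R\<^esub> x \<in> Idl\<^bsub>R\<^esub> (set (take i as)) \<longrightarrow> x \<in> Idl\<^bsub>R\<^esub> (set (take i as))) \<and>
    Idl\<^bsub>R\<^esub> (set as) \<noteq> carrier R"

text \<open>The depth of a local ring over itself.\<close>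

definition depth :: "'a ring \<Rightarrow> enat"
  where "depth R = Sup {enat (length as) | as. set as \<subseteq> max_ideal R \<and> regular_sequence R as}"

subsection \<open>Modules\<close>

definition mod_hom :: "('r, 'm) module \<Rightarrow> ('r, 'n) module \<Rightarrow> 'r ring \<Rightarrow> ('m \<Rightarrow> 'n) set"
  where "mod_hom M N R =
    {h. h \<in> carrier M \<rightarrow> carrier N \<and>
        (\<forall>x\<in>carrier M. \<forall>y\<in>carrier M. h (x \<oplus>\<^bsub>M\<^esub> y) = h x \<oplus>\<^bsub>N\<^esub> h y) \<and>
        (\<forall>r\<in>carrier R. \<forall>x\<in>carrier M. h (r \<odot>\<^bsub>M\<^esub> x) = r \<odot>\<^bsub>N\<^esub> h x)}"

definition mod_iso :: "'r ring \<Rightarrow> ('r, 'm) module \<Rightarrow> ('r, 'n) module \<Rightarrow> bool"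
  where "mod_iso R M N \<longleftrightarrow> (\<exists>h\<in>mod_hom M N R. bij_betw h (carrier M) (carrier N))"

text \<open>
  A ring \<open>S\<close> regarded as a module along a ring homomorphism \<open>\<phi>\<close> into \<open>S\<close>.  (The records of
  type \<open>module\<close> extend those of type \<open>ring\<close>; the fields \<open>mult\<close> and \<open>one\<close> are never
  used for modules below.)
\<close>

definition alg_module :: "('r \<Rightarrow> 's) \<Rightarrow> 's ring \<Rightarrow> ('r, 's) module"
  where "alg_module \<phi> S =
    \<lparr>carrier = carrier S, monoid.mult = monoid.mult S, monoid.one = monoid.one S,
     ring.zero = ring.zero S, ring.add = ring.add S,
     smult = (\<lambda>r s. \<phi> r \<otimes>\<^bsub>S\<^esub> s)\<rparr>"

definition self_module :: "'r ring \<Rightarrow> ('r, 'r) module"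
  where "self_module R = alg_module (\<lambda>r. r) R"

subsection \<open>Tensor products\<close>

definition tensor_rels ::
    "'r ring \<Rightarrow> ('r, 'm) module \<Rightarrow> ('r, 'n) module \<Rightarrow> (('m \<times> 'n) \<Rightarrow>\<^sub>0 int) set"
  where "tensor_rels R M N = generate (free_Abelian_group (carrier M \<times> carrier N))
    ({frag_of (x \<oplus>\<^bsub>M\<^esub> x', y) - frag_of (x, y) - frag_of (x', y) | x x' y.
        x \<in> carrier M \<and> x' \<in> carrier M \<and> y \<in> carrier N} \<union>
     {frag_of (x, y \<oplus>\<^bsub>N\<^esub> y') - frag_of (x, y) - frag_of (x, y') | x y y'.
        x \<in> carrier M \<and> y \<in> carrier N \<and> y' \<in> carrier N} \<union>
     {frag_of (r \<odot>\<^bsub>M\<^esub> x, y) - frag_of (x, r \<odot>\<^bsub>N\<^esub> y) | r x y.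
        r \<in> carrier R \<and> x \<in> carrier M \<and> y \<in> carrier N})"

definition tensor_group ::
    "'r ring \<Rightarrow> ('r, 'm) module \<Rightarrow> ('r, 'n) module \<Rightarrow> (('m \<times> 'n) \<Rightarrow>\<^sub>0 int) set monoid"
  where "tensor_group R M N =
    free_Abelian_group (carrier M \<times> carrier N) Mod tensor_rels R M N"

text \<open>
  The map \<open>g \<otimes> h\<close> into \<open>M \<otimes> N\<close>, evaluated at a coset \<open>c\<close>.  Here, as in all similar
  definitions below, operations on equivalence classes are written as a union over
  representatives; all members of that union are the same class.
\<close>

definition tensor_map ::
    "'r ring \<Rightarrow> ('r, 'm) module \<Rightarrow> ('r, 'n) module \<Rightarrow> ('k \<Rightarrow> 'm) \<Rightarrow> ('l \<Rightarrow> 'n) \<Rightarrow>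
     (('k \<times> 'l) \<Rightarrow>\<^sub>0 int) set \<Rightarrow> (('m \<times> 'n) \<Rightarrow>\<^sub>0 int) set"
  where "tensor_map R M N g h c =
    (\<Union>z\<in>c. tensor_rels R M N #>\<^bsub>free_Abelian_group (carrier M \<times> carrier N)\<^esub>
             frag_extend (\<lambda>(x, y). frag_of (g x, h y)) z)"

text \<open>The \<open>S\<close>-module \<open>M \<otimes>\<^sub>R S\<close>.\<close>

definition base_change ::
    "'r ring \<Rightarrow> ('r \<Rightarrow> 's) \<Rightarrow> 's ring \<Rightarrow> ('r, 'm) module \<Rightarrow> ('s, (('m \<times> 's) \<Rightarrow>\<^sub>0 int) set) module"
  where "base_change R \<phi> S M =
    (let T = tensor_group R M (alg_module \<phi> S) in
     \<lparr>carrier = carrier T, monoid.mult = undefined, monoid.one = undefined,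
      ring.zero = monoid.one T, ring.add = monoid.mult T,
      smult = (\<lambda>b. tensor_map R M (alg_module \<phi> S) (\<lambda>x. x) (\<lambda>s. b \<otimes>\<^bsub>S\<^esub> s))\<rparr>)"

subsection \<open>Flat modules, injective modules, Gorenstein rings\<close>

text \<open>
  Flatness and injectivity quantify over all modules, so a carrier type has to be fixed.  The
  type below has cardinality \<open>2 ^ max |'r| \<aleph>\<^sub>0\<close>.  It accommodates the ring and its ideals, so
  testing flatness (ideal criterion) and injectivity (Baer) on it tests them against all modules.
  Moreover every module of at most this cardinality embeds into an injective module of at most
  this cardinality (the module of additive maps from the ring to a divisible group containing
  the module), so that injective resolutions can be formed within the type, and by dimension
  shifting a ring of finite injective dimension has a finite one there.
\<close>

type_synonym 'r large = "(nat \<times> 'r) set"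

definition flat_module :: "'r ring \<Rightarrow> ('r, 'm) module \<Rightarrow> bool"
  where "flat_module R M \<longleftrightarrow> module R M \<and>
    (\<forall>(N :: ('r, 'r large) module) (N' :: ('r, 'r large) module) g.
       module R N \<and> module R N' \<and> g \<in> mod_hom N N' R \<and> inj_on g (carrier N) \<longrightarrow>
       inj_on (tensor_map R N' M g (\<lambda>x. x)) (carrier (tensor_group R N M)))"

definition injective_module :: "'r ring \<Rightarrow> ('r, 'r large) module \<Rightarrow> bool"
  where "injective_module R E \<longleftrightarrow> module R E \<and>
    (\<forall>(A :: ('r, 'r large) module) (B :: ('r, 'r large) module) g h.
       module R A \<and> module R B \<and> g \<in> mod_hom A B R \<and> inj_on g (carrier A) \<and> h \<in> mod_hom A E R \<longrightarrow>
       (\<exists>k\<in>mod_hom B E R. \<forall>x\<in>carrier A. k (g x) = h x))"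

text \<open>There is an exact sequence \<open>0 \<rightarrow> R \<rightarrow> I 0 \<rightarrow> I 1 \<rightarrow> \<dots> \<rightarrow> I n \<rightarrow> 0\<close> with injective \<open>I i\<close>.\<close>

definition finite_injective_dim :: "'r ring \<Rightarrow> bool"
  where "finite_injective_dim R \<longleftrightarrow>
    (\<exists>(I :: nat \<Rightarrow> ('r, 'r large) module) \<epsilon> d n.
       (\<forall>i. injective_module R (I i)) \<and>
       (\<forall>i>n. carrier (I i) = {\<zero>\<^bsub>I i\<^esub>}) \<and>
       \<epsilon> \<in> mod_hom (self_module R) (I 0) R \<and> inj_on \<epsilon> (carrier R) \<and>
       (\<forall>i. d i \<in> mod_hom (I i) (I (Suc i)) R) \<and>
       \<epsilon> ` carrier R = {x \<in> carrier (I 0). d 0 x = \<zero>\<^bsub>I (Suc 0)\<^esub>} \<and>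
       (\<forall>i. d i ` carrier (I i) = {x \<in> carrier (I (Suc i)). d (Suc i) x = \<zero>\<^bsub>I (Suc (Suc i))\<^esub>}))"

definition gorenstein_local_ring :: "'r ring \<Rightarrow> bool"
  where "gorenstein_local_ring R \<longleftrightarrow>
    local_ring R \<and> noetherian_ring R \<and> finite_injective_dim R"

subsection \<open>Finite separable field extensions\<close>

text \<open>Polynomials are lists of coefficients, the leading coefficient coming first.\<close>

definition poly_deriv :: "'a ring \<Rightarrow> 'a list \<Rightarrow> 'a list"
  where "poly_deriv L p =
    ring.normalize L (map (\<lambda>i. add_pow L (Polynomials.degree p - i) (p ! i)) [0..<Polynomials.degree p])"

definition separable_poly :: "'a ring \<Rightarrow> 'a set \<Rightarrow> 'a list \<Rightarrow> bool"
  where "separable_poly L K p \<longleftrightarrow>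
    (\<exists>u\<in>carrier (K[X]\<^bsub>L\<^esub>). \<exists>v\<in>carrier (K[X]\<^bsub>L\<^esub>).
       (u \<otimes>\<^bsub>K[X]\<^bsub>L\<^esub>\<^esub> p) \<oplus>\<^bsub>K[X]\<^bsub>L\<^esub>\<^esub> (v \<otimes>\<^bsub>K[X]\<^bsub>L\<^esub>\<^esub> poly_deriv L p) = \<one>\<^bsub>K[X]\<^bsub>L\<^esub>\<^esub>)"

text \<open>\<open>Irr K z\<close> is the minimal polynomial of \<open>z\<close> over the subfield \<open>K\<close> of \<open>L\<close>.\<close>

definition finite_separable :: "'a ring \<Rightarrow> 'a set \<Rightarrow> bool"
  where "finite_separable L K \<longleftrightarrow>
    field L \<and> subfield K L \<and> ring.finite_dimension L K (carrier L) \<and>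
    (\<forall>z\<in>carrier L. separable_poly L K (ring.Irr L K z))"

subsection \<open>Localization at a prime ideal\<close>

text \<open>The class of the fraction \<open>a / s\<close> in the localization of \<open>R\<close> at a multiplicative set \<open>S\<close>.\<close>

definition frac :: "'a ring \<Rightarrow> 'a set \<Rightarrow> 'a \<Rightarrow> 'a \<Rightarrow> ('a \<times> 'a) set"
  where "frac R S a s =
    {(b, t). b \<in> carrier R \<and> t \<in> S \<and> (\<exists>u\<in>S. u \<otimes>\<^bsub>R\<^esub> (t \<otimes>\<^bsub>R\<^esub> a \<ominus>\<^bsub>R\<^esub> s \<otimes>\<^bsub>R\<^esub> b) = \<zero>\<^bsub>R\<^esub>)}"

definition localization :: "'a ring \<Rightarrow> 'a set \<Rightarrow> ('a \<times> 'a) set ring"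
  where "localization R S =
    \<lparr>carrier = {frac R S a s | a s. a \<in> carrier R \<and> s \<in> S},
     monoid.mult = (\<lambda>p q. \<Union>(a, s)\<in>p. \<Union>(b, t)\<in>q. frac R S (a \<otimes>\<^bsub>R\<^esub> b) (s \<otimes>\<^bsub>R\<^esub> t)),
     monoid.one = frac R S \<one>\<^bsub>R\<^esub> \<one>\<^bsub>R\<^esub>,
     ring.zero = frac R S \<zero>\<^bsub>R\<^esub> \<one>\<^bsub>R\<^esub>,
     ring.add = (\<lambda>p q. \<Union>(a, s)\<in>p. \<Union>(b, t)\<in>q.
              frac R S (t \<otimes>\<^bsub>R\<^esub> a \<oplus>\<^bsub>R\<^esub> s \<otimes>\<^bsub>R\<^esub> b) (s \<otimes>\<^bsub>R\<^esub> t))\<rparr>"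

abbreviation localization_at :: "'a ring \<Rightarrow> 'a set \<Rightarrow> ('a \<times> 'a) set ring"
  where "localization_at R p \<equiv> localization R (carrier R - p)"

section \<open>Sheaves\<close>

definition presheaf ::
    "'p topology \<Rightarrow> ('p set \<Rightarrow> 's set) \<Rightarrow> ('p set \<Rightarrow> 'p set \<Rightarrow> 's \<Rightarrow> 's) \<Rightarrow> bool"
  where "presheaf T C r \<longleftrightarrow>
    (\<forall>U V. openin T U \<and> openin T V \<and> V \<subseteq> U \<longrightarrow> r U V \<in> C U \<rightarrow> C V) \<and>
    (\<forall>U. openin T U \<longrightarrow> (\<forall>s\<in>C U. r U U s = s)) \<and>
    (\<forall>U V W. openin T U \<and> openin T V \<and> openin T W \<and> W \<subseteq> V \<and> V \<subseteq> U \<longrightarrow>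
       (\<forall>s\<in>C U. r V W (r U V s) = r U W s))"

definition sheaf ::
    "'p topology \<Rightarrow> ('p set \<Rightarrow> 's set) \<Rightarrow> ('p set \<Rightarrow> 'p set \<Rightarrow> 's \<Rightarrow> 's) \<Rightarrow> bool"
  where "sheaf T C r \<longleftrightarrow> presheaf T C r \<and>
    (\<forall>\<U> s. (\<forall>U\<in>\<U>. openin T U \<and> s U \<in> C U) \<and>
           (\<forall>U\<in>\<U>. \<forall>V\<in>\<U>. r U (U \<inter> V) (s U) = r V (U \<inter> V) (s V)) \<longrightarrow>
       (\<exists>!t. t \<in> C (\<Union>\<U>) \<and> (\<forall>U\<in>\<U>. r (\<Union>\<U>) U t = s U)))"

text \<open>
  The class of \<open>s \<in> C U\<close> in the colimit of the \<open>C V\<close> over the open sets \<open>V\<close> containing \<open>A\<close>.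
  For \<open>A = {x}\<close> this is the germ at \<open>x\<close>; the general case is used for inverse images.
\<close>

definition germ ::
    "'p topology \<Rightarrow> ('p set \<Rightarrow> 's set) \<Rightarrow> ('p set \<Rightarrow> 'p set \<Rightarrow> 's \<Rightarrow> 's) \<Rightarrow>
     'p set \<Rightarrow> 'p set \<Rightarrow> 's \<Rightarrow> ('p set \<times> 's) set"
  where "germ T C r A U s =
    {(V, t). openin T V \<and> A \<subseteq> V \<and> t \<in> C V \<and>
       (\<exists>W. openin T W \<and> A \<subseteq> W \<and> W \<subseteq> U \<inter> V \<and> r U W s = r V W t)}"

definition germs ::
    "'p topology \<Rightarrow> ('p set \<Rightarrow> 's set) \<Rightarrow> ('p set \<Rightarrow> 'p set \<Rightarrow> 's \<Rightarrow> 's) \<Rightarrow>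
     'p set \<Rightarrow> ('p set \<times> 's) set set"
  where "germs T C r A = {germ T C r A U s | U s. openin T U \<and> A \<subseteq> U \<and> s \<in> C U}"

text \<open>The sections over \<open>W\<close> of the sheaf associated to a presheaf.\<close>

definition assoc_sections ::
    "'p topology \<Rightarrow> ('p set \<Rightarrow> 's set) \<Rightarrow> ('p set \<Rightarrow> 'p set \<Rightarrow> 's \<Rightarrow> 's) \<Rightarrow>
     'p set \<Rightarrow> ('p \<Rightarrow> ('p set \<times> 's) set) set"
  where "assoc_sections T C r W =
    {\<sigma> \<in> (\<Pi>\<^sub>E x\<in>W. germs T C r {x}).
       \<forall>x\<in>W. \<exists>V t. openin T V \<and> x \<in> V \<and> V \<subseteq> W \<and> t \<in> C V \<and> (\<forall>y\<in>V. \<sigma> y = germ T C r {y} V t)}"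

definition pointwise_ring :: "'p set \<Rightarrow> ('p \<Rightarrow> 'c ring) \<Rightarrow> ('p \<Rightarrow> 'c) set \<Rightarrow> ('p \<Rightarrow> 'c) ring"
  where "pointwise_ring W A C =
    \<lparr>carrier = C,
     monoid.mult = (\<lambda>\<sigma> \<tau>. \<lambda>x\<in>W. \<sigma> x \<otimes>\<^bsub>A x\<^esub> \<tau> x),
     monoid.one = (\<lambda>x\<in>W. \<one>\<^bsub>A x\<^esub>),
     ring.zero = (\<lambda>x\<in>W. \<zero>\<^bsub>A x\<^esub>),
     ring.add = (\<lambda>\<sigma> \<tau>. \<lambda>x\<in>W. \<sigma> x \<oplus>\<^bsub>A x\<^esub> \<tau> x)\<rparr>"

section \<open>Ringed spaces and sheaves of modules\<close>

text \<open>
  Only the values of sections and restrictions at open sets matter.  The same record also serves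
  for presheaves of rings on a space.
\<close>

record ('p, 'a) ringed_space =
  rs_top :: "'p topology"
  rs_sec :: "'p set \<Rightarrow> 'a ring"
  rs_res :: "'p set \<Rightarrow> 'p set \<Rightarrow> 'a \<Rightarrow> 'a"

record ('p, 'a, 'm) mod_presheaf =
  ms_sec :: "'p set \<Rightarrow> ('a, 'm) module"
  ms_res :: "'p set \<Rightarrow> 'p set \<Rightarrow> 'm \<Rightarrow> 'm"

definition is_ringed_space :: "('p, 'a) ringed_space \<Rightarrow> bool"
  where "is_ringed_space \<S> \<longleftrightarrow>
    (\<forall>U. openin (rs_top \<S>) U \<longrightarrow> cring (rs_sec \<S> U)) \<and>
    (\<forall>U V. openin (rs_top \<S>) U \<and> openin (rs_top \<S>) V \<and> V \<subseteq> U \<longrightarrow>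
       rs_res \<S> U V \<in> ring_hom (rs_sec \<S> U) (rs_sec \<S> V)) \<and>
    sheaf (rs_top \<S>) (\<lambda>U. carrier (rs_sec \<S> U)) (rs_res \<S>)"

definition is_O_module :: "('p, 'a) ringed_space \<Rightarrow> ('p, 'a, 'm) mod_presheaf \<Rightarrow> bool"
  where "is_O_module \<S> F \<longleftrightarrow>
    (\<forall>U. openin (rs_top \<S>) U \<longrightarrow> module (rs_sec \<S> U) (ms_sec F U)) \<and>
    (\<forall>U V. openin (rs_top \<S>) U \<and> openin (rs_top \<S>) V \<and> V \<subseteq> U \<longrightarrow>
       (\<forall>m\<in>carrier (ms_sec F U). \<forall>m'\<in>carrier (ms_sec F U).
          ms_res F U V (m \<oplus>\<^bsub>ms_sec F U\<^esub> m') = ms_res F U V m \<oplus>\<^bsub>ms_sec F V\<^esub> ms_res F U V m') \<and>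
       (\<forall>a\<in>carrier (rs_sec \<S> U). \<forall>m\<in>carrier (ms_sec F U).
          ms_res F U V (a \<odot>\<^bsub>ms_sec F U\<^esub> m) = rs_res \<S> U V a \<odot>\<^bsub>ms_sec F V\<^esub> ms_res F U V m)) \<and>
    sheaf (rs_top \<S>) (\<lambda>U. carrier (ms_sec F U)) (ms_res F)"

abbreviation rs_germ ::
    "('p, 'a) ringed_space \<Rightarrow> 'p set \<Rightarrow> 'p set \<Rightarrow> 'a \<Rightarrow> ('p set \<times> 'a) set"
  where "rs_germ \<S> \<equiv> germ (rs_top \<S>) (\<lambda>U. carrier (rs_sec \<S> U)) (rs_res \<S>)"

abbreviation ms_germ ::
    "('p, 'a) ringed_space \<Rightarrow> ('p, 'a, 'm) mod_presheaf \<Rightarrow> 'p set \<Rightarrow> 'p set \<Rightarrow> 'm \<Rightarrow> ('p set \<times> 'm) set"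
  where "ms_germ \<S> F \<equiv> germ (rs_top \<S>) (\<lambda>U. carrier (ms_sec F U)) (ms_res F)"

definition germ_ring :: "('p, 'a) ringed_space \<Rightarrow> 'p set \<Rightarrow> ('p set \<times> 'a) set ring"
  where "germ_ring \<S> A =
    \<lparr>carrier = germs (rs_top \<S>) (\<lambda>U. carrier (rs_sec \<S> U)) (rs_res \<S>) A,
     monoid.mult = (\<lambda>a b. \<Union>(U, s)\<in>a. \<Union>(V, t)\<in>b. rs_germ \<S> A (U \<inter> V)
              (rs_res \<S> U (U \<inter> V) s \<otimes>\<^bsub>rs_sec \<S> (U \<inter> V)\<^esub> rs_res \<S> V (U \<inter> V) t)),
     monoid.one = rs_germ \<S> A (topspace (rs_top \<S>)) \<one>\<^bsub>rs_sec \<S> (topspace (rs_top \<S>))\<^esub>,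
     ring.zero = rs_germ \<S> A (topspace (rs_top \<S>)) \<zero>\<^bsub>rs_sec \<S> (topspace (rs_top \<S>))\<^esub>,
     ring.add = (\<lambda>a b. \<Union>(U, s)\<in>a. \<Union>(V, t)\<in>b. rs_germ \<S> A (U \<inter> V)
              (rs_res \<S> U (U \<inter> V) s \<oplus>\<^bsub>rs_sec \<S> (U \<inter> V)\<^esub> rs_res \<S> V (U \<inter> V) t))\<rparr>"

definition germ_module ::
    "('p, 'a) ringed_space \<Rightarrow> ('p, 'a, 'm) mod_presheaf \<Rightarrow> 'p set \<Rightarrow>
     (('p set \<times> 'a) set, ('p set \<times> 'm) set) module"
  where "germ_module \<S> F A =
    \<lparr>carrier = germs (rs_top \<S>) (\<lambda>U. carrier (ms_sec F U)) (ms_res F) A,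
     monoid.mult = undefined, monoid.one = undefined,
     ring.zero = ms_germ \<S> F A (topspace (rs_top \<S>)) \<zero>\<^bsub>ms_sec F (topspace (rs_top \<S>))\<^esub>,
     ring.add = (\<lambda>m n. \<Union>(U, s)\<in>m. \<Union>(V, t)\<in>n. ms_germ \<S> F A (U \<inter> V)
              (ms_res F U (U \<inter> V) s \<oplus>\<^bsub>ms_sec F (U \<inter> V)\<^esub> ms_res F V (U \<inter> V) t)),
     smult = (\<lambda>a m. \<Union>(U, s)\<in>a. \<Union>(V, t)\<in>m. ms_germ \<S> F A (U \<inter> V)
              (rs_res \<S> U (U \<inter> V) s \<odot>\<^bsub>ms_sec F (U \<inter> V)\<^esub> ms_res F V (U \<inter> V) t))\<rparr>"

abbreviation stalk :: "('p, 'a) ringed_space \<Rightarrow> 'p \<Rightarrow> ('p set \<times> 'a) set ring"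
  where "stalk \<S> x \<equiv> germ_ring \<S> {x}"

abbreviation mod_stalk ::
    "('p, 'a) ringed_space \<Rightarrow> ('p, 'a, 'm) mod_presheaf \<Rightarrow> 'p \<Rightarrow>
     (('p set \<times> 'a) set, ('p set \<times> 'm) set) module"
  where "mod_stalk \<S> F x \<equiv> germ_module \<S> F {x}"

subsection \<open>Associated sheaves\<close>

definition assoc_ring_sheaf ::
    "('p, 'a) ringed_space \<Rightarrow> ('p, 'p \<Rightarrow> ('p set \<times> 'a) set) ringed_space"
  where "assoc_ring_sheaf P =
    \<lparr>rs_top = rs_top P,
     rs_sec = (\<lambda>W. pointwise_ring W (stalk P)
                 (assoc_sections (rs_top P) (\<lambda>U. carrier (rs_sec P U)) (rs_res P) W)),
     rs_res = (\<lambda>W W' \<sigma>. restrict \<sigma> W')\<rparr>"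

text \<open>
  The sheaf associated to a presheaf of modules \<open>F\<close> over a presheaf of rings \<open>P\<close>.  The parameter
  \<open>ev\<close> determines the scalars: a scalar \<open>a\<close> over \<open>W\<close> acts at the point \<open>x\<close> as the element
  \<open>ev W a x\<close> of the stalk of \<open>P\<close>.
\<close>

definition assoc_mod_sheaf ::
    "('p, 'a) ringed_space \<Rightarrow> ('p set \<Rightarrow> 'c \<Rightarrow> 'p \<Rightarrow> ('p set \<times> 'a) set) \<Rightarrow>
     ('p, 'a, 'm) mod_presheaf \<Rightarrow> ('p, 'c, 'p \<Rightarrow> ('p set \<times> 'm) set) mod_presheaf"
  where "assoc_mod_sheaf P ev F =
    \<lparr>ms_sec = (\<lambda>W.
       \<lparr>carrier = assoc_sections (rs_top P) (\<lambda>U. carrier (ms_sec F U)) (ms_res F) W,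
        monoid.mult = undefined, monoid.one = undefined,
        ring.zero = (\<lambda>x\<in>W. \<zero>\<^bsub>mod_stalk P F x\<^esub>),
        ring.add = (\<lambda>\<sigma> \<tau>. \<lambda>x\<in>W. \<sigma> x \<oplus>\<^bsub>mod_stalk P F x\<^esub> \<tau> x),
        smult = (\<lambda>a \<sigma>. \<lambda>x\<in>W. ev W a x \<odot>\<^bsub>mod_stalk P F x\<^esub> \<sigma> x)\<rparr>),
     ms_res = (\<lambda>W W' \<sigma>. restrict \<sigma> W')\<rparr>"

subsection \<open>Morphisms\<close>

text \<open>
  \<open>map_sec f V\<close> is the homomorphism from the sections over \<open>V\<close> to the sections over the
  preimage of \<open>V\<close>.
\<close>

record ('p, 'a, 'q, 'b) rs_map =
  map_pt :: "'p \<Rightarrow> 'q"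
  map_sec :: "'q set \<Rightarrow> 'b \<Rightarrow> 'a"

definition preim :: "('p, 'a) ringed_space \<Rightarrow> ('p, 'a, 'q, 'b) rs_map \<Rightarrow> 'q set \<Rightarrow> 'p set"
  where "preim \<S> f V = {x \<in> topspace (rs_top \<S>). map_pt f x \<in> V}"

definition rs_morphism ::
    "('p, 'a) ringed_space \<Rightarrow> ('q, 'b) ringed_space \<Rightarrow> ('p, 'a, 'q, 'b) rs_map \<Rightarrow> bool"
  where "rs_morphism \<S> \<T> f \<longleftrightarrow>
    continuous_map (rs_top \<S>) (rs_top \<T>) (map_pt f) \<and>
    (\<forall>V. openin (rs_top \<T>) V \<longrightarrow> map_sec f V \<in> ring_hom (rs_sec \<T> V) (rs_sec \<S> (preim \<S> f V))) \<and>
    (\<forall>V V'. openin (rs_top \<T>) V \<and> openin (rs_top \<T>) V' \<and> V' \<subseteq> V \<longrightarrow>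
       (\<forall>s\<in>carrier (rs_sec \<T> V).
          map_sec f V' (rs_res \<T> V V' s) = rs_res \<S> (preim \<S> f V) (preim \<S> f V') (map_sec f V s)))"

definition rs_isomorphism ::
    "('p, 'a) ringed_space \<Rightarrow> ('q, 'b) ringed_space \<Rightarrow> ('p, 'a, 'q, 'b) rs_map \<Rightarrow> bool"
  where "rs_isomorphism \<S> \<T> f \<longleftrightarrow> rs_morphism \<S> \<T> f \<and>
    homeomorphic_map (rs_top \<S>) (rs_top \<T>) (map_pt f) \<and>
    (\<forall>V. openin (rs_top \<T>) V \<longrightarrow>
       bij_betw (map_sec f V) (carrier (rs_sec \<T> V)) (carrier (rs_sec \<S> (preim \<S> f V))))"

text \<open>The homomorphism from the stalk at \<open>f x\<close> to the stalk at \<open>x\<close>.\<close>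

definition stalk_map ::
    "('p, 'a) ringed_space \<Rightarrow> ('p, 'a, 'q, 'b) rs_map \<Rightarrow> 'p \<Rightarrow> ('q set \<times> 'b) set \<Rightarrow> ('p set \<times> 'a) set"
  where "stalk_map \<S> f x c = (\<Union>(V, s)\<in>c. rs_germ \<S> {x} (preim \<S> f V) (map_sec f V s))"

section \<open>Schemes\<close>

definition is_locally_ringed_space :: "('p, 'a) ringed_space \<Rightarrow> bool"
  where "is_locally_ringed_space \<S> \<longleftrightarrow> is_ringed_space \<S> \<and>
    (\<forall>x\<in>topspace (rs_top \<S>). local_ring (stalk \<S> x))"

definition zariski_topology :: "'a ring \<Rightarrow> 'a set topology"
  where "zariski_topology R =
    topology (\<lambda>U. \<exists>I. ideal I R \<and> U = {p. primeideal p R \<and> \<not> I \<subseteq> p})"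

definition Spec :: "'a ring \<Rightarrow> ('a set, 'a set \<Rightarrow> ('a \<times> 'a) set) ringed_space"
  where "Spec R =
    \<lparr>rs_top = zariski_topology R,
     rs_sec = (\<lambda>U. pointwise_ring U (localization_at R)
       {\<sigma> \<in> (\<Pi>\<^sub>E p\<in>U. carrier (localization_at R p)).
          \<forall>p\<in>U. \<exists>V. openin (zariski_topology R) V \<and> p \<in> V \<and> V \<subseteq> U \<and>
            (\<exists>a\<in>carrier R. \<exists>b\<in>carrier R. \<forall>q\<in>V. b \<notin> q \<and> \<sigma> q = frac R (carrier R - q) a b)}),
     rs_res = (\<lambda>U V \<sigma>. restrict \<sigma> V)\<rparr>"

definition open_subspace :: "('p, 'a) ringed_space \<Rightarrow> 'p set \<Rightarrow> ('p, 'a) ringed_space"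
  where "open_subspace \<S> U = \<S>\<lparr>rs_top := subtopology (rs_top \<S>) U\<rparr>"

text \<open>
  The type of \<open>R\<close> is no restriction, as \<open>R\<close> is isomorphic to the ring of sections over \<open>U\<close>.
  An isomorphism of ringed spaces to a locally ringed space is automatically local.
\<close>

definition affine_open :: "('p, 'a) ringed_space \<Rightarrow> 'p set \<Rightarrow> 'a ring \<Rightarrow> bool"
  where "affine_open \<S> U R \<longleftrightarrow> openin (rs_top \<S>) U \<and> cring R \<and>
    (\<exists>f. rs_isomorphism (open_subspace \<S> U) (Spec R) f)"

definition is_scheme :: "('p, 'a) ringed_space \<Rightarrow> bool"
  where "is_scheme \<S> \<longleftrightarrow> is_locally_ringed_space \<S> \<and>
    (\<forall>x\<in>topspace (rs_top \<S>). \<exists>U R. x \<in> U \<and> affine_open \<S> U R)"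

definition noetherian_scheme :: "('p, 'a) ringed_space \<Rightarrow> bool"
  where "noetherian_scheme \<S> \<longleftrightarrow> is_scheme \<S> \<and> compact_space (rs_top \<S>) \<and>
    (\<forall>x\<in>topspace (rs_top \<S>). \<exists>U R. x \<in> U \<and> affine_open \<S> U R \<and> noetherian_ring R)"

definition scheme_morphism ::
    "('p, 'a) ringed_space \<Rightarrow> ('q, 'b) ringed_space \<Rightarrow> ('p, 'a, 'q, 'b) rs_map \<Rightarrow> bool"
  where "scheme_morphism \<S> \<T> f \<longleftrightarrow> rs_morphism \<S> \<T> f \<and>
    (\<forall>x\<in>topspace (rs_top \<S>). local_hom (stalk_map \<S> f x) (stalk \<T> (map_pt f x)) (stalk \<S> x))"

definition satisfies_G1 :: "('p, 'a) ringed_space \<Rightarrow> bool"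
  where "satisfies_G1 \<S> \<longleftrightarrow>
    (\<forall>x\<in>topspace (rs_top \<S>). krull_dim (stalk \<S> x) \<le> 1 \<longrightarrow> gorenstein_local_ring (stalk \<S> x))"

definition satisfies_S2 :: "('p, 'a) ringed_space \<Rightarrow> bool"
  where "satisfies_S2 \<S> \<longleftrightarrow>
    (\<forall>x\<in>topspace (rs_top \<S>). depth (stalk \<S> x) \<ge> min 2 (krull_dim (stalk \<S> x)))"

subsection \<open>Etale morphisms\<close>

text \<open>
  The definition of SGA 1 for locally Noetherian schemes: locally of finite type, flat and
  unramified.  (Over a locally Noetherian base, locally of finite type and locally of finite
  presentation agree.)
\<close>

definition finite_type_hom :: "('a \<Rightarrow> 'b) \<Rightarrow> 'a ring \<Rightarrow> 'b ring \<Rightarrow> bool"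
  where "finite_type_hom \<phi> A B \<longleftrightarrow> \<phi> \<in> ring_hom A B \<and>
    (\<exists>S\<subseteq>carrier B. finite S \<and> generate_ring B (\<phi> ` carrier A \<union> S) = carrier B)"

definition locally_of_finite_type ::
    "('p, 'a) ringed_space \<Rightarrow> ('q, 'b) ringed_space \<Rightarrow> ('p, 'a, 'q, 'b) rs_map \<Rightarrow> bool"
  where "locally_of_finite_type \<S> \<T> f \<longleftrightarrow>
    (\<forall>x\<in>topspace (rs_top \<S>). \<exists>U A V B.
       x \<in> U \<and> affine_open \<S> U A \<and> affine_open \<T> V B \<and> map_pt f ` U \<subseteq> V \<and>
       finite_type_hom (\<lambda>s. rs_res \<S> (preim \<S> f V) U (map_sec f V s)) (rs_sec \<T> V) (rs_sec \<S> U))"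

definition flat_morphism ::
    "('p, 'a) ringed_space \<Rightarrow> ('q, 'b) ringed_space \<Rightarrow> ('p, 'a, 'q, 'b) rs_map \<Rightarrow> bool"
  where "flat_morphism \<S> \<T> f \<longleftrightarrow>
    (\<forall>x\<in>topspace (rs_top \<S>).
       flat_module (stalk \<T> (map_pt f x)) (alg_module (stalk_map \<S> f x) (stalk \<S> x)))"

text \<open>
  \<open>unramified_hom \<phi> A B\<close>: the maximal ideal of \<open>A\<close> generates that of \<open>B\<close>, and the residue
  field of \<open>B\<close> is finite separable over (the image of) that of \<open>A\<close>.
\<close>

definition unramified_hom :: "('a \<Rightarrow> 'b) \<Rightarrow> 'a ring \<Rightarrow> 'b ring \<Rightarrow> bool"
  where "unramified_hom \<phi> A B \<longleftrightarrow>
    Idl\<^bsub>B\<^esub> (\<phi> ` max_ideal A) = max_ideal B \<and>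
    finite_separable (residue_field B) ((\<lambda>a. max_ideal B +>\<^bsub>B\<^esub> \<phi> a) ` carrier A)"

definition unramified_stalks ::
    "('p, 'a) ringed_space \<Rightarrow> ('q, 'b) ringed_space \<Rightarrow> ('p, 'a, 'q, 'b) rs_map \<Rightarrow> bool"
  where "unramified_stalks \<S> \<T> f \<longleftrightarrow>
    (\<forall>x\<in>topspace (rs_top \<S>). unramified_hom (stalk_map \<S> f x) (stalk \<T> (map_pt f x)) (stalk \<S> x))"

definition etale_morphism ::
    "('p, 'a) ringed_space \<Rightarrow> ('q, 'b) ringed_space \<Rightarrow> ('p, 'a, 'q, 'b) rs_map \<Rightarrow> bool"
  where "etale_morphism \<S> \<T> f \<longleftrightarrow> scheme_morphism \<S> \<T> f \<and>
    locally_of_finite_type \<S> \<T> f \<and> flat_morphism \<S> \<T> f \<and> unramified_stalks \<S> \<T> f"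

section \<open>Pullback of modules\<close>

text \<open>
  The presheaf \<open>W \<mapsto> colim \<O>(V)\<close> over the open \<open>V\<close> containing \<open>f W\<close>, its module analogue,
  and the associated sheaves \<open>f\<^sup>-\<^sup>1\<O>\<close> and \<open>f\<^sup>-\<^sup>1F\<close>.
\<close>

definition inv_image_ring_presheaf ::
    "('p, 'a) ringed_space \<Rightarrow> ('q, 'b) ringed_space \<Rightarrow> ('p, 'a, 'q, 'b) rs_map \<Rightarrow>
     ('p, ('q set \<times> 'b) set) ringed_space"
  where "inv_image_ring_presheaf \<S> \<T> f =
    \<lparr>rs_top = rs_top \<S>,
     rs_sec = (\<lambda>W. germ_ring \<T> (map_pt f ` W)),
     rs_res = (\<lambda>W W' c. \<Union>(V, s)\<in>c. rs_germ \<T> (map_pt f ` W') V s)\<rparr>"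

definition inv_image_mod_presheaf ::
    "('q, 'b) ringed_space \<Rightarrow> ('p, 'a, 'q, 'b) rs_map \<Rightarrow> ('q, 'b, 'm) mod_presheaf \<Rightarrow>
     ('p, ('q set \<times> 'b) set, ('q set \<times> 'm) set) mod_presheaf"
  where "inv_image_mod_presheaf \<T> f F =
    \<lparr>ms_sec = (\<lambda>W. germ_module \<T> F (map_pt f ` W)),
     ms_res = (\<lambda>W W' c. \<Union>(V, s)\<in>c. ms_germ \<T> F (map_pt f ` W') V s)\<rparr>"

definition inv_image_ring ::
    "('p, 'a) ringed_space \<Rightarrow> ('q, 'b) ringed_space \<Rightarrow> ('p, 'a, 'q, 'b) rs_map \<Rightarrow>
     ('p, 'p \<Rightarrow> ('p set \<times> ('q set \<times> 'b) set) set) ringed_space"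
  where "inv_image_ring \<S> \<T> f = assoc_ring_sheaf (inv_image_ring_presheaf \<S> \<T> f)"

definition inv_image_mod ::
    "('p, 'a) ringed_space \<Rightarrow> ('q, 'b) ringed_space \<Rightarrow> ('p, 'a, 'q, 'b) rs_map \<Rightarrow>
     ('q, 'b, 'm) mod_presheaf \<Rightarrow>
     ('p, 'p \<Rightarrow> ('p set \<times> ('q set \<times> 'b) set) set, 'p \<Rightarrow> ('p set \<times> ('q set \<times> 'm) set) set) mod_presheaf"
  where "inv_image_mod \<S> \<T> f F =
    assoc_mod_sheaf (inv_image_ring_presheaf \<S> \<T> f) (\<lambda>W a. a) (inv_image_mod_presheaf \<T> f F)"

text \<open>
  The homomorphism \<open>f\<^sup>-\<^sup>1\<O>\<^sub>\<T> \<rightarrow> \<O>\<^sub>\<S>\<close> over \<open>W\<close> adjoint to \<open>map_sec f\<close>: the section with the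
  prescribed germs, the germ at \<open>x\<close> represented by \<open>s\<close> over \<open>V\<close> being sent to that of
  \<open>map_sec f V s\<close>.
\<close>

definition inv_image_to_struct ::
    "('p, 'a) ringed_space \<Rightarrow> ('p, 'a, 'q, 'b) rs_map \<Rightarrow> 'p set \<Rightarrow>
     ('p \<Rightarrow> ('p set \<times> ('q set \<times> 'b) set) set) \<Rightarrow> 'a"
  where "inv_image_to_struct \<S> f W \<sigma> =
    (THE a. a \<in> carrier (rs_sec \<S> W) \<and>
       (\<forall>x\<in>W. rs_germ \<S> {x} W a =
          (\<Union>(W', c)\<in>\<sigma> x. \<Union>(V, s)\<in>c. rs_germ \<S> {x} (preim \<S> f V) (map_sec f V s))))"

text \<open>The presheaf \<open>W \<mapsto> f\<^sup>-\<^sup>1F(W) \<otimes> \<O>\<^sub>\<S>(W)\<close>, the tensor product being over \<open>f\<^sup>-\<^sup>1\<O>\<^sub>\<T>(W)\<close>.\<close>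

definition pullback_presheaf ::
    "('p, 'a) ringed_space \<Rightarrow> ('q, 'b) ringed_space \<Rightarrow> ('p, 'a, 'q, 'b) rs_map \<Rightarrow>
     ('q, 'b, 'm) mod_presheaf \<Rightarrow>
     ('p, 'a, ((('p \<Rightarrow> ('p set \<times> ('q set \<times> 'm) set) set) \<times> 'a) \<Rightarrow>\<^sub>0 int) set) mod_presheaf"
  where "pullback_presheaf \<S> \<T> f F =
    \<lparr>ms_sec = (\<lambda>W. base_change (rs_sec (inv_image_ring \<S> \<T> f) W) (inv_image_to_struct \<S> f W)
                    (rs_sec \<S> W) (ms_sec (inv_image_mod \<S> \<T> f F) W)),
     ms_res = (\<lambda>W W'. tensor_map (rs_sec (inv_image_ring \<S> \<T> f) W')
                    (ms_sec (inv_image_mod \<S> \<T> f F) W')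
                    (alg_module (inv_image_to_struct \<S> f W') (rs_sec \<S> W'))
                    (ms_res (inv_image_mod \<S> \<T> f F) W W') (rs_res \<S> W W'))\<rparr>"

definition pullback ::
    "('p, 'a) ringed_space \<Rightarrow> ('q, 'b) ringed_space \<Rightarrow> ('p, 'a, 'q, 'b) rs_map \<Rightarrow>
     ('q, 'b, 'm) mod_presheaf \<Rightarrow>
     ('p, 'a, 'p \<Rightarrow> ('p set \<times> ((('p \<Rightarrow> ('p set \<times> ('q set \<times> 'm) set) set) \<times> 'a) \<Rightarrow>\<^sub>0 int) set) set)
       mod_presheaf"
  where "pullback \<S> \<T> f F =
    assoc_mod_sheaf \<S> (\<lambda>W a x. rs_germ \<S> {x} W a) (pullback_presheaf \<S> \<T> f F)"

section \<open>Generic points\<close>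

definition irreducible_subset :: "'p topology \<Rightarrow> 'p set \<Rightarrow> bool"
  where "irreducible_subset T Z \<longleftrightarrow> Z \<subseteq> topspace T \<and> Z \<noteq> {} \<and>
    (\<forall>A B. closedin T A \<and> closedin T B \<and> Z \<subseteq> A \<union> B \<longrightarrow> Z \<subseteq> A \<or> Z \<subseteq> B)"

definition irreducible_component :: "'p topology \<Rightarrow> 'p set \<Rightarrow> bool"
  where "irreducible_component T Z \<longleftrightarrow> irreducible_subset T Z \<and>
    (\<forall>Z'. irreducible_subset T Z' \<and> Z \<subseteq> Z' \<longrightarrow> Z' = Z)"

definition generic_point :: "('p, 'a) ringed_space \<Rightarrow> 'p \<Rightarrow> bool"
  where "generic_point \<S> \<eta> \<longleftrightarrow> \<eta> \<in> topspace (rs_top \<S>) \<and>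
    irreducible_component (rs_top \<S>) (rs_top \<S> closure_of {\<eta>})"

definition generically_rank_one :: "('p, 'a) ringed_space \<Rightarrow> ('p, 'a, 'm) mod_presheaf \<Rightarrow> bool"
  where "generically_rank_one \<S> F \<longleftrightarrow>
    (\<forall>\<eta>. generic_point \<S> \<eta> \<longrightarrow> mod_iso (stalk \<S> \<eta>) (mod_stalk \<S> F \<eta>) (self_module (stalk \<S> \<eta>)))"

end

theory Submission
  imports Defs
begin

text \<open>
  Let \<open>x\<close> be a generic point of \<open>U\<close> and \<open>y = f x\<close>.  The proof has two independent halves.

  \<^item> \<open>y\<close> is a generic point of \<open>V\<close>.  On a Noetherian affine chart, a point is generic exactly if the
    nonunits of its local ring are nilpotent: for a minimal prime \<open>p\<close> this is prime avoidance
    (\<open>minimal_prime_nilpotent\<close>); conversely, as \<open>p\<close> is finitely generated, nilpotency of \<open>p\<close> in the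
    localization spreads out to a neighbourhood, which is then contained in the closure of the point
    (\<open>generic_point_if_locally_nilpotent\<close>).  The map \<open>\<O>\<^sub>y \<rightarrow> \<O>\<^sub>x\<close> is local, so it sends nonunits to
    nonunits, which are nilpotent; and it is flat and local, hence injective
    (\<open>flat_local_hom_injective\<close>), so nonunits of \<open>\<O>\<^sub>y\<close> are nilpotent as well.

  \<^item> If \<open>F\<^sub>y\<close> is free of rank 1 over \<open>\<O>\<^sub>y\<close>, then the stalk of \<open>f\<^sup>*F\<close> at \<open>x\<close> is free of rank 1 over
    \<open>\<O>\<^sub>x\<close> (\<open>pullback_stalk_rank_one\<close>).  Instead of identifying this stalk with \<open>F\<^sub>y \<otimes> \<O>\<^sub>x\<close> in
    general, a generator \<open>e\<close> of \<open>F\<^sub>y\<close> is used: it extends to a section near \<open>y\<close>, and near \<open>x\<close> every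
    section of the presheaf tensor product is of the form \<open>e \<otimes> a\<close>
    (\<open>pullback_section_multiple_of_generator\<close>).  So \<open>a \<mapsto> e \<otimes> a\<close> is onto, and the universal
    property of the tensor product supplies its inverse.

  The pullback is a sheafification, of a tensor product, of inverse images, which are themselves
  sheafifications of presheaves of germs.  All these layers are handled through one principle: an
  operation on sections that commutes with restriction induces an operation on germs, which may be
  computed on any common open set of definition (\<open>germ_op\<close>).
\<close>

section \<open>Germs of presheaves\<close>

lemma presheaf_closed:
  assumes "presheaf T C r" "openin T U" "openin T V" "V \<subseteq> U" "s \<in> C U"
  shows "r U V s \<in> C V"
proof -
  have "r U V \<in> C U \<rightarrow> C V" using assms(1-4) by (simp add: presheaf_def)
  then show ?thesis using assms(5) by (rule funcset_mem)
qed

lemma presheaf_id: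
  assumes "presheaf T C r" "openin T U" "s \<in> C U"
  shows "r U U s = s"
  using assms by (simp add: presheaf_def)

lemma presheaf_comp:
  assumes "presheaf T C r" "openin T U" "openin T V" "openin T W" "W \<subseteq> V" "V \<subseteq> U" "s \<in> C U"
  shows "r V W (r U V s) = r U W s"
  using assms by (simp add: presheaf_def)

lemma germ_in_germs:
  assumes "openin T U" "A \<subseteq> U" "s \<in> C U"
  shows "germ T C r A U s \<in> germs T C r A"
  using assms unfolding germs_def by blast

lemma germsE:
  assumes "c \<in> germs T C r A"
  obtains U s where "openin T U" "A \<subseteq> U" "s \<in> C U" "c = germ T C r A U s"
  using assms unfolding germs_def by blast

lemma mem_own_germ:
  assumes "openin T U" "A \<subseteq> U" "s \<in> C U"
  shows "(U, s) \<in> germ T C r A U s"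
  using assms unfolding germ_def by blast

lemma germ_eqI:
  assumes P: "presheaf T C r"
    and U: "openin T U" "s \<in> C U" and V: "openin T V" "t \<in> C V"
    and W: "openin T W" "A \<subseteq> W" "W \<subseteq> U" "W \<subseteq> V" "r U W s = r V W t"
  shows "germ T C r A U s = germ T C r A V t"
proof -
  have *: "germ T C r A U s \<subseteq> germ T C r A V t"
    if U: "openin T U" "s \<in> C U" and V: "openin T V" "t \<in> C V"
      and W: "W \<subseteq> U" "W \<subseteq> V" "r U W s = r V W t" for U V s t
  proof
    fix p assume "p \<in> germ T C r A U s"
    then obtain Q u W' where p: "p = (Q, u)" and Q: "openin T Q" "A \<subseteq> Q" "u \<in> C Q"
      and W': "openin T W'" "A \<subseteq> W'" "W' \<subseteq> U" "W' \<subseteq> Q" "r U W' s = r Q W' u"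
      unfolding germ_def by auto
    let ?W = "W \<inter> W'"
    have oW: "openin T ?W" using assms(6) W'(1) by blast
    have "r Q ?W u = r W' ?W (r Q W' u)"
      using presheaf_comp[OF P, OF Q(1) W'(1) oW Int_lower2 W'(4) Q(3)] by simp
    also have "\<dots> = r U ?W s"
      using presheaf_comp[OF P, OF U(1) W'(1) oW Int_lower2 W'(3) U(2)] W'(5) by simp
    also have "\<dots> = r W ?W (r U W s)"
      using presheaf_comp[OF P, OF U(1) assms(6) oW Int_lower1 W(1) U(2)] by simp
    also have "\<dots> = r V ?W t"
      using presheaf_comp[OF P, OF V(1) assms(6) oW Int_lower1 W(2) V(2)] W(3) by simp
    finally have "r V ?W t = r Q ?W u" by simp
    moreover have "A \<subseteq> ?W" "?W \<subseteq> V \<inter> Q" using W'(2,4) W(2) assms(7) by blast+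
    ultimately show "p \<in> germ T C r A V t"
      unfolding germ_def p using Q oW by blast
  qed
  show ?thesis
    by (rule subset_antisym[OF *[OF U V W(3-5)] *[OF V U W(4,3) W(5)[symmetric]]])
qed

lemma germ_eqD:
  assumes "germ T C r A U s = germ T C r A V t" "openin T V" "A \<subseteq> V" "t \<in> C V"
  obtains W where "openin T W" "A \<subseteq> W" "W \<subseteq> U" "W \<subseteq> V" "r U W s = r V W t"
proof -
  have "(V, t) \<in> germ T C r A U s" using mem_own_germ[of T V A t C r] assms by simp
  then show ?thesis using that unfolding germ_def by auto
qed

lemma germ_mem:
  assumes P: "presheaf T C r" "openin T U" "s \<in> C U" and m: "(V, t) \<in> germ T C r A U s"
  shows "openin T V" "A \<subseteq> V" "t \<in> C V" "germ T C r A V t = germ T C r A U s"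
proof -
  show V: "openin T V" "A \<subseteq> V" "t \<in> C V" using m unfolding germ_def by auto
  obtain W where "openin T W" "A \<subseteq> W" "W \<subseteq> U" "W \<subseteq> V" "r U W s = r V W t"
    using m unfolding germ_def by auto
  then show "germ T C r A V t = germ T C r A U s"
    using germ_eqI[OF P(1), OF V(1,3) P(2,3)] by metis
qed

lemma germ_restrict:
  assumes P: "presheaf T C r" and o: "openin T U" "openin T V" "A \<subseteq> V" "V \<subseteq> U" "s \<in> C U"
  shows "germ T C r A V (r U V s) = germ T C r A U s"
proof -
  have c: "r U V s \<in> C V" using presheaf_closed[OF P, OF o(1,2,4,5)] .
  show ?thesis
    using germ_eqI[OF P, OF o(2) c o(1,5) o(2,3) subset_refl o(4)] presheaf_id[OF P, OF o(2) c] by simp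
qed

text \<open>
  The operations on classes are unions over representatives.  Such a union can be evaluated at any
  representative as soon as the members agree; by the second lemma it suffices that they do not
  change under restriction.
\<close>

lemma UN_germ:
  assumes "openin T U" "A \<subseteq> U" "s \<in> C U"
    and "\<And>V t. (V, t) \<in> germ T C r A U s \<Longrightarrow> H V t = Q"
  shows "(\<Union>(V, t)\<in>germ T C r A U s. H V t) = Q"
proof -
  have "H V t = Q" if "(V, t) \<in> germ T C r A U s" for V t using assms(4)[OF that] .
  then show ?thesis
    using mem_own_germ[of T U A s C r] assms(1-3) by (auto split: prod.splits) 
qed

lemma UN_germ_cong:
  assumes P: "presheaf T C r" and U: "openin T U" "A \<subseteq> U" "s \<in> C U"
    and H: "\<And>V W t. \<lbrakk>openin T V; openin T W; A \<subseteq> W; W \<subseteq> V; t \<in> C V\<rbrakk> \<Longrightarrow> H V t = H W (r V W t)"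
  shows "(\<Union>(V, t)\<in>germ T C r A U s. H V t) = H U s"
proof (rule UN_germ[where C = C, OF U])
  fix V t assume m: "(V, t) \<in> germ T C r A U s"
  note V = germ_mem[OF P, OF U(1,3) m]
  obtain W where W: "openin T W" "A \<subseteq> W" "W \<subseteq> V" "W \<subseteq> U" "r V W t = r U W s"
    using germ_eqD[OF V(4) U] by blast
  show "H V t = H U s"
    using H[OF V(1) W(1,2,3) V(3)] H[OF U(1) W(1,2,4) U(3)] W(5) by simp
qed

text \<open>
  Restricting both arguments to a smaller open set does not change the germ of the result, so each
  of the two unions is constant.  Addition, multiplication and scalar multiplication of germs, in
  stalks as well as in inverse images, are all of this form.
\<close>

lemma germ_op:
  assumes P1: "presheaf T C1 r1" and P2: "presheaf T C2 r2" and P3: "presheaf T C3 r3"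
    and cl: "\<And>W s t. \<lbrakk>openin T W; s \<in> C1 W; t \<in> C2 W\<rbrakk> \<Longrightarrow> op W s t \<in> C3 W"
    and cm: "\<And>W W' s t. \<lbrakk>openin T W; openin T W'; W' \<subseteq> W; s \<in> C1 W; t \<in> C2 W\<rbrakk> \<Longrightarrow>
       r3 W W' (op W s t) = op W' (r1 W W' s) (r2 W W' t)"
    and U: "openin T U" "A \<subseteq> U" "s \<in> C1 U" "t \<in> C2 U"
  shows "(\<Union>(U', s')\<in>germ T C1 r1 A U s. \<Union>(V, t)\<in>germ T C2 r2 A U t.
            germ T C3 r3 A (U' \<inter> V) (op (U' \<inter> V) (r1 U' (U' \<inter> V) s') (r2 V (U' \<inter> V) t))) =
         germ T C3 r3 A U (op U s t)"
proof -
  let ?H = "\<lambda>U s V t. germ T C3 r3 A (U \<inter> V) (op (U \<inter> V) (r1 U (U \<inter> V) s) (r2 V (U \<inter> V) t))"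
  have shrink: "?H U s V t = germ T C3 r3 A W (op W (r1 U W s) (r2 V W t))"
    if "openin T U" "openin T V" "openin T W" "A \<subseteq> W" "W \<subseteq> U \<inter> V" "s \<in> C1 U" "t \<in> C2 V"
    for U s V t W
  proof -
    have o: "openin T (U \<inter> V)" using that by blast
    have c1: "r1 U (U \<inter> V) s \<in> C1 (U \<inter> V)" and c2: "r2 V (U \<inter> V) t \<in> C2 (U \<inter> V)"
      using presheaf_closed[OF P1, OF that(1) o _ that(6)] presheaf_closed[OF P2, OF that(2) o _ that(7)]
      by auto
    have "?H U s V t = germ T C3 r3 A W (r3 (U \<inter> V) W (op (U \<inter> V) (r1 U (U \<inter> V) s) (r2 V (U \<inter> V) t)))"
      using germ_restrict[OF P3, OF o that(3,4,5) cl[OF o c1 c2]] by simp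
    also have "r3 (U \<inter> V) W (op (U \<inter> V) (r1 U (U \<inter> V) s) (r2 V (U \<inter> V) t)) =
        op W (r1 U W s) (r2 V W t)"
      using cm[OF o that(3,5) c1 c2] presheaf_comp[OF P1, OF that(1) o that(3,5) _ that(6)]
        presheaf_comp[OF P2, OF that(2) o that(3,5) _ that(7)] by auto
    finally show ?thesis .
  qed
  have inner: "(\<Union>(V, t)\<in>germ T C2 r2 A U t. ?H U' s' V t) = ?H U' s' U t"
    if "openin T U'" "A \<subseteq> U'" "s' \<in> C1 U'" for U' s'
  proof (rule UN_germ_cong[OF P2, OF U(1,2,4)])
    fix V W t assume a: "openin T V" "openin T W" "A \<subseteq> W" "W \<subseteq> V" "t \<in> C2 V"
    have o: "openin T (U' \<inter> W)" using a(2) that(1) by blast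
    have cW: "r2 V W t \<in> C2 W" using presheaf_closed[OF P2, OF a(1,2,4,5)] .
    have "r2 W (U' \<inter> W) (r2 V W t) = r2 V (U' \<inter> W) t"
      using presheaf_comp[OF P2, OF a(1,2) o _ a(4,5)] by auto
    then show "?H U' s' V t = ?H U' s' W (r2 V W t)"
      using shrink[OF that(1) a(1) o _ _ that(3) a(5)] a(3,4) that(2) by auto
  qed
  have "(\<Union>(U', s')\<in>germ T C1 r1 A U s. \<Union>(V, t)\<in>germ T C2 r2 A U t. ?H U' s' V t) =
      (\<Union>(U', s')\<in>germ T C1 r1 A U s. ?H U' s' U t)"
    by (intro SUP_cong refl, unfold case_prod_beta, rule inner[unfolded case_prod_beta])
      (use germ_mem(1,2,3)[OF P1, OF U(1,3)] in force)+
  also have "\<dots> = ?H U s U t"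
  proof (rule UN_germ_cong[OF P1, OF U(1,2,3)])
    fix V W s assume a: "openin T V" "openin T W" "A \<subseteq> W" "W \<subseteq> V" "s \<in> C1 V"
    have o: "openin T (W \<inter> U)" using a(2) U(1) by blast
    have "r1 W (W \<inter> U) (r1 V W s) = r1 V (W \<inter> U) s"
      using presheaf_comp[OF P1, OF a(1,2) o _ a(4,5)] by auto
    then show "?H V s U t = ?H W (r1 V W s) U t"
      using shrink[OF a(1) U(1) o _ _ a(5) U(4)] a(3,4) U(2) by auto
  qed
  also have "\<dots> = germ T C3 r3 A U (op U s t)"
    using presheaf_id[OF P1, OF U(1,3)] presheaf_id[OF P2, OF U(1,4)] by simp
  finally show ?thesis .
qed

lemma common_representatives:
  assumes P1: "presheaf T C1 r1" and P2: "presheaf T C2 r2"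
    and c: "c \<in> germs T C1 r1 A" and d: "d \<in> germs T C2 r2 A"
  obtains U s t where "openin T U" "A \<subseteq> U" "s \<in> C1 U" "t \<in> C2 U"
    "c = germ T C1 r1 A U s" "d = germ T C2 r2 A U t"
proof -
  obtain V s where V: "openin T V" "A \<subseteq> V" "s \<in> C1 V" "c = germ T C1 r1 A V s"
    using germsE[OF c] by metis
  obtain W t where W: "openin T W" "A \<subseteq> W" "t \<in> C2 W" "d = germ T C2 r2 A W t"
    using germsE[OF d] by metis
  have o: "openin T (V \<inter> W)" "A \<subseteq> V \<inter> W" using V W by auto
  show ?thesis
    using that[OF o presheaf_closed[OF P1, OF V(1) o(1) _ V(3)] presheaf_closed[OF P2, OF W(1) o(1) _ W(3)]]
      germ_restrict[OF P1, OF V(1) o _ V(3)] germ_restrict[OF P2, OF W(1) o _ W(3)] V(4) W(4) by auto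
qed

section \<open>Presheaves of rings and modules\<close>

text \<open>
  Presheaves of sets with operations: closure and compatibility with restriction are what makes the
  operations on germs single-valued.  Both conditions pass to inverse images, to associated sheaves
  and to tensor products.
\<close>

definition ring_presheaf :: "('p, 'a) ringed_space \<Rightarrow> bool"
  where "ring_presheaf S \<longleftrightarrow>
    presheaf (rs_top S) (\<lambda>U. carrier (rs_sec S U)) (rs_res S) \<and>
    (\<forall>U. openin (rs_top S) U \<longrightarrow> (\<forall>a\<in>carrier (rs_sec S U). \<forall>b\<in>carrier (rs_sec S U).
       a \<oplus>\<^bsub>rs_sec S U\<^esub> b \<in> carrier (rs_sec S U) \<and> a \<otimes>\<^bsub>rs_sec S U\<^esub> b \<in> carrier (rs_sec S U))) \<and>
    (\<forall>U V. openin (rs_top S) U \<and> openin (rs_top S) V \<and> V \<subseteq> U \<longrightarrow>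
       (\<forall>a\<in>carrier (rs_sec S U). \<forall>b\<in>carrier (rs_sec S U).
          rs_res S U V (a \<oplus>\<^bsub>rs_sec S U\<^esub> b) = rs_res S U V a \<oplus>\<^bsub>rs_sec S V\<^esub> rs_res S U V b \<and>
          rs_res S U V (a \<otimes>\<^bsub>rs_sec S U\<^esub> b) = rs_res S U V a \<otimes>\<^bsub>rs_sec S V\<^esub> rs_res S U V b))"

definition module_presheaf :: "('p, 'a) ringed_space \<Rightarrow> ('p, 'a, 'm) mod_presheaf \<Rightarrow> bool"
  where "module_presheaf S F \<longleftrightarrow>
    presheaf (rs_top S) (\<lambda>U. carrier (ms_sec F U)) (ms_res F) \<and>
    (\<forall>U. openin (rs_top S) U \<longrightarrow> (\<forall>m\<in>carrier (ms_sec F U).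
       (\<forall>n\<in>carrier (ms_sec F U). m \<oplus>\<^bsub>ms_sec F U\<^esub> n \<in> carrier (ms_sec F U)) \<and>
       (\<forall>a\<in>carrier (rs_sec S U). a \<odot>\<^bsub>ms_sec F U\<^esub> m \<in> carrier (ms_sec F U)))) \<and>
    (\<forall>U V. openin (rs_top S) U \<and> openin (rs_top S) V \<and> V \<subseteq> U \<longrightarrow>
       (\<forall>m\<in>carrier (ms_sec F U).
          (\<forall>n\<in>carrier (ms_sec F U).
             ms_res F U V (m \<oplus>\<^bsub>ms_sec F U\<^esub> n) = ms_res F U V m \<oplus>\<^bsub>ms_sec F V\<^esub> ms_res F U V n) \<and>
          (\<forall>a\<in>carrier (rs_sec S U).
             ms_res F U V (a \<odot>\<^bsub>ms_sec F U\<^esub> m) = rs_res S U V a \<odot>\<^bsub>ms_sec F V\<^esub> ms_res F U V m)))"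

lemma ringed_space_imp_ring_presheaf:
  assumes "is_ringed_space S"
  shows "ring_presheaf S"
proof -
  have cl: "a \<oplus>\<^bsub>rs_sec S U\<^esub> b \<in> carrier (rs_sec S U)" "a \<otimes>\<^bsub>rs_sec S U\<^esub> b \<in> carrier (rs_sec S U)"
    if "openin (rs_top S) U" "a \<in> carrier (rs_sec S U)" "b \<in> carrier (rs_sec S U)" for U a b
  proof -
    have "cring (rs_sec S U)" using assms that(1) unfolding is_ringed_space_def by blast
    then interpret cring "rs_sec S U" .
    show "a \<oplus>\<^bsub>rs_sec S U\<^esub> b \<in> carrier (rs_sec S U)" "a \<otimes>\<^bsub>rs_sec S U\<^esub> b \<in> carrier (rs_sec S U)"
      using that by auto
  qed
  show ?thesis
    using assms cl by (simp add: is_ringed_space_def ring_presheaf_def sheaf_def ring_hom_def)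
qed

lemma O_module_imp_module_presheaf:
  assumes "is_O_module S F"
  shows "module_presheaf S F"
proof -
  have cl: "m \<oplus>\<^bsub>ms_sec F U\<^esub> n \<in> carrier (ms_sec F U)" "a \<odot>\<^bsub>ms_sec F U\<^esub> m \<in> carrier (ms_sec F U)"
    if "openin (rs_top S) U" "m \<in> carrier (ms_sec F U)" "n \<in> carrier (ms_sec F U)"
      "a \<in> carrier (rs_sec S U)" for U m n a
  proof -
    have "module (rs_sec S U) (ms_sec F U)" using assms that(1) by (simp add: is_O_module_def)
    then interpret module "rs_sec S U" "ms_sec F U" .
    show "m \<oplus>\<^bsub>ms_sec F U\<^esub> n \<in> carrier (ms_sec F U)" "a \<odot>\<^bsub>ms_sec F U\<^esub> m \<in> carrier (ms_sec F U)"
      using that by auto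
  qed
  have add: "m \<oplus>\<^bsub>ms_sec F U\<^esub> n \<in> carrier (ms_sec F U)"
    if "openin (rs_top S) U" "m \<in> carrier (ms_sec F U)" "n \<in> carrier (ms_sec F U)" for U m n
  proof -
    have "module (rs_sec S U) (ms_sec F U)" using assms that(1) by (simp add: is_O_module_def)
    then interpret module "rs_sec S U" "ms_sec F U" .
    show ?thesis using that by auto
  qed
  show ?thesis
    using assms add cl(2) by (simp add: is_O_module_def module_presheaf_def sheaf_def)
qed

context
  fixes S :: "('p, 'a) ringed_space"
  assumes S: "ring_presheaf S"
begin

lemma ring_presheaf_presheaf: "presheaf (rs_top S) (\<lambda>U. carrier (rs_sec S U)) (rs_res S)"
  using S unfolding ring_presheaf_def by blast

lemma ring_presheaf_ops:
  assumes "openin (rs_top S) U" "a \<in> carrier (rs_sec S U)" "b \<in> carrier (rs_sec S U)"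
  shows "a \<oplus>\<^bsub>rs_sec S U\<^esub> b \<in> carrier (rs_sec S U)" "a \<otimes>\<^bsub>rs_sec S U\<^esub> b \<in> carrier (rs_sec S U)"
  using S assms by (simp add: ring_presheaf_def)+

lemma ring_presheaf_res:
  assumes "openin (rs_top S) U" "openin (rs_top S) V" "V \<subseteq> U"
    "a \<in> carrier (rs_sec S U)" "b \<in> carrier (rs_sec S U)"
  shows "rs_res S U V (a \<oplus>\<^bsub>rs_sec S U\<^esub> b) = rs_res S U V a \<oplus>\<^bsub>rs_sec S V\<^esub> rs_res S U V b"
    "rs_res S U V (a \<otimes>\<^bsub>rs_sec S U\<^esub> b) = rs_res S U V a \<otimes>\<^bsub>rs_sec S V\<^esub> rs_res S U V b"
  using S assms by (simp add: ring_presheaf_def)+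

lemma germ_ring_ops:
  assumes "openin (rs_top S) U" "A \<subseteq> U" "a \<in> carrier (rs_sec S U)" "b \<in> carrier (rs_sec S U)"
  shows "rs_germ S A U a \<oplus>\<^bsub>germ_ring S A\<^esub> rs_germ S A U b = rs_germ S A U (a \<oplus>\<^bsub>rs_sec S U\<^esub> b)"
    "rs_germ S A U a \<otimes>\<^bsub>germ_ring S A\<^esub> rs_germ S A U b = rs_germ S A U (a \<otimes>\<^bsub>rs_sec S U\<^esub> b)"
  unfolding germ_ring_def ring_record_simps monoid.simps
  by (rule germ_op[OF ring_presheaf_presheaf ring_presheaf_presheaf ring_presheaf_presheaf];
      simp add: ring_presheaf_ops ring_presheaf_res assms)+

lemma germ_ring_carrier:
  "carrier (germ_ring S A) = germs (rs_top S) (\<lambda>U. carrier (rs_sec S U)) (rs_res S) A"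
  by (simp add: germ_ring_def)

end

context
  fixes S :: "('p, 'a) ringed_space" and F :: "('p, 'a, 'm) mod_presheaf"
  assumes S: "presheaf (rs_top S) (\<lambda>U. carrier (rs_sec S U)) (rs_res S)"
    and F: "module_presheaf S F"
begin

lemma module_presheaf_presheaf: "presheaf (rs_top S) (\<lambda>U. carrier (ms_sec F U)) (ms_res F)"
  using F unfolding module_presheaf_def by blast

lemma module_presheaf_add:
  assumes "openin (rs_top S) U" "m \<in> carrier (ms_sec F U)" "n \<in> carrier (ms_sec F U)"
  shows "m \<oplus>\<^bsub>ms_sec F U\<^esub> n \<in> carrier (ms_sec F U)"
  using F assms by (simp add: module_presheaf_def)

lemma module_presheaf_smult:
  assumes "openin (rs_top S) U" "a \<in> carrier (rs_sec S U)" "m \<in> carrier (ms_sec F U)"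
  shows "a \<odot>\<^bsub>ms_sec F U\<^esub> m \<in> carrier (ms_sec F U)"
  using F assms by (simp add: module_presheaf_def)

lemma module_presheaf_res_add:
  assumes "openin (rs_top S) U" "openin (rs_top S) V" "V \<subseteq> U"
    "m \<in> carrier (ms_sec F U)" "n \<in> carrier (ms_sec F U)"
  shows "ms_res F U V (m \<oplus>\<^bsub>ms_sec F U\<^esub> n) = ms_res F U V m \<oplus>\<^bsub>ms_sec F V\<^esub> ms_res F U V n"
  using F assms by (simp add: module_presheaf_def)

lemma module_presheaf_res_smult:
  assumes "openin (rs_top S) U" "openin (rs_top S) V" "V \<subseteq> U"
    "a \<in> carrier (rs_sec S U)" "m \<in> carrier (ms_sec F U)"
  shows "ms_res F U V (a \<odot>\<^bsub>ms_sec F U\<^esub> m) = rs_res S U V a \<odot>\<^bsub>ms_sec F V\<^esub> ms_res F U V m"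
  using F assms by (simp add: module_presheaf_def)

lemma germ_module_add:
  assumes "openin (rs_top S) U" "A \<subseteq> U" "m \<in> carrier (ms_sec F U)" "n \<in> carrier (ms_sec F U)"
  shows "ms_germ S F A U m \<oplus>\<^bsub>germ_module S F A\<^esub> ms_germ S F A U n = ms_germ S F A U (m \<oplus>\<^bsub>ms_sec F U\<^esub> n)"
  unfolding germ_module_def ring_record_simps monoid.simps
  by (rule germ_op[OF module_presheaf_presheaf module_presheaf_presheaf module_presheaf_presheaf];
      simp add: module_presheaf_add module_presheaf_res_add assms)

lemma germ_module_smult:
  assumes "openin (rs_top S) U" "A \<subseteq> U" "a \<in> carrier (rs_sec S U)" "m \<in> carrier (ms_sec F U)"
  shows "rs_germ S A U a \<odot>\<^bsub>germ_module S F A\<^esub> ms_germ S F A U m = ms_germ S F A U (a \<odot>\<^bsub>ms_sec F U\<^esub> m)"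
  unfolding germ_module_def module.simps
  by (rule germ_op[OF S module_presheaf_presheaf module_presheaf_presheaf];
      simp add: module_presheaf_smult module_presheaf_res_smult assms)

lemma germ_module_carrier:
  "carrier (germ_module S F A) = germs (rs_top S) (\<lambda>U. carrier (ms_sec F U)) (ms_res F) A"
  by (simp add: germ_module_def)

end

section \<open>Stalks of associated sheaves\<close>

lemma assoc_sectionsI:
  assumes "\<And>x. x \<in> W \<Longrightarrow> \<exists>V t. openin T V \<and> x \<in> V \<and> V \<subseteq> W \<and> t \<in> C V \<and> (\<forall>y\<in>V. \<sigma> y = germ T C r {y} V t)"
    and "\<And>x. x \<notin> W \<Longrightarrow> \<sigma> x = undefined"
  shows "\<sigma> \<in> assoc_sections T C r W"
proof -
  have "\<sigma> x \<in> germs T C r {x}" if x: "x \<in> W" for x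
  proof -
    obtain V t where V: "openin T V" "x \<in> V" "t \<in> C V" and \<sigma>: "\<forall>y\<in>V. \<sigma> y = germ T C r {y} V t"
      using assms(1)[OF x] by blast
    have "germ T C r {x} V t \<in> germs T C r {x}"
      using germ_in_germs[of T V "{x}" t C r] V by simp
    then show ?thesis using \<sigma> V(2) by simp
  qed
  then show ?thesis
    using assms unfolding assoc_sections_def by (auto simp: PiE_def extensional_def)
qed

lemma assoc_sections_germ:
  assumes "\<sigma> \<in> assoc_sections T C r W" "x \<in> W"
  shows "\<sigma> x \<in> germs T C r {x}"
  using assms unfolding assoc_sections_def by auto

lemma assoc_sections_outside:
  assumes "\<sigma> \<in> assoc_sections T C r W" "x \<notin> W"
  shows "\<sigma> x = undefined"
  using assms unfolding assoc_sections_def by auto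

lemma assoc_sectionsE:
  assumes P: "presheaf T C r" and \<sigma>: "\<sigma> \<in> assoc_sections T C r W" and x: "x \<in> W"
    and N: "openin T N" "x \<in> N"
  obtains V t where "openin T V" "x \<in> V" "V \<subseteq> W" "V \<subseteq> N" "t \<in> C V"
    "\<And>y. y \<in> V \<Longrightarrow> \<sigma> y = germ T C r {y} V t"
proof -
  obtain V t where V: "openin T V" "x \<in> V" "V \<subseteq> W" "t \<in> C V" "\<forall>y\<in>V. \<sigma> y = germ T C r {y} V t"
    using \<sigma> x unfolding assoc_sections_def by blast
  have o: "openin T (V \<inter> N)" using V N by blast
  show ?thesis
  proof (rule that[OF o _ _ _ presheaf_closed[OF P, OF V(1) o _ V(4)]])
    fix y assume y: "y \<in> V \<inter> N"
    show "\<sigma> y = germ T C r {y} (V \<inter> N) (r V (V \<inter> N) t)"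
      using germ_restrict[OF P, OF V(1) o _ _ V(4), of "{y}"] V(5) y by auto
  qed (use V N x in auto)
qed

lemma canonical_section:
  assumes "openin T V" "t \<in> C V"
  shows "(\<lambda>y\<in>V. germ T C r {y} V t) \<in> assoc_sections T C r V"
  by (rule assoc_sectionsI) (use assms in auto)

lemma assoc_presheaf:
  assumes P: "presheaf T C r"
  shows "presheaf T (assoc_sections T C r) (\<lambda>W W' \<sigma>. restrict \<sigma> W')"
proof -
  have "restrict \<sigma> W' \<in> assoc_sections T C r W'"
    if \<sigma>: "\<sigma> \<in> assoc_sections T C r W" and W': "openin T W'" "W' \<subseteq> W" for \<sigma> W W'
  proof (rule assoc_sectionsI)
    fix x assume x: "x \<in> W'"
    obtain V t where "openin T V" "x \<in> V" "V \<subseteq> W'" "t \<in> C V" "\<And>y. y \<in> V \<Longrightarrow> \<sigma> y = germ T C r {y} V t"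
      using assoc_sectionsE[OF P \<sigma> _ W'(1) x] x W'(2) by (metis subsetD)
    then show "\<exists>V t. openin T V \<and> x \<in> V \<and> V \<subseteq> W' \<and> t \<in> C V \<and> (\<forall>y\<in>V. restrict \<sigma> W' y = germ T C r {y} V t)"
      by (metis restrict_apply subsetD)
  qed simp
  moreover have "restrict \<sigma> W = \<sigma>" if "\<sigma> \<in> assoc_sections T C r W" for \<sigma> W
    using assoc_sections_outside[OF that] by (auto simp: restrict_def fun_eq_iff)
  ultimately show ?thesis
    unfolding presheaf_def by (auto simp: Int_absorb1)
qed

text \<open>
  The map from the stalk of the associated sheaf to that of the presheaf that takes a germ of \<open>\<sigma>\<close> to
  the value \<open>\<sigma> x\<close>, which is itself a germ.
\<close>

definition germ_value :: "'p \<Rightarrow> ('p set \<times> ('p \<Rightarrow> 'c set)) set \<Rightarrow> 'c set"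
  where "germ_value x c = (\<Union>(W, \<sigma>)\<in>c. \<sigma> x)"

abbreviation assoc_germ where
  "assoc_germ T C r \<equiv> germ T (assoc_sections T C r) (\<lambda>W W' \<sigma>. restrict \<sigma> W')"

abbreviation assoc_germs where
  "assoc_germs T C r \<equiv> germs T (assoc_sections T C r) (\<lambda>W W' \<sigma>. restrict \<sigma> W')"

lemma germ_value_germ:
  assumes "presheaf T C r" "openin T W" "x \<in> W" "\<sigma> \<in> assoc_sections T C r W"
  shows "germ_value x (assoc_germ T C r {x} W \<sigma>) = \<sigma> x"
  unfolding germ_value_def
  using UN_germ_cong[OF assoc_presheaf[OF assms(1)], OF assms(2), of "{x}" \<sigma> "\<lambda>W \<sigma>. \<sigma> x"] assms(3,4)
  by auto

text \<open>
  Injectivity: two sections with the same value at \<open>x\<close> are given near \<open>x\<close> by sections of the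
  presheaf with the same germ at \<open>x\<close>, and these agree on a neighbourhood.
\<close>

lemma bij_betw_germ_value:
  assumes P: "presheaf T C r"
  shows "bij_betw (germ_value x) (assoc_germs T C r {x}) (germs T C r {x})"
proof -
  have "c = d" if c: "c \<in> assoc_germs T C r {x}" and d: "d \<in> assoc_germs T C r {x}"
    and eq: "germ_value x c = germ_value x d" for c d
  proof -
    obtain W \<sigma> \<tau> where W: "openin T W" "{x} \<subseteq> W" and \<sigma>: "\<sigma> \<in> assoc_sections T C r W"
      and \<tau>: "\<tau> \<in> assoc_sections T C r W"
      and cd: "c = assoc_germ T C r {x} W \<sigma>" "d = assoc_germ T C r {x} W \<tau>"
      using common_representatives[OF assoc_presheaf[OF P] assoc_presheaf[OF P], OF c d] by metis
    have x: "x \<in> W" using W by simp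
    have e: "\<sigma> x = \<tau> x"
      using eq germ_value_germ[OF P, OF W(1) x] \<sigma> \<tau> cd by simp
    obtain V s where V: "openin T V" "x \<in> V" "V \<subseteq> W" "s \<in> C V" "\<And>y. y \<in> V \<Longrightarrow> \<sigma> y = germ T C r {y} V s"
      using assoc_sectionsE[OF P \<sigma> x W(1) x] by metis
    obtain V' t where V': "openin T V'" "x \<in> V'" "V' \<subseteq> W" "t \<in> C V'" "\<And>y. y \<in> V' \<Longrightarrow> \<tau> y = germ T C r {y} V' t"
      using assoc_sectionsE[OF P \<tau> x W(1) x] by metis
    have g: "germ T C r {x} V s = germ T C r {x} V' t" using e V(2,5) V'(2,5) by metis
    obtain N where N: "openin T N" "{x} \<subseteq> N" "N \<subseteq> V" "N \<subseteq> V'" "r V N s = r V' N t"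
      using germ_eqD[OF g V'(1) _ V'(4)] V'(2) by auto
    have "\<sigma> y = \<tau> y" if y: "y \<in> N" for y
      using germ_restrict[OF P, OF V(1) N(1) _ N(3) V(4), of "{y}"]
        germ_restrict[OF P, OF V'(1) N(1) _ N(4) V'(4), of "{y}"] N(5) V(5) V'(5) subsetD[OF N(3) y] subsetD[OF N(4) y] y
      by simp
    then have "restrict \<sigma> N = restrict \<tau> N" by (auto simp: restrict_def fun_eq_iff)
    then show "c = d"
      unfolding cd
      by (intro germ_eqI[OF assoc_presheaf[OF P], OF W(1) \<sigma> W(1) \<tau> N(1,2)]) (use N(3,4) V(3) V'(3) in auto)
  qed
  then have inj: "inj_on (germ_value x) (assoc_germs T C r {x})" by (rule inj_onI)
  have into: "germ_value x c \<in> germs T C r {x}" if c: "c \<in> assoc_germs T C r {x}" for c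
  proof -
    obtain W \<sigma> where "openin T W" "{x} \<subseteq> W" "\<sigma> \<in> assoc_sections T C r W" "c = assoc_germ T C r {x} W \<sigma>"
      using germsE[OF c] by metis
    then show ?thesis using germ_value_germ[OF P, of W x \<sigma>] assoc_sections_germ[of \<sigma> T C r W x] by simp
  qed
  have onto: "d \<in> germ_value x ` assoc_germs T C r {x}" if d: "d \<in> germs T C r {x}" for d
  proof -
    obtain V t where V: "openin T V" "{x} \<subseteq> V" "t \<in> C V" "d = germ T C r {x} V t"
      using germsE[OF d] by metis
    let ?\<sigma> = "\<lambda>y\<in>V. germ T C r {y} V t"
    have \<sigma>: "?\<sigma> \<in> assoc_sections T C r V" using canonical_section[where C = C, OF V(1,3)] .
    have "germ_value x (assoc_germ T C r {x} V ?\<sigma>) = d"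
      using germ_value_germ[OF P, OF V(1) _ \<sigma>, of x] V by simp
    then show ?thesis
      by (rule image_eqI[OF sym germ_in_germs[where C = "assoc_sections T C r", OF V(1,2) \<sigma>]])
  qed
  show ?thesis
    unfolding bij_betw_def using inj into onto by blast
qed

text \<open>
  Scalars act on the associated sheaf through their germs \<open>ev W a x\<close>, which have to come locally
  from sections of \<open>P\<close>.  This covers two cases: \<open>f\<^sup>-\<^sup>1F\<close>, where the scalars are sections of the
  associated ring sheaf, and \<open>f\<^sup>*F\<close>, where they are sections of \<open>P\<close> itself.
\<close>

lemma assoc_mod_sheaf_module_presheaf:
  assumes PP: "presheaf (rs_top P) (\<lambda>U. carrier (rs_sec P U)) (rs_res P)"
    and F: "module_presheaf P F"
    and top: "rs_top R = rs_top P"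
    and loc: "\<And>W a x. \<lbrakk>openin (rs_top P) W; a \<in> carrier (rs_sec R W); x \<in> W\<rbrakk> \<Longrightarrow>
       \<exists>V b. openin (rs_top P) V \<and> x \<in> V \<and> V \<subseteq> W \<and> b \<in> carrier (rs_sec P V) \<and>
          (\<forall>y\<in>V. ev W a y = rs_germ P {y} V b)"
    and res: "\<And>W W' a x. \<lbrakk>openin (rs_top P) W; openin (rs_top P) W'; W' \<subseteq> W; a \<in> carrier (rs_sec R W); x \<in> W'\<rbrakk> \<Longrightarrow>
       ev W' (rs_res R W W' a) x = ev W a x"
  shows "module_presheaf R (assoc_mod_sheaf P ev F)"
proof -
  let ?T = "rs_top P" and ?C = "\<lambda>U. carrier (ms_sec F U)" and ?r = "ms_res F"
  note MP = module_presheaf_presheaf[OF PP F]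
  have add: "(\<lambda>x\<in>W. \<sigma> x \<oplus>\<^bsub>mod_stalk P F x\<^esub> \<tau> x) \<in> assoc_sections ?T ?C ?r W"
    if W: "openin ?T W" and \<sigma>: "\<sigma> \<in> assoc_sections ?T ?C ?r W" and \<tau>: "\<tau> \<in> assoc_sections ?T ?C ?r W" for W \<sigma> \<tau>
  proof (rule assoc_sectionsI)
    fix x assume x: "x \<in> W"
    obtain V s where V: "openin ?T V" "x \<in> V" "V \<subseteq> W" "s \<in> ?C V" "\<And>y. y \<in> V \<Longrightarrow> \<sigma> y = germ ?T ?C ?r {y} V s"
      using assoc_sectionsE[OF MP \<sigma> x W x] by metis
    obtain V' t where V': "openin ?T V'" "x \<in> V'" "V' \<subseteq> W" "V' \<subseteq> V" "t \<in> ?C V'" "\<And>y. y \<in> V' \<Longrightarrow> \<tau> y = germ ?T ?C ?r {y} V' t"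
      using assoc_sectionsE[OF MP \<tau> x V(1,2)] by metis
    have s': "?r V V' s \<in> ?C V'" using presheaf_closed[OF MP, OF V(1) V'(1,4) V(4)] .
    have "(\<lambda>x\<in>W. \<sigma> x \<oplus>\<^bsub>mod_stalk P F x\<^esub> \<tau> x) y = germ ?T ?C ?r {y} V' (?r V V' s \<oplus>\<^bsub>ms_sec F V'\<^esub> t)"
      if y: "y \<in> V'" for y
    proof -
      have "\<sigma> y = germ ?T ?C ?r {y} V' (?r V V' s)"
        using V(5) germ_restrict[OF MP, OF V(1) V'(1) _ V'(4) V(4), of "{y}"] y V'(4) by auto
      then show ?thesis
        using germ_module_add[OF PP F, OF V'(1) _ s' V'(5), of "{y}"] V'(6) V'(3) y by auto
    qed
    then show "\<exists>V t. openin ?T V \<and> x \<in> V \<and> V \<subseteq> W \<and> t \<in> ?C V \<and>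
        (\<forall>y\<in>V. (\<lambda>x\<in>W. \<sigma> x \<oplus>\<^bsub>mod_stalk P F x\<^esub> \<tau> x) y = germ ?T ?C ?r {y} V t)"
      using V'(1,2,3) module_presheaf_add[OF PP F, OF V'(1) s' V'(5)]
      by (intro exI[of _ V'] exI[of _ "?r V V' s \<oplus>\<^bsub>ms_sec F V'\<^esub> t"]) blast
  qed simp
  have smult: "(\<lambda>x\<in>W. ev W a x \<odot>\<^bsub>mod_stalk P F x\<^esub> \<tau> x) \<in> assoc_sections ?T ?C ?r W"
    if W: "openin ?T W" and a: "a \<in> carrier (rs_sec R W)" and \<tau>: "\<tau> \<in> assoc_sections ?T ?C ?r W" for W a \<tau>
  proof (rule assoc_sectionsI)
    fix x assume x: "x \<in> W"
    obtain V s where V: "openin ?T V" "x \<in> V" "V \<subseteq> W" "s \<in> carrier (rs_sec P V)" "\<And>y. y \<in> V \<Longrightarrow> ev W a y = rs_germ P {y} V s"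
      using loc[OF W a x] by metis
    obtain V' t where V': "openin ?T V'" "x \<in> V'" "V' \<subseteq> W" "V' \<subseteq> V" "t \<in> ?C V'" "\<And>y. y \<in> V' \<Longrightarrow> \<tau> y = germ ?T ?C ?r {y} V' t"
      using assoc_sectionsE[OF MP \<tau> x V(1,2)] by metis
    have s': "rs_res P V V' s \<in> carrier (rs_sec P V')" using presheaf_closed[OF PP, OF V(1) V'(1,4) V(4)] .
    have "(\<lambda>x\<in>W. ev W a x \<odot>\<^bsub>mod_stalk P F x\<^esub> \<tau> x) y = germ ?T ?C ?r {y} V' (rs_res P V V' s \<odot>\<^bsub>ms_sec F V'\<^esub> t)"
      if y: "y \<in> V'" for y
    proof -
      have "ev W a y = rs_germ P {y} V' (rs_res P V V' s)"
        using V(5) germ_restrict[OF PP, OF V(1) V'(1) _ V'(4) V(4), of "{y}"] y V'(4) by auto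
      then show ?thesis
        using germ_module_smult[OF PP F, OF V'(1) _ s' V'(5), of "{y}"] V'(6) V'(3) y by auto
    qed
    then show "\<exists>V t. openin ?T V \<and> x \<in> V \<and> V \<subseteq> W \<and> t \<in> ?C V \<and>
        (\<forall>y\<in>V. (\<lambda>x\<in>W. ev W a x \<odot>\<^bsub>mod_stalk P F x\<^esub> \<tau> x) y = germ ?T ?C ?r {y} V t)"
      using V'(1,2,3) module_presheaf_smult[OF PP F, OF V'(1) s' V'(5)]
      by (intro exI[of _ V'] exI[of _ "rs_res P V V' s \<odot>\<^bsub>ms_sec F V'\<^esub> t"]) blast
  qed simp
  have "restrict (\<lambda>x\<in>W. \<sigma> x \<oplus>\<^bsub>mod_stalk P F x\<^esub> \<tau> x) W' =
      (\<lambda>x\<in>W'. restrict \<sigma> W' x \<oplus>\<^bsub>mod_stalk P F x\<^esub> restrict \<tau> W' x)" if "W' \<subseteq> W" for W W' \<sigma> \<tau>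
    using that by (auto simp: restrict_def fun_eq_iff)
  moreover have "restrict (\<lambda>x\<in>W. ev W a x \<odot>\<^bsub>mod_stalk P F x\<^esub> \<tau> x) W' =
      (\<lambda>x\<in>W'. ev W' (rs_res R W W' a) x \<odot>\<^bsub>mod_stalk P F x\<^esub> restrict \<tau> W' x)"
    if "openin ?T W" "openin ?T W'" "W' \<subseteq> W" "a \<in> carrier (rs_sec R W)" for W W' a \<tau>
    using that res[OF that] by (auto simp: restrict_def fun_eq_iff)
  ultimately show ?thesis
    unfolding module_presheaf_def
    using assoc_presheaf[OF MP] add smult by (simp add: assoc_mod_sheaf_def top)
qed

text \<open>
  The operations on the associated sheaf are pointwise, so the bijection \<open>germ_value x\<close> is linear.
\<close>

lemma mod_stalk_assoc_mod_sheaf: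
  fixes S :: "('p, 'a) ringed_space" and F :: "('p, 'a, 'm) mod_presheaf"
  assumes PP: "presheaf (rs_top S) (\<lambda>U. carrier (rs_sec S U)) (rs_res S)"
    and F: "module_presheaf S F"
  defines "G \<equiv> assoc_mod_sheaf S (\<lambda>W a x. rs_germ S {x} W a) F"
  shows "mod_iso (stalk S x) (mod_stalk S G x) (mod_stalk S F x)"
proof -
  let ?T = "rs_top S" and ?C = "\<lambda>U. carrier (ms_sec F U)" and ?r = "ms_res F"
  note MP = module_presheaf_presheaf[OF PP F]
  have GP: "module_presheaf S G"
    unfolding G_def
    by (rule assoc_mod_sheaf_module_presheaf[OF PP F]) (use germ_restrict[OF PP] in auto)
  have Gsec: "carrier (ms_sec G W) = assoc_sections ?T ?C ?r W" for W
    by (simp add: G_def assoc_mod_sheaf_def)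
  have Gres: "ms_res G = (\<lambda>W W' \<sigma>. restrict \<sigma> W')"
    by (simp add: G_def assoc_mod_sheaf_def)
  have Gcar: "carrier (mod_stalk S G x) = assoc_germs ?T ?C ?r {x}"
    by (simp add: germ_module_def Gsec Gres)
  have Fcar: "carrier (mod_stalk S F x) = germs ?T ?C ?r {x}"
    by (simp add: germ_module_def)
  have AP: "presheaf ?T (assoc_sections ?T ?C ?r) (\<lambda>W W' \<sigma>. restrict \<sigma> W')" using assoc_presheaf[OF MP] .
  have "germ_value x (m \<oplus>\<^bsub>mod_stalk S G x\<^esub> n) = germ_value x m \<oplus>\<^bsub>mod_stalk S F x\<^esub> germ_value x n"
    if mn: "m \<in> assoc_germs ?T ?C ?r {x}" "n \<in> assoc_germs ?T ?C ?r {x}" for m n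
  proof -
    obtain W \<sigma> \<tau> where W: "openin ?T W" "{x} \<subseteq> W" and st: "\<sigma> \<in> assoc_sections ?T ?C ?r W" "\<tau> \<in> assoc_sections ?T ?C ?r W"
      and e: "m = assoc_germ ?T ?C ?r {x} W \<sigma>" "n = assoc_germ ?T ?C ?r {x} W \<tau>"
      using common_representatives[OF AP AP, OF mn] by metis
    have "m \<oplus>\<^bsub>mod_stalk S G x\<^esub> n = assoc_germ ?T ?C ?r {x} W (\<sigma> \<oplus>\<^bsub>ms_sec G W\<^esub> \<tau>)"
      using germ_module_add[OF PP GP, OF W, of \<sigma> \<tau>] st e by (simp add: Gsec Gres)
    moreover have "\<sigma> \<oplus>\<^bsub>ms_sec G W\<^esub> \<tau> \<in> assoc_sections ?T ?C ?r W"
      using module_presheaf_add[OF PP GP, OF W(1), of \<sigma> \<tau>] st by (simp add: Gsec)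
    ultimately have "germ_value x (m \<oplus>\<^bsub>mod_stalk S G x\<^esub> n) = (\<sigma> \<oplus>\<^bsub>ms_sec G W\<^esub> \<tau>) x"
      using germ_value_germ[OF MP, OF W(1)] W(2) by simp
    also have "\<dots> = \<sigma> x \<oplus>\<^bsub>mod_stalk S F x\<^esub> \<tau> x"
      using W(2) by (simp add: G_def assoc_mod_sheaf_def)
    finally show ?thesis using e germ_value_germ[OF MP, OF W(1)] W(2) st by simp
  qed
  moreover have "germ_value x (a \<odot>\<^bsub>mod_stalk S G x\<^esub> n) = a \<odot>\<^bsub>mod_stalk S F x\<^esub> germ_value x n"
    if mn: "a \<in> carrier (stalk S x)" "n \<in> assoc_germs ?T ?C ?r {x}" for a n
  proof -
    obtain W b \<tau> where W: "openin ?T W" "{x} \<subseteq> W" and st: "b \<in> carrier (rs_sec S W)" "\<tau> \<in> assoc_sections ?T ?C ?r W"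
      and e: "a = rs_germ S {x} W b" "n = assoc_germ ?T ?C ?r {x} W \<tau>"
      using common_representatives[OF PP AP, OF _ mn(2), of a] mn(1) by (auto simp: germ_ring_def)
    have "a \<odot>\<^bsub>mod_stalk S G x\<^esub> n = assoc_germ ?T ?C ?r {x} W (b \<odot>\<^bsub>ms_sec G W\<^esub> \<tau>)"
      using germ_module_smult[OF PP GP, OF W, of b \<tau>] st e by (simp add: Gsec Gres)
    moreover have "b \<odot>\<^bsub>ms_sec G W\<^esub> \<tau> \<in> assoc_sections ?T ?C ?r W"
      using module_presheaf_smult[OF PP GP, OF W(1), of b \<tau>] st by (simp add: Gsec)
    ultimately have "germ_value x (a \<odot>\<^bsub>mod_stalk S G x\<^esub> n) = (b \<odot>\<^bsub>ms_sec G W\<^esub> \<tau>) x"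
      using germ_value_germ[OF MP, OF W(1)] W(2) by simp
    also have "\<dots> = a \<odot>\<^bsub>mod_stalk S F x\<^esub> \<tau> x"
      using W(2) e(1) by (simp add: G_def assoc_mod_sheaf_def)
    finally show ?thesis using e germ_value_germ[OF MP, OF W(1)] W(2) st by simp
  qed
  moreover note bij = bij_betw_germ_value[OF MP, of x]
  ultimately have "germ_value x \<in> mod_hom (mod_stalk S G x) (mod_stalk S F x) (stalk S x)"
    using bij_betwE[OF bij] by (simp add: mod_hom_def Gcar Fcar)
  then show ?thesis
    unfolding mod_iso_def using bij by (auto simp: Gcar Fcar)
qed

section \<open>Inverse images\<close>

abbreviation inv_sec where
  "inv_sec T C r f \<equiv> (\<lambda>W. germs T C r (f ` W))"

abbreviation inv_res where
  "inv_res T C r f \<equiv> (\<lambda>W W' c. \<Union>(V, s)\<in>c. germ T C r (f ` W') V s)"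

lemma coarser_germ:
  assumes P: "presheaf T C r" and "openin T V" "A \<subseteq> V" "s \<in> C V" "B \<subseteq> A"
  shows "(\<Union>(V, s)\<in>germ T C r A V s. germ T C r B V s) = germ T C r B V s"
  using UN_germ_cong[where H = "germ T C r B", OF P, OF assms(2,3,4)] germ_restrict[OF P] assms(5)
  by (metis order_trans)

lemma inv_presheaf:
  assumes P: "presheaf T C r"
  shows "presheaf S (inv_sec T C r f) (inv_res T C r f)"
proof -
  have "inv_res T C r f U W c \<in> inv_sec T C r f W"
    if c: "c \<in> inv_sec T C r f U" and "W \<subseteq> U" for U W c
  proof -
    obtain V s where V: "openin T V" "f ` U \<subseteq> V" "s \<in> C V" "c = germ T C r (f ` U) V s"
      using germsE[OF c] by metis
    have sub: "f ` W \<subseteq> f ` U" using that(2) by blast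
    show ?thesis
      unfolding V(4) coarser_germ[OF P, OF V(1,2,3) sub]
      using germ_in_germs[where C = C, OF V(1) _ V(3)] sub V(2) by blast
  qed
  moreover have "inv_res T C r f U U c = c" if c: "c \<in> inv_sec T C r f U" for U c
    using germsE[OF c] coarser_germ[OF P, where A = "f ` U" and B = "f ` U"] by (metis (no_types, lifting) subset_refl)
  moreover have "inv_res T C r f W W' (inv_res T C r f U W c) = inv_res T C r f U W' c"
    if c: "c \<in> inv_sec T C r f U" and "W \<subseteq> U" "W' \<subseteq> W" for U W W' c
  proof -
    obtain V s where V: "openin T V" "f ` U \<subseteq> V" "s \<in> C V" "c = germ T C r (f ` U) V s"
      using germsE[OF c] by metis
    have sub: "f ` W \<subseteq> f ` U" "f ` W' \<subseteq> f ` W" "f ` W' \<subseteq> f ` U" using that(2,3) by blast+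
    show ?thesis
      unfolding V(4) coarser_germ[OF P, OF V(1,2,3) sub(1)] coarser_germ[OF P, OF V(1,2,3) sub(3)]
      using coarser_germ[OF P, OF V(1) _ V(3) sub(2)] sub(1) V(2) by (metis order_trans)
  qed
  ultimately show ?thesis
    by (simp only: presheaf_def Pi_iff) simp
qed

text \<open>The stalk at \<open>x\<close> of the inverse image maps to the stalk at \<open>f x\<close>.\<close>

definition inv_stalk ::
    "'q topology \<Rightarrow> ('q set \<Rightarrow> 's set) \<Rightarrow> ('q set \<Rightarrow> 'q set \<Rightarrow> 's \<Rightarrow> 's) \<Rightarrow> ('p \<Rightarrow> 'q) \<Rightarrow> 'p \<Rightarrow>
     ('p set \<times> ('q set \<times> 's) set) set \<Rightarrow> ('q set \<times> 's) set"
  where "inv_stalk T C r f x c = (\<Union>(W, d)\<in>c. \<Union>(V, s)\<in>d. germ T C r {f x} V s)"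

text \<open>The section of the inverse image, as an associated sheaf, given by a section over \<open>V \<supseteq> f W\<close>.\<close>

definition inv_section ::
    "'p topology \<Rightarrow> 'q topology \<Rightarrow> ('q set \<Rightarrow> 's set) \<Rightarrow> ('q set \<Rightarrow> 'q set \<Rightarrow> 's \<Rightarrow> 's) \<Rightarrow> ('p \<Rightarrow> 'q) \<Rightarrow>
     'p set \<Rightarrow> 'q set \<Rightarrow> 's \<Rightarrow> 'p \<Rightarrow> ('p set \<times> ('q set \<times> 's) set) set"
  where "inv_section S T C r f W V s =
    (\<lambda>y\<in>W. germ S (inv_sec T C r f) (inv_res T C r f) {y} W (germ T C r (f ` W) V s))"

abbreviation inv_sections where
  "inv_sections S T C r f \<equiv> assoc_sections S (inv_sec T C r f) (inv_res T C r f)"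

context
  fixes S :: "'p topology" and T :: "'q topology" and C :: "'q set \<Rightarrow> 's set" and r and f :: "'p \<Rightarrow> 'q"
  assumes P: "presheaf T C r"
begin

text \<open>
  An element of the stalk of the inverse image is a germ of germs.  A function of sections near
  \<open>f x\<close> that does not change under restriction is well-defined on it.
\<close>

lemma inv_stalk_UN:
  assumes W: "openin S W" "x \<in> W" and V: "openin T V" "f ` W \<subseteq> V" "s \<in> C V"
    and K: "\<And>V V' t. \<lbrakk>openin T V; openin T V'; f x \<in> V'; V' \<subseteq> V; t \<in> C V\<rbrakk> \<Longrightarrow> K V t = K V' (r V V' t)"
  shows "(\<Union>(W, d)\<in>germ S (inv_sec T C r f) (inv_res T C r f) {x} W (germ T C r (f ` W) V s).
            \<Union>(V, s)\<in>d. K V s) = K V s"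
proof -
  have in1: "(\<Union>(V, s)\<in>germ T C r (f ` W) V s. K V s) = K V s"
    if "x \<in> W" "openin T V" "f ` W \<subseteq> V" "s \<in> C V" for W V s
    by (rule UN_germ_cong[OF P, OF that(2,3,4)]) (use K that(1) in blast)
  have "(\<Union>(W, d)\<in>germ S (inv_sec T C r f) (inv_res T C r f) {x} W (germ T C r (f ` W) V s).
            \<Union>(V, s)\<in>d. K V s) = (\<Union>(V, s)\<in>germ T C r (f ` W) V s. K V s)"
  proof (rule UN_germ_cong[OF inv_presheaf[OF P, of S f]])
    show "germ T C r (f ` W) V s \<in> germs T C r (f ` W)"
      using germ_in_germs[where C = C, OF V] .
  next
    fix W W' c assume a: "{x} \<subseteq> W'" "W' \<subseteq> W" "c \<in> germs T C r (f ` W)"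
    obtain V s where V: "openin T V" "f ` W \<subseteq> V" "s \<in> C V" "c = germ T C r (f ` W) V s"
      using germsE[OF a(3)] by metis
    have V': "f ` W' \<subseteq> V" using V(2) a(2) by blast
    show "(\<Union>(V, s)\<in>c. K V s) = (\<Union>(V, s)\<in>(\<Union>(V, s)\<in>c. germ T C r (f ` W') V s). K V s)"
      unfolding V(4) coarser_germ[OF P, OF V(1,2,3) image_mono[OF a(2)]]
      using in1[OF _ V(1,2,3)] in1[OF _ V(1) V' V(3)] a(1,2) by auto
  qed (use W in auto)
  then show ?thesis using in1[OF W(2) V] by simp
qed

lemma inv_stalk_germ:
  assumes W: "openin S W" "x \<in> W" and V: "openin T V" "f ` W \<subseteq> V" "s \<in> C V"
  shows "inv_stalk T C r f x (germ S (inv_sec T C r f) (inv_res T C r f) {x} W (germ T C r (f ` W) V s))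
    = germ T C r {f x} V s"
  unfolding inv_stalk_def
  by (rule inv_stalk_UN[OF assms]) (use germ_restrict[OF P] in auto)

lemma inv_section_in:
  assumes "openin S W" "openin T V" "f ` W \<subseteq> V" "s \<in> C V"
  shows "inv_section S T C r f W V s \<in> inv_sections S T C r f W"
  unfolding inv_section_def
  using canonical_section[where C = "inv_sec T C r f", OF assms(1) germ_in_germs[where C = C, OF assms(2,3,4)]] .

lemma restrict_inv_section:
  assumes W: "openin S W" "openin S W'" "W' \<subseteq> W" and V: "openin T V" "f ` W \<subseteq> V" "s \<in> C V"
    and V': "openin T V'" "f ` W' \<subseteq> V'" "V' \<subseteq> V"
  shows "restrict (inv_section S T C r f W V s) W' = inv_section S T C r f W' V' (r V V' s)"
proof
  fix y
  have c: "germ T C r (f ` W) V s \<in> germs T C r (f ` W)"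
    using germ_in_germs[where C = C, OF V] .
  show "restrict (inv_section S T C r f W V s) W' y = inv_section S T C r f W' V' (r V V' s) y"
  proof (cases "y \<in> W'")
    case True
    then show ?thesis
      using germ_restrict[OF inv_presheaf[OF P, of S f], OF W(1,2) _ W(3) c, of "{y}"] W(3)
        coarser_germ[OF P, OF V image_mono[OF W(3)]] germ_restrict[OF P, OF V(1) V'(1,2,3) V(3)]
      by (simp add: inv_section_def subset_iff)
  qed (simp add: inv_section_def)
qed

text \<open>
  Both layers of germs disappear locally: near a point, a section of the inverse image comes from a
  section of the original presheaf near the image of the point.
\<close>

lemma inv_sections_local:
  assumes \<sigma>: "\<sigma> \<in> inv_sections S T C r f W" and x: "x \<in> W" and N: "openin S W"
  obtains W' V s where "openin S W'" "x \<in> W'" "W' \<subseteq> W" "openin T V" "f ` W' \<subseteq> V" "s \<in> C V"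
    "restrict \<sigma> W' = inv_section S T C r f W' V s"
proof -
  obtain W' c where W': "openin S W'" "x \<in> W'" "W' \<subseteq> W" "c \<in> germs T C r (f ` W')"
    "\<And>y. y \<in> W' \<Longrightarrow> \<sigma> y = germ S (inv_sec T C r f) (inv_res T C r f) {y} W' c"
    using assoc_sectionsE[OF inv_presheaf[OF P, of S f] \<sigma> x N x] by metis
  obtain V s where V: "openin T V" "f ` W' \<subseteq> V" "s \<in> C V" "c = germ T C r (f ` W') V s"
    using germsE[OF W'(4)] by metis
  have "restrict \<sigma> W' = inv_section S T C r f W' V s"
    unfolding inv_section_def using W'(5) V(4) by (auto simp: restrict_def fun_eq_iff)
  then show ?thesis using that W' V by blast
qed

end

section \<open>Tensor products\<close>

text \<open>
  The operands below are modules of sections of associated sheaves.  What the construction of the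
  tensor product uses of them is that their operations stay inside the carriers.
\<close>

definition tensor_closed :: "'r ring \<Rightarrow> ('r, 'm) module \<Rightarrow> ('r, 'n) module \<Rightarrow> bool"
  where "tensor_closed R M N \<longleftrightarrow>
    (\<forall>x\<in>carrier M. \<forall>x'\<in>carrier M. x \<oplus>\<^bsub>M\<^esub> x' \<in> carrier M) \<and>
    (\<forall>y\<in>carrier N. \<forall>y'\<in>carrier N. y \<oplus>\<^bsub>N\<^esub> y' \<in> carrier N) \<and>
    (\<forall>r\<in>carrier R. (\<forall>x\<in>carrier M. r \<odot>\<^bsub>M\<^esub> x \<in> carrier M) \<and> (\<forall>y\<in>carrier N. r \<odot>\<^bsub>N\<^esub> y \<in> carrier N))"

definition pure_tensor :: "'r ring \<Rightarrow> ('r, 'm) module \<Rightarrow> ('r, 'n) module \<Rightarrow> 'm \<Rightarrow> 'n \<Rightarrow> (('m \<times> 'n) \<Rightarrow>\<^sub>0 int) set"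
  where "pure_tensor R M N x y =
    tensor_rels R M N #>\<^bsub>free_Abelian_group (carrier M \<times> carrier N)\<^esub> frag_of (x, y)"

definition tensor_gens :: "'r ring \<Rightarrow> ('r, 'm) module \<Rightarrow> ('r, 'n) module \<Rightarrow> (('m \<times> 'n) \<Rightarrow>\<^sub>0 int) set"
  where "tensor_gens R M N =
    {frag_of (x \<oplus>\<^bsub>M\<^esub> x', y) - frag_of (x, y) - frag_of (x', y) | x x' y.
        x \<in> carrier M \<and> x' \<in> carrier M \<and> y \<in> carrier N} \<union>
     {frag_of (x, y \<oplus>\<^bsub>N\<^esub> y') - frag_of (x, y) - frag_of (x, y') | x y y'.
        x \<in> carrier M \<and> y \<in> carrier N \<and> y' \<in> carrier N} \<union>
     {frag_of (r \<odot>\<^bsub>M\<^esub> x, y) - frag_of (x, r \<odot>\<^bsub>N\<^esub> y) | r x y.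
        r \<in> carrier R \<and> x \<in> carrier M \<and> y \<in> carrier N}"

definition biadditive_balanced ::
    "'r ring \<Rightarrow> ('r, 'm) module \<Rightarrow> ('r, 'n) module \<Rightarrow> ('g, 'c) monoid_scheme \<Rightarrow> ('m \<Rightarrow> 'n \<Rightarrow> 'g) \<Rightarrow> bool"
  where "biadditive_balanced R M N G \<beta> \<longleftrightarrow>
    (\<forall>x\<in>carrier M. \<forall>y\<in>carrier N. \<beta> x y \<in> carrier G) \<and>
    (\<forall>x\<in>carrier M. \<forall>x'\<in>carrier M. \<forall>y\<in>carrier N. \<beta> (x \<oplus>\<^bsub>M\<^esub> x') y = \<beta> x y \<otimes>\<^bsub>G\<^esub> \<beta> x' y) \<and>
    (\<forall>x\<in>carrier M. \<forall>y\<in>carrier N. \<forall>y'\<in>carrier N. \<beta> x (y \<oplus>\<^bsub>N\<^esub> y') = \<beta> x y \<otimes>\<^bsub>G\<^esub> \<beta> x y') \<and>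
    (\<forall>r\<in>carrier R. \<forall>x\<in>carrier M. \<forall>y\<in>carrier N. \<beta> (r \<odot>\<^bsub>M\<^esub> x) y = \<beta> x (r \<odot>\<^bsub>N\<^esub> y))"

context
  fixes R :: "'r ring" and M :: "('r, 'm) module" and N :: "('r, 'n) module"
  assumes cl: "tensor_closed R M N"
begin

private abbreviation FA where "FA \<equiv> free_Abelian_group (carrier M \<times> carrier N)"
private abbreviation K where "K \<equiv> tensor_rels R M N"
private abbreviation T where "T \<equiv> tensor_group R M N"

lemma tensor_rels_generate: "K = generate FA (tensor_gens R M N)"
  by (simp add: tensor_rels_def tensor_gens_def)

lemma tensor_gens_carrier: "tensor_gens R M N \<subseteq> carrier FA"
proof -
  have "Poly_Mapping.keys (frag_of a - frag_of b) \<subseteq> S" if "a \<in> S" "b \<in> S" for a b :: "'m \<times> 'n" and S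
    using keys_diff[of "frag_of a" "frag_of b"] that by auto
  moreover have "Poly_Mapping.keys (frag_of a - frag_of b - frag_of c) \<subseteq> S"
    if "a \<in> S" "b \<in> S" "c \<in> S" for a b c :: "'m \<times> 'n" and S
    using keys_diff[of "frag_of a - frag_of b" "frag_of c"] keys_diff[of "frag_of a" "frag_of b"] that by auto
  ultimately show ?thesis
    using cl by (auto simp: tensor_gens_def tensor_closed_def)
qed

lemma tensor_rels_subgroup: "subgroup K FA"
  unfolding tensor_rels_generate
  by (rule group.generate_is_subgroup[OF group_free_Abelian_group tensor_gens_carrier])

lemma tensor_rels_normal: "K \<lhd> FA"
  by (rule comm_group.subgroup_imp_normal[OF abelian_free_Abelian_group tensor_rels_subgroup])

lemma comm_group_tensor: "comm_group T"
  unfolding tensor_group_def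
  by (rule comm_group.abelian_FactGroup[OF abelian_free_Abelian_group tensor_rels_subgroup])

lemma tensor_coset_hom: "group_hom FA T (\<lambda>z. K #>\<^bsub>FA\<^esub> z)"
  using normal.r_coset_hom_Mod[OF tensor_rels_normal] comm_group_tensor
  by (simp add: group_hom_def group_hom_axioms_def comm_group_def tensor_group_def)

lemma tensor_carrierE:
  assumes "c \<in> carrier T"
  obtains z where "z \<in> carrier FA" "c = K #>\<^bsub>FA\<^esub> z"
  using assms by (auto simp: tensor_group_def carrier_FactGroup)

lemma tensor_coset_rel:
  assumes "z \<in> carrier FA" "w \<in> carrier FA" "z - w \<in> tensor_gens R M N"
  shows "K #>\<^bsub>FA\<^esub> z = K #>\<^bsub>FA\<^esub> w"
proof -
  interpret \<pi>: group_hom FA T "\<lambda>z. K #>\<^bsub>FA\<^esub> z" by (rule tensor_coset_hom)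
  have d: "z - w \<in> carrier FA" using tensor_gens_carrier assms(3) by blast
  have "z - w \<in> K" unfolding tensor_rels_generate using assms(3) by (rule generate.incl)
  then have "K #>\<^bsub>FA\<^esub> (z - w) = \<one>\<^bsub>T\<^esub>"
    using group.coset_join2[OF group_free_Abelian_group d tensor_rels_subgroup] by (simp add: tensor_group_def)
  then have "K #>\<^bsub>FA\<^esub> ((z - w) + w) = K #>\<^bsub>FA\<^esub> w"
    using \<pi>.hom_mult[OF d assms(2)] \<pi>.hom_closed[OF assms(2)] by simp
  then show ?thesis by simp
qed

lemma pure_tensor_closed:
  assumes "x \<in> carrier M" "y \<in> carrier N"
  shows "pure_tensor R M N x y \<in> carrier T"
  unfolding pure_tensor_def
  by (rule group_hom.hom_closed[OF tensor_coset_hom]) (use assms in simp)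

lemma pure_tensor_biadditive: "biadditive_balanced R M N T (pure_tensor R M N)"
proof -
  interpret \<pi>: group_hom FA T "\<lambda>z. K #>\<^bsub>FA\<^esub> z" by (rule tensor_coset_hom)
  have sum: "K #>\<^bsub>FA\<^esub> frag_of a = (K #>\<^bsub>FA\<^esub> frag_of b) \<otimes>\<^bsub>T\<^esub> (K #>\<^bsub>FA\<^esub> frag_of c)"
    if "a \<in> carrier M \<times> carrier N" "b \<in> carrier M \<times> carrier N" "c \<in> carrier M \<times> carrier N"
      "frag_of a - frag_of b - frag_of c \<in> tensor_gens R M N" for a b c
  proof -
    have bc: "frag_of b \<in> carrier FA" "frag_of c \<in> carrier FA" using that by simp_all
    have "frag_of b + frag_of c \<in> carrier FA" using \<pi>.G.m_closed[OF bc] by simp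
    moreover have "frag_of a - (frag_of b + frag_of c) \<in> tensor_gens R M N"
      using that(4) by (simp add: diff_diff_add)
    ultimately show ?thesis
      using tensor_coset_rel[of "frag_of a" "frag_of b + frag_of c"] that(1) \<pi>.hom_mult[OF bc] by simp
  qed
  have "pure_tensor R M N (r \<odot>\<^bsub>M\<^esub> x) y = pure_tensor R M N x (r \<odot>\<^bsub>N\<^esub> y)"
    if "r \<in> carrier R" "x \<in> carrier M" "y \<in> carrier N" for r x y
    unfolding pure_tensor_def
    by (rule tensor_coset_rel) (use that cl in \<open>auto simp: tensor_closed_def tensor_gens_def\<close>)
  moreover have "pure_tensor R M N (x \<oplus>\<^bsub>M\<^esub> x') y = pure_tensor R M N x y \<otimes>\<^bsub>T\<^esub> pure_tensor R M N x' y"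
    if "x \<in> carrier M" "x' \<in> carrier M" "y \<in> carrier N" for x x' y
    unfolding pure_tensor_def
    by (rule sum) (use that cl in \<open>auto simp: tensor_closed_def tensor_gens_def\<close>)
  moreover have "pure_tensor R M N x (y \<oplus>\<^bsub>N\<^esub> y') = pure_tensor R M N x y \<otimes>\<^bsub>T\<^esub> pure_tensor R M N x y'"
    if "x \<in> carrier M" "y \<in> carrier N" "y' \<in> carrier N" for x y y'
    unfolding pure_tensor_def
    by (rule sum) (use that cl in \<open>auto simp: tensor_closed_def tensor_gens_def\<close>)
  ultimately show ?thesis
    unfolding biadditive_balanced_def using pure_tensor_closed by blast
qed

lemma tensor_induct [consumes 1, case_names one pure mult inv]:
  assumes c: "c \<in> carrier T"
    and one: "P \<one>\<^bsub>T\<^esub>"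
    and pure: "\<And>x y. \<lbrakk>x \<in> carrier M; y \<in> carrier N\<rbrakk> \<Longrightarrow> P (pure_tensor R M N x y)"
    and mult: "\<And>c d. \<lbrakk>c \<in> carrier T; d \<in> carrier T; P c; P d\<rbrakk> \<Longrightarrow> P (c \<otimes>\<^bsub>T\<^esub> d)"
    and inv: "\<And>c. \<lbrakk>c \<in> carrier T; P c\<rbrakk> \<Longrightarrow> P (inv\<^bsub>T\<^esub> c)"
  shows "P c"
proof -
  interpret \<pi>: group_hom FA T "\<lambda>z. K #>\<^bsub>FA\<^esub> z" by (rule tensor_coset_hom)
  obtain z where z: "z \<in> carrier FA" "c = K #>\<^bsub>FA\<^esub> z" using tensor_carrierE[OF c] by metis
  have "P (K #>\<^bsub>FA\<^esub> z)"
    using z(1)[unfolded carrier_free_Abelian_group_iff]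
  proof (induction z rule: free_Abelian_group_induct[consumes 1, case_names zero diff gen])
    case zero
    then show ?case using one \<pi>.hom_one by simp
  next
    case (diff x y)
    have x: "x \<in> carrier FA" and y: "y \<in> carrier FA" using diff by simp_all
    have "K #>\<^bsub>FA\<^esub> (x - y) = (K #>\<^bsub>FA\<^esub> x) \<otimes>\<^bsub>T\<^esub> inv\<^bsub>T\<^esub> (K #>\<^bsub>FA\<^esub> y)"
      using \<pi>.hom_mult[OF x \<pi>.G.inv_closed[OF y]] \<pi>.hom_inv[OF y] y by simp
    then show ?case
      using mult inv diff(3,4) \<pi>.hom_closed[OF x] \<pi>.hom_closed[OF y] \<pi>.H.inv_closed by metis
  next
    case (gen a)
    then show ?case using pure[of "fst a" "snd a"] by (auto simp: pure_tensor_def)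
  qed
  then show ?thesis using z(2) by simp
qed

lemma tensor_hom_eqI:
  assumes G: "group G" and g: "g \<in> hom T G" and h: "h \<in> hom T G"
    and eq: "\<And>x y. \<lbrakk>x \<in> carrier M; y \<in> carrier N\<rbrakk> \<Longrightarrow> g (pure_tensor R M N x y) = h (pure_tensor R M N x y)"
    and c: "c \<in> carrier T"
  shows "g c = h c"
proof -
  have T: "group T" using comm_group_tensor by (simp add: comm_group_def)
  interpret g: group_hom T G g using G T g by (simp add: group_hom_def group_hom_axioms_def)
  interpret h: group_hom T G h using G T h by (simp add: group_hom_def group_hom_axioms_def)
  show ?thesis
    using c by (induction c rule: tensor_induct) (simp_all add: eq)
qed

text \<open>
  The universal property: a balanced biadditive map extends to the free group on pairs, and the
  extension kills the generators of the relations.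
\<close>

lemma tensor_lift:
  assumes G: "comm_group G" and \<beta>: "biadditive_balanced R M N G \<beta>"
  obtains h where "h \<in> hom T G"
    "\<And>x y. \<lbrakk>x \<in> carrier M; y \<in> carrier N\<rbrakk> \<Longrightarrow> h (pure_tensor R M N x y) = \<beta> x y"
proof -
  interpret G: comm_group G by (rule G)
  have "(\<lambda>p. \<beta> (fst p) (snd p)) ` (carrier M \<times> carrier N) \<subseteq> carrier G"
    using \<beta> by (auto simp: biadditive_balanced_def)
  then obtain f where f: "f \<in> hom FA G"
    and f_of: "\<And>p. p \<in> carrier M \<times> carrier N \<Longrightarrow> f (frag_of p) = \<beta> (fst p) (snd p)"
    using G.free_Abelian_group_universal[of "\<lambda>p. \<beta> (fst p) (snd p)" "carrier M \<times> carrier N"] by blast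
  interpret f: group_hom FA G f
    using f G.is_group by (simp add: group_hom_def group_hom_axioms_def)
  have f_rel: "f (z - w) = \<one>\<^bsub>G\<^esub>" if "z \<in> carrier FA" "w \<in> carrier FA" "f z = f w" for z w
  proof -
    have "f (z - w) = f z \<otimes>\<^bsub>G\<^esub> inv\<^bsub>G\<^esub> f w"
      using f.hom_mult[OF that(1) f.G.inv_closed[OF that(2)]] f.hom_inv[OF that(2)] that(2) by simp
    then show ?thesis using that f.hom_closed by simp
  qed
  have f_sum: "f (frag_of a - frag_of b - frag_of c) = \<one>\<^bsub>G\<^esub>"
    if "a \<in> carrier M \<times> carrier N" "b \<in> carrier M \<times> carrier N" "c \<in> carrier M \<times> carrier N"
      "\<beta> (fst a) (snd a) = \<beta> (fst b) (snd b) \<otimes>\<^bsub>G\<^esub> \<beta> (fst c) (snd c)" for a b c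
  proof -
    have bc: "frag_of b \<in> carrier FA" "frag_of c \<in> carrier FA" "frag_of a \<in> carrier FA" using that by simp_all
    have "frag_of b + frag_of c \<in> carrier FA" using f.G.m_closed[OF bc(1,2)] by simp
    then have "f (frag_of a - (frag_of b + frag_of c)) = \<one>\<^bsub>G\<^esub>"
      using f_rel[OF bc(3)] f.hom_mult[OF bc(1,2)] f_of that by simp
    then show ?thesis by (simp add: diff_diff_add)
  qed
  have "tensor_gens R M N \<subseteq> kernel FA G f"
  proof
    fix z assume z: "z \<in> tensor_gens R M N"
    then have "f z = \<one>\<^bsub>G\<^esub>"
      unfolding tensor_gens_def
    proof (elim UnE CollectE exE conjE)
      fix x x' y assume "z = frag_of (x \<oplus>\<^bsub>M\<^esub> x', y) - frag_of (x, y) - frag_of (x', y)"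
        "x \<in> carrier M" "x' \<in> carrier M" "y \<in> carrier N"
      then show ?thesis
        using f_sum[of "(x \<oplus>\<^bsub>M\<^esub> x', y)" "(x, y)" "(x', y)"] \<beta> cl
        by (simp add: biadditive_balanced_def tensor_closed_def)
    next
      fix x y y' assume "z = frag_of (x, y \<oplus>\<^bsub>N\<^esub> y') - frag_of (x, y) - frag_of (x, y')"
        "x \<in> carrier M" "y \<in> carrier N" "y' \<in> carrier N"
      then show ?thesis
        using f_sum[of "(x, y \<oplus>\<^bsub>N\<^esub> y')" "(x, y)" "(x, y')"] \<beta> cl
        by (simp add: biadditive_balanced_def tensor_closed_def)
    next
      fix r x y assume "z = frag_of (r \<odot>\<^bsub>M\<^esub> x, y) - frag_of (x, r \<odot>\<^bsub>N\<^esub> y)"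
        "r \<in> carrier R" "x \<in> carrier M" "y \<in> carrier N"
      then show ?thesis
        using f_rel[of "frag_of (r \<odot>\<^bsub>M\<^esub> x, y)" "frag_of (x, r \<odot>\<^bsub>N\<^esub> y)"] f_of \<beta> cl
        by (simp add: biadditive_balanced_def tensor_closed_def)
    qed
    then show "z \<in> kernel FA G f"
      unfolding kernel_def using subsetD[OF tensor_gens_carrier z] by blast
  qed
  then have ker: "K \<subseteq> kernel FA G f"
    unfolding tensor_rels_generate by (rule f.G.generate_subgroup_incl[OF _ f.subgroup_kernel])
  have fib: "f z = f w" if "z \<in> carrier FA" "w \<in> carrier FA" "K #>\<^bsub>FA\<^esub> z = K #>\<^bsub>FA\<^esub> w" for z w
  proof -
    have "z \<in> K #>\<^bsub>FA\<^esub> w" using group.rcos_self[OF group_free_Abelian_group that(1) tensor_rels_subgroup] that(3) by simp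
    then obtain k where k: "k \<in> K" "z = k \<otimes>\<^bsub>FA\<^esub> w" by (auto simp: r_coset_def)
    have "k \<in> carrier FA" "f k = \<one>\<^bsub>G\<^esub>" using ker k(1) by (auto simp: kernel_def)
    then show ?thesis using f.hom_mult[OF _ that(2), of k] k(2) f.hom_closed[OF that(2)] by simp
  qed
  obtain h where h: "h \<in> hom (FA Mod K) G" "\<And>z. z \<in> carrier FA \<Longrightarrow> h (K #>\<^bsub>FA\<^esub> z) = f z"
    using FactGroup_universal[OF f tensor_rels_normal fib] by blast
  show ?thesis
    using that[of h] h f_of by (simp add: tensor_group_def pure_tensor_def)
qed

end

text \<open>
  The map \<open>g \<otimes> h\<close> along a change of scalars \<open>\<rho>\<close>.  The case \<open>\<rho> = id\<close> gives the scalar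
  multiplication of a base change; restriction of scalars from a larger to a smaller open set gives
  the restriction maps of a tensor product of sheaves.  The universal property provides a
  homomorphism with the right values on pure tensors, and on a coset the union that defines
  \<open>tensor_map\<close> consists of the value of this homomorphism only.
\<close>

lemma tensor_map:
  assumes cl: "tensor_closed R M N" and cl': "tensor_closed R' M' N'"
    and \<rho>: "\<And>r. r \<in> carrier R \<Longrightarrow> \<rho> r \<in> carrier R'"
    and g: "\<And>x. x \<in> carrier M \<Longrightarrow> g x \<in> carrier M'"
      "\<And>x x'. \<lbrakk>x \<in> carrier M; x' \<in> carrier M\<rbrakk> \<Longrightarrow> g (x \<oplus>\<^bsub>M\<^esub> x') = g x \<oplus>\<^bsub>M'\<^esub> g x'"
      "\<And>r x. \<lbrakk>r \<in> carrier R; x \<in> carrier M\<rbrakk> \<Longrightarrow> g (r \<odot>\<^bsub>M\<^esub> x) = \<rho> r \<odot>\<^bsub>M'\<^esub> g x"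
    and h: "\<And>x. x \<in> carrier N \<Longrightarrow> h x \<in> carrier N'"
      "\<And>x x'. \<lbrakk>x \<in> carrier N; x' \<in> carrier N\<rbrakk> \<Longrightarrow> h (x \<oplus>\<^bsub>N\<^esub> x') = h x \<oplus>\<^bsub>N'\<^esub> h x'"
      "\<And>r x. \<lbrakk>r \<in> carrier R; x \<in> carrier N\<rbrakk> \<Longrightarrow> h (r \<odot>\<^bsub>N\<^esub> x) = \<rho> r \<odot>\<^bsub>N'\<^esub> h x"
  shows "tensor_map R' M' N' g h \<in> hom (tensor_group R M N) (tensor_group R' M' N')"
    and "\<And>x y. \<lbrakk>x \<in> carrier M; y \<in> carrier N\<rbrakk> \<Longrightarrow>
       tensor_map R' M' N' g h (pure_tensor R M N x y) = pure_tensor R' M' N' (g x) (h y)"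
proof -
  let ?FA = "free_Abelian_group (carrier M \<times> carrier N)" and ?K = "tensor_rels R M N"
  let ?FA' = "free_Abelian_group (carrier M' \<times> carrier N')" and ?K' = "tensor_rels R' M' N'"
  let ?T = "tensor_group R M N" and ?T' = "tensor_group R' M' N'"
  let ?F = "frag_extend (\<lambda>(x, y). frag_of (g x, h y))"
  have "biadditive_balanced R M N ?T' (\<lambda>x y. pure_tensor R' M' N' (g x) (h y))"
    using pure_tensor_biadditive[OF cl'] g h \<rho> by (simp add: biadditive_balanced_def)
  then obtain \<Phi> where \<Phi>: "\<Phi> \<in> hom ?T ?T'"
    and \<Phi>_pure: "\<And>x y. \<lbrakk>x \<in> carrier M; y \<in> carrier N\<rbrakk> \<Longrightarrow> \<Phi> (pure_tensor R M N x y) = pure_tensor R' M' N' (g x) (h y)"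
    using tensor_lift[OF cl comm_group_tensor[OF cl']] by metis
  interpret \<pi>: group_hom ?FA ?T "\<lambda>z. ?K #>\<^bsub>?FA\<^esub> z" by (rule tensor_coset_hom[OF cl])
  interpret \<pi>': group_hom ?FA' ?T' "\<lambda>z. ?K' #>\<^bsub>?FA'\<^esub> z" by (rule tensor_coset_hom[OF cl'])
  interpret \<Phi>: group_hom ?T ?T' \<Phi> using \<Phi> \<pi>.H.is_group \<pi>'.H.is_group by (simp add: group_hom_def group_hom_axioms_def)
  have rep: "?F z \<in> carrier ?FA' \<and> ?K' #>\<^bsub>?FA'\<^esub> ?F z = \<Phi> (?K #>\<^bsub>?FA\<^esub> z)" if "z \<in> carrier ?FA" for z
    using that[unfolded carrier_free_Abelian_group_iff]
  proof (induction z rule: free_Abelian_group_induct[consumes 1, case_names zero diff gen])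
    case zero
    then show ?case using \<pi>.hom_one \<pi>'.hom_one \<Phi>.hom_one by simp
  next
    case (diff x y)
    have x: "x \<in> carrier ?FA" and y: "y \<in> carrier ?FA" using diff by simp_all
    have Fx: "?F x \<in> carrier ?FA'" and Fy: "?F y \<in> carrier ?FA'" using diff by simp_all
    have "?K #>\<^bsub>?FA\<^esub> (x - y) = (?K #>\<^bsub>?FA\<^esub> x) \<otimes>\<^bsub>?T\<^esub> inv\<^bsub>?T\<^esub> (?K #>\<^bsub>?FA\<^esub> y)"
      using \<pi>.hom_mult[OF x \<pi>.G.inv_closed[OF y]] \<pi>.hom_inv[OF y] y by simp
    moreover have "?K' #>\<^bsub>?FA'\<^esub> (?F x - ?F y) = (?K' #>\<^bsub>?FA'\<^esub> ?F x) \<otimes>\<^bsub>?T'\<^esub> inv\<^bsub>?T'\<^esub> (?K' #>\<^bsub>?FA'\<^esub> ?F y)"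
      using \<pi>'.hom_mult[OF Fx \<pi>'.G.inv_closed[OF Fy]] \<pi>'.hom_inv[OF Fy] Fy by simp
    moreover have "?F x - ?F y \<in> carrier ?FA'"
      using \<pi>'.G.m_closed[OF Fx \<pi>'.G.inv_closed[OF Fy]] Fy by simp
    ultimately show ?case
      using diff(3,4) \<Phi>.hom_mult[OF \<pi>.hom_closed[OF x] \<pi>.H.inv_closed[OF \<pi>.hom_closed[OF y]]]
        \<Phi>.hom_inv[OF \<pi>.hom_closed[OF y]] by (simp add: frag_extend_diff)
  next
    case (gen a)
    then show ?case
      using \<Phi>_pure[of "fst a" "snd a"] g(1) h(1) by (auto simp: pure_tensor_def)
  qed
  have eq: "tensor_map R' M' N' g h c = \<Phi> c" if c: "c \<in> carrier ?T" for c
  proof -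
    obtain z where z: "z \<in> carrier ?FA" "c = ?K #>\<^bsub>?FA\<^esub> z" using tensor_carrierE[OF cl c] by metis
    have zc: "z \<in> c" using group.rcos_self[OF group_free_Abelian_group z(1) tensor_rels_subgroup[OF cl]] z(2) by simp
    have "?K' #>\<^bsub>?FA'\<^esub> ?F w = \<Phi> c" if w: "w \<in> c" for w
    proof -
      have "w \<in> carrier ?FA"
        using monoid.r_coset_subset_G[OF group.is_monoid[OF group_free_Abelian_group] subgroup.subset[OF tensor_rels_subgroup[OF cl]] z(1)] w z(2)
        by blast
      moreover have "?K #>\<^bsub>?FA\<^esub> w = c"
        using group.repr_independence[OF group_free_Abelian_group _ z(1) tensor_rels_subgroup[OF cl]] w z(2) by metis
      ultimately show ?thesis using rep by simp
    qed
    then show ?thesis unfolding tensor_map_def using zc by auto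
  qed
  show "tensor_map R' M' N' g h \<in> hom ?T ?T'"
    using \<Phi> eq \<pi>.H.m_closed by (auto simp: hom_def Pi_iff)
  show "tensor_map R' M' N' g h (pure_tensor R M N x y) = pure_tensor R' M' N' (g x) (h y)"
    if "x \<in> carrier M" "y \<in> carrier N" for x y
    using eq[OF pure_tensor_closed[OF cl that]] \<Phi>_pure[OF that] by simp
qed

section \<open>Gluing\<close>

text \<open>Sections with the same germs have equal restrictions to the members of a covering.\<close>

lemma sheaf_eqI:
  assumes S: "sheaf T C r" and W: "openin T W" and ab: "a \<in> C W" "b \<in> C W"
    and germ: "\<And>x. x \<in> W \<Longrightarrow> germ T C r {x} W a = germ T C r {x} W b"
  shows "a = b"
proof -
  have P: "presheaf T C r" using S by (simp add: sheaf_def)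
  define \<U> where "\<U> = {N. openin T N \<and> N \<subseteq> W \<and> r W N a = r W N b}"
  have un: "\<Union>\<U> = W"
  proof
    show "W \<subseteq> \<Union>\<U>"
    proof
      fix x assume x: "x \<in> W"
      then obtain N where "openin T N" "{x} \<subseteq> N" "N \<subseteq> W" "r W N a = r W N b"
        using germ_eqD[where C = C, OF germ[OF x] W _ ab(2)] by auto
      then show "x \<in> \<Union>\<U>" by (auto simp: \<U>_def)
    qed
  qed (auto simp: \<U>_def)
  have o: "openin T (N \<inter> N')" if "N \<in> \<U>" "N' \<in> \<U>" for N N'
    using that by (auto simp: \<U>_def)
  have res: "r N (N \<inter> N') (r W N a) = r W (N \<inter> N') a" "r N' (N \<inter> N') (r W N' a) = r W (N \<inter> N') a"
    if "N \<in> \<U>" "N' \<in> \<U>" for N N'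
    using presheaf_comp[OF P, OF W _ o[OF that] Int_lower1 _ ab(1)]
      presheaf_comp[OF P, OF W _ o[OF that] Int_lower2 _ ab(1)] that by (auto simp: \<U>_def)
  have "\<exists>!t. t \<in> C (\<Union>\<U>) \<and> (\<forall>N\<in>\<U>. r (\<Union>\<U>) N t = r W N a)"
  proof (rule conjunct2[OF S[unfolded sheaf_def], rule_format], intro conjI ballI)
    fix N assume N: "N \<in> \<U>"
    then have o: "openin T N" "N \<subseteq> W" by (simp_all add: \<U>_def)
    show "openin T N" by (rule o(1))
    show "r W N a \<in> C N" by (rule presheaf_closed[OF P, OF W o ab(1)])
  qed (simp add: res)
  then obtain t where t: "\<And>u. u \<in> C W \<Longrightarrow> (\<forall>N\<in>\<U>. r W N u = r W N a) \<Longrightarrow> u = t"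
    unfolding un by (elim ex1E) blast
  have "r W N b = r W N a" if "N \<in> \<U>" for N
    using that by (simp add: \<U>_def)
  then have "a = t" "b = t"
    using t[OF ab(1)] t[OF ab(2)] by blast+
  then show ?thesis by simp
qed

text \<open>
  A sheaf is its own associated sheaf.  The sections chosen on the members of the covering agree on
  overlaps because they have the same germs there.
\<close>

lemma sheaf_section_with_germs:
  assumes S: "sheaf T C r" and W: "openin T W"
    and loc: "\<And>x. x \<in> W \<Longrightarrow> \<exists>V t. openin T V \<and> x \<in> V \<and> V \<subseteq> W \<and> t \<in> C V \<and> (\<forall>y\<in>V. \<tau> y = germ T C r {y} V t)"
  shows "\<exists>!a. a \<in> C W \<and> (\<forall>x\<in>W. germ T C r {x} W a = \<tau> x)"
proof -
  have P: "presheaf T C r" using S by (simp add: sheaf_def)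
  define \<U> where "\<U> = {N. openin T N \<and> N \<subseteq> W \<and> (\<exists>t\<in>C N. \<forall>y\<in>N. \<tau> y = germ T C r {y} N t)}"
  define s where "s N = (SOME t. t \<in> C N \<and> (\<forall>y\<in>N. \<tau> y = germ T C r {y} N t))" for N
  have s: "openin T N" "N \<subseteq> W" "s N \<in> C N" "\<And>y. y \<in> N \<Longrightarrow> \<tau> y = germ T C r {y} N (s N)" if "N \<in> \<U>" for N
  proof -
    have ex: "\<exists>t. t \<in> C N \<and> (\<forall>y\<in>N. \<tau> y = germ T C r {y} N t)"
      and N: "openin T N" "N \<subseteq> W" using that by (auto simp: \<U>_def)
    show "openin T N" "N \<subseteq> W" by (rule N)+
    show "s N \<in> C N" "\<And>y. y \<in> N \<Longrightarrow> \<tau> y = germ T C r {y} N (s N)"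
      using someI_ex[OF ex, folded s_def] by blast+
  qed
  have un: "\<Union>\<U> = W"
    using loc by (fastforce simp: \<U>_def)
  have "\<exists>!t. t \<in> C (\<Union>\<U>) \<and> (\<forall>N\<in>\<U>. r (\<Union>\<U>) N t = s N)"
  proof (rule conjunct2[OF S[unfolded sheaf_def], rule_format], intro conjI ballI)
    fix N assume N: "N \<in> \<U>"
    show "openin T N" "s N \<in> C N" by (rule s[OF N])+
    fix N' assume N': "N' \<in> \<U>"
    have o: "openin T (N \<inter> N')" using s(1)[OF N] s(1)[OF N'] by blast
    show "r N (N \<inter> N') (s N) = r N' (N \<inter> N') (s N')"
    proof (rule sheaf_eqI[OF S, OF o])
      show "r N (N \<inter> N') (s N) \<in> C (N \<inter> N')"
        using presheaf_closed[OF P, OF s(1)[OF N] o Int_lower1 s(3)[OF N]] .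
      show "r N' (N \<inter> N') (s N') \<in> C (N \<inter> N')"
        using presheaf_closed[OF P, OF s(1)[OF N'] o Int_lower2 s(3)[OF N']] .
      fix x assume x: "x \<in> N \<inter> N'"
      show "germ T C r {x} (N \<inter> N') (r N (N \<inter> N') (s N)) = germ T C r {x} (N \<inter> N') (r N' (N \<inter> N') (s N'))"
        using germ_restrict[OF P, OF s(1)[OF N] o _ Int_lower1 s(3)[OF N], of "{x}"]
          germ_restrict[OF P, OF s(1)[OF N'] o _ Int_lower2 s(3)[OF N'], of "{x}"]
          s(4)[OF N, of x] s(4)[OF N', of x] x by simp
    qed
  qed
  then obtain a where a: "a \<in> C W" "\<And>N. N \<in> \<U> \<Longrightarrow> r W N a = s N"
    unfolding un by blast
  have ga: "germ T C r {x} W a = \<tau> x" if x: "x \<in> W" for x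
  proof -
    obtain N where N: "N \<in> \<U>" "x \<in> N" using x un by blast
    show ?thesis
      using germ_restrict[OF P, OF W s(1)[OF N(1)] _ s(2)[OF N(1)] a(1), of "{x}"] a(2)[OF N(1)] s(4)[OF N] N(2)
      by simp
  qed
  show ?thesis
  proof (rule ex1I[of _ a])
    fix b assume b: "b \<in> C W \<and> (\<forall>x\<in>W. germ T C r {x} W b = \<tau> x)"
    show "b = a" by (rule sheaf_eqI[OF S, OF W]) (use a(1) b ga in auto)
  qed (use a ga in blast)
qed

lemma mod_iso_trans:
  assumes "mod_iso R M N" "mod_iso R N L"
  shows "mod_iso R M L"
proof -
  obtain g where g: "g \<in> mod_hom M N R" "bij_betw g (carrier M) (carrier N)"
    using assms(1) by (auto simp: mod_iso_def)
  obtain h where h: "h \<in> mod_hom N L R" "bij_betw h (carrier N) (carrier L)"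
    using assms(2) by (auto simp: mod_iso_def)
  have "h \<circ> g \<in> mod_hom M L R"
    using g(1) h(1) by (auto simp: mod_hom_def Pi_iff)
  then show ?thesis
    unfolding mod_iso_def using bij_betw_trans[OF g(2) h(2)] by blast
qed

lemma id_hom: "(\<lambda>x. x) \<in> hom G G"
  by (simp add: hom_def)

lemma comp_hom: "g \<in> hom G H \<Longrightarrow> h \<in> hom H I \<Longrightarrow> (\<lambda>x. h (g x)) \<in> hom G I"
  by (auto simp: hom_def Pi_iff)

section \<open>Pullback of a module\<close>

locale pulled_back_module =
  fixes U :: "('p, 'a) ringed_space"
    and V :: "('q, 'b) ringed_space"
    and f :: "('p, 'a, 'q, 'b) rs_map"
    and F :: "('q, 'b, 'm) mod_presheaf"
  assumes ringed_U: "is_ringed_space U" and ringed_V: "is_ringed_space V"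
    and morphism: "rs_morphism U V f"
    and O_module: "is_O_module V F"
begin

text \<open>
  \<open>IR\<close> and \<open>IM\<close> are the presheaves of germs along \<open>f W\<close>, \<open>AR\<close> and \<open>AM\<close> their associated sheaves;
  \<open>secR\<close>, \<open>secF\<close> produce sections of the latter, and \<open>stalkR\<close>, \<open>stalkF\<close> lead from their stalks at
  \<open>x\<close> to the stalks at \<open>f x\<close>.
\<close>

abbreviation OU where "OU \<equiv> \<lambda>W. carrier (rs_sec U W)"
abbreviation OV where "OV \<equiv> \<lambda>W. carrier (rs_sec V W)"
abbreviation FV where "FV \<equiv> \<lambda>W. carrier (ms_sec F W)"
abbreviation IR where "IR \<equiv> inv_image_ring_presheaf U V f"
abbreviation IM where "IM \<equiv> inv_image_mod_presheaf V f F"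
abbreviation AR where "AR \<equiv> inv_image_ring U V f"
abbreviation AM where "AM \<equiv> inv_image_mod U V f F"
abbreviation secR where "secR \<equiv> inv_section (rs_top U) (rs_top V) OV (rs_res V) (map_pt f)"
abbreviation secF where "secF \<equiv> inv_section (rs_top U) (rs_top V) FV (ms_res F) (map_pt f)"
abbreviation stalkR where "stalkR \<equiv> inv_stalk (rs_top V) OV (rs_res V) (map_pt f)"
abbreviation stalkF where "stalkF \<equiv> inv_stalk (rs_top V) FV (ms_res F) (map_pt f)"

subsection \<open>The inverse image\<close>

lemma ring_U: "ring_presheaf U" and ring_V: "ring_presheaf V"
  using ringed_space_imp_ring_presheaf ringed_U ringed_V by blast+

lemmas presheaf_U = ring_presheaf_presheaf[OF ring_U]
lemmas presheaf_V = ring_presheaf_presheaf[OF ring_V]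
lemmas module_F = O_module_imp_module_presheaf[OF O_module]
lemmas presheaf_F = module_presheaf_presheaf[OF presheaf_V module_F]

lemma preim_open: "openin (rs_top U) (preim U f N)" if "openin (rs_top V) N"
  using morphism that by (simp add: rs_morphism_def preim_def continuous_map_def)

lemma image_preim: "map_pt f ` W \<subseteq> N \<Longrightarrow> openin (rs_top U) W \<Longrightarrow> W \<subseteq> preim U f N"
  unfolding preim_def using openin_subset by blast

lemma map_sec_closed: "map_sec f N s \<in> OU (preim U f N)" if "openin (rs_top V) N" "s \<in> OV N"
  using morphism that by (auto simp: rs_morphism_def ring_hom_def)

lemma map_sec_res:
  assumes "openin (rs_top V) N" "openin (rs_top V) N'" "N' \<subseteq> N" "s \<in> OV N"
  shows "map_sec f N' (rs_res V N N' s) = rs_res U (preim U f N) (preim U f N') (map_sec f N s)"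
  using morphism assms by (simp add: rs_morphism_def)

lemma IR_simps: "rs_top IR = rs_top U" "carrier (rs_sec IR W) = inv_sec (rs_top V) OV (rs_res V) (map_pt f) W"
  "rs_res IR = inv_res (rs_top V) OV (rs_res V) (map_pt f)"
  by (simp_all add: inv_image_ring_presheaf_def germ_ring_def)

lemma IM_simps: "carrier (ms_sec IM W) = inv_sec (rs_top V) FV (ms_res F) (map_pt f) W"
  "ms_sec IM W = germ_module V F (map_pt f ` W)"
  "ms_res IM = inv_res (rs_top V) FV (ms_res F) (map_pt f)"
  by (simp_all add: inv_image_mod_presheaf_def germ_module_def)

lemma presheaf_IR: "presheaf (rs_top IR) (\<lambda>W. carrier (rs_sec IR W)) (rs_res IR)"
  unfolding IR_simps by (rule inv_presheaf[OF presheaf_V])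

lemma module_IM: "module_presheaf IR IM"
proof -
  have P: "presheaf (rs_top U) (\<lambda>W. carrier (ms_sec IM W)) (ms_res IM)"
    unfolding IM_simps(1,3) by (rule inv_presheaf[OF presheaf_F])
  have add: "m \<oplus>\<^bsub>ms_sec IM W\<^esub> n \<in> carrier (ms_sec IM W) \<and> (W' \<subseteq> W \<longrightarrow>
      ms_res IM W W' (m \<oplus>\<^bsub>ms_sec IM W\<^esub> n) = ms_res IM W W' m \<oplus>\<^bsub>ms_sec IM W'\<^esub> ms_res IM W W' n)"
    if mn: "m \<in> carrier (ms_sec IM W)" "n \<in> carrier (ms_sec IM W)" for W W' m n
  proof -
    let ?A = "map_pt f ` W" and ?B = "map_pt f ` W'"
    obtain N s t where N: "openin (rs_top V) N" "?A \<subseteq> N" and st: "s \<in> FV N" "t \<in> FV N"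
      and e: "m = ms_germ V F ?A N s" "n = ms_germ V F ?A N t"
      using common_representatives[OF presheaf_F presheaf_F] mn[unfolded IM_simps(1)] by metis
    have sum: "s \<oplus>\<^bsub>ms_sec F N\<^esub> t \<in> FV N"
      using module_presheaf_add[OF presheaf_V module_F, OF N(1) st] .
    have mn': "m \<oplus>\<^bsub>ms_sec IM W\<^esub> n = ms_germ V F ?A N (s \<oplus>\<^bsub>ms_sec F N\<^esub> t)"
      unfolding e IM_simps using germ_module_add[OF presheaf_V module_F, OF N st] .
    have "ms_res IM W W' (m \<oplus>\<^bsub>ms_sec IM W\<^esub> n) = ms_res IM W W' m \<oplus>\<^bsub>ms_sec IM W'\<^esub> ms_res IM W W' n"
      if "W' \<subseteq> W"
    proof -
      have B: "?B \<subseteq> ?A" "?B \<subseteq> N" using that N(2) by blast+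
      show ?thesis
        unfolding mn' unfolding e IM_simps
        using coarser_germ[OF presheaf_F, OF N sum B(1)] coarser_germ[OF presheaf_F, OF N st(1) B(1)]
          coarser_germ[OF presheaf_F, OF N st(2) B(1)] germ_module_add[OF presheaf_V module_F, OF N(1) B(2) st]
        by simp
    qed
    then show ?thesis
      unfolding mn' IM_simps(1) using germ_in_germs[where C = FV, OF N sum] by simp
  qed
  have smult: "a \<odot>\<^bsub>ms_sec IM W\<^esub> n \<in> carrier (ms_sec IM W) \<and> (W' \<subseteq> W \<longrightarrow>
      ms_res IM W W' (a \<odot>\<^bsub>ms_sec IM W\<^esub> n) = rs_res IR W W' a \<odot>\<^bsub>ms_sec IM W'\<^esub> ms_res IM W W' n)"
    if mn: "a \<in> carrier (rs_sec IR W)" "n \<in> carrier (ms_sec IM W)" for W W' a n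
  proof -
    let ?A = "map_pt f ` W" and ?B = "map_pt f ` W'"
    obtain N s t where N: "openin (rs_top V) N" "?A \<subseteq> N" and st: "s \<in> OV N" "t \<in> FV N"
      and e: "a = rs_germ V ?A N s" "n = ms_germ V F ?A N t"
      using common_representatives[OF presheaf_V presheaf_F] mn[unfolded IM_simps(1) IR_simps(2)] by metis
    have sum: "s \<odot>\<^bsub>ms_sec F N\<^esub> t \<in> FV N"
      using module_presheaf_smult[OF presheaf_V module_F, OF N(1) st] .
    have mn': "a \<odot>\<^bsub>ms_sec IM W\<^esub> n = ms_germ V F ?A N (s \<odot>\<^bsub>ms_sec F N\<^esub> t)"
      unfolding e IM_simps using germ_module_smult[OF presheaf_V module_F, OF N st] .
    have "ms_res IM W W' (a \<odot>\<^bsub>ms_sec IM W\<^esub> n) = rs_res IR W W' a \<odot>\<^bsub>ms_sec IM W'\<^esub> ms_res IM W W' n"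
      if "W' \<subseteq> W"
    proof -
      have B: "?B \<subseteq> ?A" "?B \<subseteq> N" using that N(2) by blast+
      show ?thesis
        unfolding mn' unfolding e IM_simps IR_simps
        using coarser_germ[OF presheaf_F, OF N sum B(1)] coarser_germ[OF presheaf_V, OF N st(1) B(1)]
          coarser_germ[OF presheaf_F, OF N st(2) B(1)] germ_module_smult[OF presheaf_V module_F, OF N(1) B(2) st]
        by simp
    qed
    then show ?thesis
      unfolding mn' IM_simps(1) using germ_in_germs[where C = FV, OF N sum] by simp
  qed
  show ?thesis
    using P add smult unfolding module_presheaf_def IR_simps(1) by metis
qed

lemmas presheaf_IM = module_presheaf_presheaf[OF presheaf_IR module_IM]

lemma AR_simps: "rs_top AR = rs_top U"
  "carrier (rs_sec AR W) = inv_sections (rs_top U) (rs_top V) OV (rs_res V) (map_pt f) W"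
  "rs_res AR = (\<lambda>W W' \<sigma>. restrict \<sigma> W')"
  by (simp_all add: inv_image_ring_def assoc_ring_sheaf_def pointwise_ring_def IR_simps)

lemma AM_simps:
  "carrier (ms_sec AM W) = inv_sections (rs_top U) (rs_top V) FV (ms_res F) (map_pt f) W"
  "ms_res AM = (\<lambda>W W' \<sigma>. restrict \<sigma> W')"
  "a \<odot>\<^bsub>ms_sec AM W\<^esub> \<sigma> = (\<lambda>x\<in>W. a x \<odot>\<^bsub>mod_stalk IR IM x\<^esub> \<sigma> x)"
  "\<sigma> \<oplus>\<^bsub>ms_sec AM W\<^esub> \<tau> = (\<lambda>x\<in>W. \<sigma> x \<oplus>\<^bsub>mod_stalk IR IM x\<^esub> \<tau> x)"
  by (simp_all add: inv_image_mod_def assoc_mod_sheaf_def IR_simps IM_simps(1,3))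

lemma module_AM: "module_presheaf AR AM"
  unfolding inv_image_mod_def
proof (rule assoc_mod_sheaf_module_presheaf[OF presheaf_IR module_IM])
  show "rs_top AR = rs_top IR" by (simp add: AR_simps IR_simps)
next
  fix W a x assume a: "openin (rs_top IR) W" "a \<in> carrier (rs_sec AR W)" "x \<in> W"
  have a2: "a \<in> assoc_sections (rs_top IR) (\<lambda>W. carrier (rs_sec IR W)) (rs_res IR) W"
    using a(2) unfolding AR_simps IR_simps .
  show "\<exists>N b. openin (rs_top IR) N \<and> x \<in> N \<and> N \<subseteq> W \<and> b \<in> carrier (rs_sec IR N) \<and>
          (\<forall>y\<in>N. a y = rs_germ IR {y} N b)"
    using assoc_sectionsE[OF presheaf_IR, OF a2 a(3) a(1) a(3)] by metis
qed (simp add: AR_simps)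

lemma presheaf_AR: "presheaf (rs_top AR) (\<lambda>W. carrier (rs_sec AR W)) (rs_res AR)"
  unfolding AR_simps by (rule assoc_presheaf[OF inv_presheaf[OF presheaf_V]])

lemmas presheaf_AM = module_presheaf_presheaf[OF presheaf_AR module_AM]

lemma smult_inv_section:
  assumes W: "openin (rs_top U) W" and N: "openin (rs_top V) N" "map_pt f ` W \<subseteq> N"
    and a: "a \<in> OV N" and m: "m \<in> FV N"
  shows "secR W N a \<odot>\<^bsub>ms_sec AM W\<^esub> secF W N m = secF W N (a \<odot>\<^bsub>ms_sec F N\<^esub> m)"
proof
  fix y
  show "(secR W N a \<odot>\<^bsub>ms_sec AM W\<^esub> secF W N m) y = secF W N (a \<odot>\<^bsub>ms_sec F N\<^esub> m) y"
  proof (cases "y \<in> W")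
    case True
    let ?A = "map_pt f ` W"
    have "rs_germ V ?A N a \<in> carrier (rs_sec IR W)" "ms_germ V F ?A N m \<in> carrier (ms_sec IM W)"
      unfolding IR_simps IM_simps(1) using germ_in_germs[where C = OV, OF N a] germ_in_germs[where C = FV, OF N m] .
    from germ_module_smult[OF presheaf_IR module_IM, OF _ _ this, of "{y}"]
    have "rs_germ IR {y} W (rs_germ V ?A N a) \<odot>\<^bsub>mod_stalk IR IM y\<^esub> ms_germ IR IM {y} W (ms_germ V F ?A N m) =
      ms_germ IR IM {y} W (rs_germ V ?A N a \<odot>\<^bsub>germ_module V F ?A\<^esub> ms_germ V F ?A N m)"
      using W True by (simp add: IR_simps(1) IM_simps(2))
    then show ?thesis
      using True germ_module_smult[OF presheaf_V module_F, OF N a m]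
      unfolding AM_simps inv_section_def by (simp add: IR_simps IM_simps(1,3))
  qed (simp add: AM_simps inv_section_def)
qed

lemma mod_stalk_IM_carrier:
  "carrier (mod_stalk IR IM x) = germs (rs_top U) (inv_sec (rs_top V) FV (ms_res F) (map_pt f))
     (inv_res (rs_top V) FV (ms_res F) (map_pt f)) {x}"
  by (simp add: germ_module_def IM_simps(1,3) IR_simps(1))

lemma stalk_IR_carrier:
  "carrier (stalk IR x) = germs (rs_top U) (inv_sec (rs_top V) OV (rs_res V) (map_pt f))
     (inv_res (rs_top V) OV (rs_res V) (map_pt f)) {x}"
  by (simp add: germ_ring_def IR_simps)

lemma stalkF_closed:
  assumes "c \<in> carrier (mod_stalk IR IM x)"
  shows "stalkF x c \<in> carrier (mod_stalk V F (map_pt f x))"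
proof -
  obtain W d where W: "openin (rs_top U) W" "{x} \<subseteq> W" "d \<in> inv_sec (rs_top V) FV (ms_res F) (map_pt f) W"
    "c = germ (rs_top U) (inv_sec (rs_top V) FV (ms_res F) (map_pt f)) (inv_res (rs_top V) FV (ms_res F) (map_pt f)) {x} W d"
    using germsE[OF assms[unfolded mod_stalk_IM_carrier]] by metis
  obtain N s where N: "openin (rs_top V) N" "map_pt f ` W \<subseteq> N" "s \<in> FV N" "d = ms_germ V F (map_pt f ` W) N s"
    using germsE[OF W(3)] by metis
  show ?thesis
    unfolding W(4) N(4) germ_module_carrier[OF presheaf_V module_F]
    using inv_stalk_germ[OF presheaf_F, OF W(1) _ N(1,2,3), of x]
      germ_in_germs[where C = FV, OF N(1) _ N(3), of "{map_pt f x}"] W(2) N(2) by auto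
qed

lemma stalkR_closed:
  assumes "c \<in> carrier (stalk IR x)"
  shows "stalkR x c \<in> carrier (stalk V (map_pt f x))"
proof -
  obtain W d where W: "openin (rs_top U) W" "{x} \<subseteq> W" "d \<in> inv_sec (rs_top V) OV (rs_res V) (map_pt f) W"
    "c = germ (rs_top U) (inv_sec (rs_top V) OV (rs_res V) (map_pt f)) (inv_res (rs_top V) OV (rs_res V) (map_pt f)) {x} W d"
    using germsE[OF assms[unfolded stalk_IR_carrier]] by metis
  obtain N s where N: "openin (rs_top V) N" "map_pt f ` W \<subseteq> N" "s \<in> OV N" "d = rs_germ V (map_pt f ` W) N s"
    using germsE[OF W(3)] by metis
  show ?thesis
    unfolding W(4) N(4) germ_ring_carrier[OF ring_V]
    using inv_stalk_germ[OF presheaf_V, OF W(1) _ N(1,2,3), of x]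
      germ_in_germs[where C = OV, OF N(1) _ N(3), of "{map_pt f x}"] W(2) N(2) by auto
qed

lemma stalkF_add:
  assumes c: "c \<in> carrier (mod_stalk IR IM x)" and d: "d \<in> carrier (mod_stalk IR IM x)"
  shows "stalkF x (c \<oplus>\<^bsub>mod_stalk IR IM x\<^esub> d) = stalkF x c \<oplus>\<^bsub>mod_stalk V F (map_pt f x)\<^esub> stalkF x d"
proof -
  obtain W m n where W: "openin (rs_top IR) W" "{x} \<subseteq> W" and mn: "m \<in> carrier (ms_sec IM W)" "n \<in> carrier (ms_sec IM W)"
    and cd: "c = ms_germ IR IM {x} W m" "d = ms_germ IR IM {x} W n"
    using common_representatives[OF presheaf_IM presheaf_IM] c d
    unfolding germ_module_carrier[OF presheaf_IR module_IM] by metis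
  let ?A = "map_pt f ` W"
  obtain N s t where N: "openin (rs_top V) N" "?A \<subseteq> N" and st: "s \<in> FV N" "t \<in> FV N"
    and e: "m = ms_germ V F ?A N s" "n = ms_germ V F ?A N t"
    using common_representatives[OF presheaf_F presheaf_F] mn[unfolded IM_simps(1)] by metis
  have W': "openin (rs_top U) W" "x \<in> W" using W by (simp_all add: IR_simps)
  have x: "{map_pt f x} \<subseteq> N" using W'(2) N(2) by blast
  have "c \<oplus>\<^bsub>mod_stalk IR IM x\<^esub> d = ms_germ IR IM {x} W (ms_germ V F ?A N (s \<oplus>\<^bsub>ms_sec F N\<^esub> t))"
    unfolding cd germ_module_add[OF presheaf_IR module_IM, OF W mn]
    unfolding e IM_simps(2) germ_module_add[OF presheaf_V module_F, OF N st] ..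
  then show ?thesis
    using inv_stalk_germ[OF presheaf_F, OF W' N] st module_presheaf_add[OF presheaf_V module_F, OF N(1) st]
      germ_module_add[OF presheaf_V module_F, OF N(1) x st]
    unfolding cd e IR_simps IM_simps(1,3) by simp
qed

lemma stalkF_smult:
  assumes c: "c \<in> carrier (stalk IR x)" and d: "d \<in> carrier (mod_stalk IR IM x)"
  shows "stalkF x (c \<odot>\<^bsub>mod_stalk IR IM x\<^esub> d) = stalkR x c \<odot>\<^bsub>mod_stalk V F (map_pt f x)\<^esub> stalkF x d"
proof -
  obtain W m n where W: "openin (rs_top IR) W" "{x} \<subseteq> W" and mn: "m \<in> carrier (rs_sec IR W)" "n \<in> carrier (ms_sec IM W)"
    and cd: "c = rs_germ IR {x} W m" "d = ms_germ IR IM {x} W n"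
    using common_representatives[OF presheaf_IR presheaf_IM] c d
    unfolding germ_module_carrier[OF presheaf_IR module_IM] stalk_IR_carrier IR_simps by metis
  let ?A = "map_pt f ` W"
  obtain N s t where N: "openin (rs_top V) N" "?A \<subseteq> N" and st: "s \<in> OV N" "t \<in> FV N"
    and e: "m = rs_germ V ?A N s" "n = ms_germ V F ?A N t"
    using common_representatives[OF presheaf_V presheaf_F] mn[unfolded IM_simps(1) IR_simps(2)] by metis
  have W': "openin (rs_top U) W" "x \<in> W" using W by (simp_all add: IR_simps)
  have x: "{map_pt f x} \<subseteq> N" using W'(2) N(2) by blast
  have "c \<odot>\<^bsub>mod_stalk IR IM x\<^esub> d = ms_germ IR IM {x} W (ms_germ V F ?A N (s \<odot>\<^bsub>ms_sec F N\<^esub> t))"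
    unfolding cd germ_module_smult[OF presheaf_IR module_IM, OF W mn]
    unfolding e IM_simps(2) germ_module_smult[OF presheaf_V module_F, OF N st] ..
  then show ?thesis
    using inv_stalk_germ[OF presheaf_F, OF W' N] inv_stalk_germ[OF presheaf_V, OF W' N] st
      module_presheaf_smult[OF presheaf_V module_F, OF N(1) st]
      germ_module_smult[OF presheaf_V module_F, OF N(1) x st]
    unfolding cd e IR_simps IM_simps(1,3) by simp
qed

subsection \<open>The pullback before sheafification\<close>

lemma stalk_map_germ:
  assumes N: "openin (rs_top V) N" "map_pt f x \<in> N" "s \<in> OV N" and x: "x \<in> topspace (rs_top U)"
  shows "stalk_map U f x (rs_germ V {map_pt f x} N s) = rs_germ U {x} (preim U f N) (map_sec f N s)"
  unfolding stalk_map_def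
proof (rule UN_germ_cong[OF presheaf_V, OF N(1) _ N(3)])
  fix N N' t assume a: "openin (rs_top V) N" "openin (rs_top V) N'" "{map_pt f x} \<subseteq> N'" "N' \<subseteq> N" "t \<in> OV N"
  have sub: "{x} \<subseteq> preim U f N'" "preim U f N' \<subseteq> preim U f N"
    using a(3,4) x by (auto simp: preim_def)
  show "rs_germ U {x} (preim U f N) (map_sec f N t) = rs_germ U {x} (preim U f N') (map_sec f N' (rs_res V N N' t))"
    unfolding map_sec_res[OF a(1,2,4,5)]
    using germ_restrict[OF presheaf_U, OF preim_open[OF a(1)] preim_open[OF a(2)] sub map_sec_closed[OF a(1,5)]] ..
qed (use N in simp)

text \<open>The union that prescribes the germs in the definition of \<open>inv_image_to_struct\<close>.\<close>

lemma struct_germ_value: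
  assumes c: "c \<in> carrier (stalk IR x)" and x: "x \<in> topspace (rs_top U)"
  shows "(\<Union>(W, d)\<in>c. \<Union>(N, s)\<in>d. rs_germ U {x} (preim U f N) (map_sec f N s)) = stalk_map U f x (stalkR x c)"
proof -
  obtain W d where W: "openin (rs_top U) W" "{x} \<subseteq> W" "d \<in> inv_sec (rs_top V) OV (rs_res V) (map_pt f) W"
    "c = germ (rs_top U) (inv_sec (rs_top V) OV (rs_res V) (map_pt f)) (inv_res (rs_top V) OV (rs_res V) (map_pt f)) {x} W d"
    using germsE[OF c[unfolded stalk_IR_carrier]] by metis
  obtain N s where N: "openin (rs_top V) N" "map_pt f ` W \<subseteq> N" "s \<in> OV N" "d = rs_germ V (map_pt f ` W) N s"
    using germsE[OF W(3)] by metis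
  have xW: "x \<in> W" and fx: "map_pt f x \<in> N" using W(2) N(2) by auto
  have "(\<Union>(W, d)\<in>c. \<Union>(N, s)\<in>d. rs_germ U {x} (preim U f N) (map_sec f N s)) =
      rs_germ U {x} (preim U f N) (map_sec f N s)"
    unfolding W(4) N(4)
  proof (rule inv_stalk_UN[OF presheaf_V, OF W(1) xW N(1,2,3)])
    fix N N' t assume a: "openin (rs_top V) N" "openin (rs_top V) N'" "map_pt f x \<in> N'" "N' \<subseteq> N" "t \<in> OV N"
    show "rs_germ U {x} (preim U f N) (map_sec f N t) = rs_germ U {x} (preim U f N') (map_sec f N' (rs_res V N N' t))"
      using stalk_map_germ[OF a(1) _ a(5) x] stalk_map_germ[OF a(2,3) presheaf_closed[OF presheaf_V, OF a(1,2,4,5)] x]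
        germ_restrict[OF presheaf_V, OF a(1,2) _ a(4,5), of "{map_pt f x}"] a(3,4) by auto
  qed
  also have "\<dots> = stalk_map U f x (stalkR x c)"
    unfolding W(4) N(4) inv_stalk_germ[OF presheaf_V, OF W(1) xW N(1,2,3)]
    using stalk_map_germ[OF N(1) fx N(3) x] ..
  finally show ?thesis .
qed

lemma section_AR_germ: "\<sigma> \<in> carrier (rs_sec AR W) \<Longrightarrow> x \<in> W \<Longrightarrow> \<sigma> x \<in> carrier (stalk IR x)"
  unfolding AR_simps stalk_IR_carrier by (rule assoc_sections_germ)

lemma section_AM_germ: "\<sigma> \<in> carrier (ms_sec AM W) \<Longrightarrow> x \<in> W \<Longrightarrow> \<sigma> x \<in> carrier (mod_stalk IR IM x)"
  unfolding AM_simps mod_stalk_IM_carrier by (rule assoc_sections_germ)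

lemma sheaf_U: "sheaf (rs_top U) OU (rs_res U)"
  using ringed_U by (simp add: is_ringed_space_def)

text \<open>
  The section sought is given near each point by \<open>map_sec f N s\<close>, where \<open>s\<close> represents \<open>\<sigma>\<close> there;
  these pieces glue since their germs are prescribed by \<open>\<sigma>\<close>.
\<close>

lemma inv_image_to_struct:
  assumes W: "openin (rs_top U) W" and \<sigma>: "\<sigma> \<in> carrier (rs_sec AR W)"
  shows "inv_image_to_struct U f W \<sigma> \<in> OU W"
    and "\<And>x. x \<in> W \<Longrightarrow> rs_germ U {x} W (inv_image_to_struct U f W \<sigma>) = stalk_map U f x (stalkR x (\<sigma> x))"
proof -
  define \<tau> where "\<tau> x = stalk_map U f x (stalkR x (\<sigma> x))" for x
  have top: "x \<in> topspace (rs_top U)" if "x \<in> W" for x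
    using that openin_subset[OF W] by blast
  have val: "(\<Union>(W', c)\<in>\<sigma> x. \<Union>(N, s)\<in>c. rs_germ U {x} (preim U f N) (map_sec f N s)) = \<tau> x" if "x \<in> W" for x
    unfolding \<tau>_def using struct_germ_value[OF section_AR_germ[OF \<sigma> that] top[OF that]] .
  have "\<exists>!a. a \<in> OU W \<and> (\<forall>x\<in>W. rs_germ U {x} W a = \<tau> x)"
  proof (rule sheaf_section_with_germs[OF sheaf_U W])
    fix x assume x: "x \<in> W"
    obtain W' N s where W': "openin (rs_top U) W'" "x \<in> W'" "W' \<subseteq> W"
      and N: "openin (rs_top V) N" "map_pt f ` W' \<subseteq> N" "s \<in> OV N" and rs: "restrict \<sigma> W' = secR W' N s"
      using inv_sections_local[OF presheaf_V, OF \<sigma>[unfolded AR_simps] x W] by metis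
    have sub: "W' \<subseteq> preim U f N" by (rule image_preim[OF N(2) W'(1)])
    note ms = map_sec_closed[OF N(1,3)] and po = preim_open[OF N(1)]
    have "\<tau> y = rs_germ U {y} W' (rs_res U (preim U f N) W' (map_sec f N s))" if y: "y \<in> W'" for y
    proof -
      have "\<sigma> y = germ (rs_top U) (inv_sec (rs_top V) OV (rs_res V) (map_pt f))
          (inv_res (rs_top V) OV (rs_res V) (map_pt f)) {y} W' (rs_germ V (map_pt f ` W') N s)"
        using fun_cong[OF rs, of y] y by (simp add: inv_section_def)
      then have "\<tau> y = stalk_map U f y (rs_germ V {map_pt f y} N s)"
        unfolding \<tau>_def using inv_stalk_germ[OF presheaf_V, OF W'(1) y N] by simp
      also have "\<dots> = rs_germ U {y} (preim U f N) (map_sec f N s)"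
        by (rule stalk_map_germ[OF N(1) _ N(3) top]) (use y N(2) W'(3) in auto)
      also have "\<dots> = rs_germ U {y} W' (rs_res U (preim U f N) W' (map_sec f N s))"
        using germ_restrict[OF presheaf_U, OF po W'(1) _ sub ms, of "{y}"] y by simp
      finally show ?thesis .
    qed
    then show "\<exists>N t. openin (rs_top U) N \<and> x \<in> N \<and> N \<subseteq> W \<and> t \<in> OU N \<and> (\<forall>y\<in>N. \<tau> y = rs_germ U {y} N t)"
      using W' presheaf_closed[OF presheaf_U, OF po W'(1) sub ms] by blast
  qed
  then have ex: "\<exists>!a. a \<in> OU W \<and> (\<forall>x\<in>W. rs_germ U {x} W a =
      (\<Union>(W', c)\<in>\<sigma> x. \<Union>(N, s)\<in>c. rs_germ U {x} (preim U f N) (map_sec f N s)))"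
    using val by simp
  note a = theI'[OF ex, folded inv_image_to_struct_def]
  show "inv_image_to_struct U f W \<sigma> \<in> OU W" using a by blast
  show "rs_germ U {x} W (inv_image_to_struct U f W \<sigma>) = stalk_map U f x (stalkR x (\<sigma> x))" if "x \<in> W" for x
    using a that val[OF that] unfolding \<tau>_def by simp
qed

lemma inv_image_to_struct_restrict:
  assumes W: "openin (rs_top U) W" "openin (rs_top U) W'" "W' \<subseteq> W" and \<sigma>: "\<sigma> \<in> carrier (rs_sec AR W)"
  shows "inv_image_to_struct U f W' (restrict \<sigma> W') = rs_res U W W' (inv_image_to_struct U f W \<sigma>)"
proof (rule sheaf_eqI[OF sheaf_U, OF W(2)])
  have r: "restrict \<sigma> W' \<in> carrier (rs_sec AR W')"
    using presheaf_closed[OF presheaf_AR, OF _ _ W(3) \<sigma>] W(1,2) by (simp add: AR_simps(1,3))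
  note s = inv_image_to_struct[OF W(1) \<sigma>] and s' = inv_image_to_struct[OF W(2) r]
  show "inv_image_to_struct U f W' (restrict \<sigma> W') \<in> OU W'" by (rule s'(1))
  show "rs_res U W W' (inv_image_to_struct U f W \<sigma>) \<in> OU W'"
    by (rule presheaf_closed[OF presheaf_U, OF W s(1)])
  fix x assume x: "x \<in> W'"
  then show "rs_germ U {x} W' (inv_image_to_struct U f W' (restrict \<sigma> W')) =
      rs_germ U {x} W' (rs_res U W W' (inv_image_to_struct U f W \<sigma>))"
    using germ_restrict[OF presheaf_U, OF W(1,2) _ W(3) s(1), of "{x}"] s(2)[of x] s'(2)[of x] W(3) by auto
qed

text \<open>
  \<open>PF\<close> is the presheaf of tensor products whose associated sheaf is the pullback, and \<open>pt W\<close> forms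
  the pure tensors in its sections \<open>TG W\<close>.
\<close>

abbreviation NM where "NM W \<equiv> alg_module (inv_image_to_struct U f W) (rs_sec U W)"
abbreviation PF where "PF \<equiv> pullback_presheaf U V f F"
abbreviation TG where "TG W \<equiv> tensor_group (rs_sec AR W) (ms_sec AM W) (NM W)"
abbreviation pt where "pt W \<equiv> pure_tensor (rs_sec AR W) (ms_sec AM W) (NM W)"

lemma cring_sec: "cring (rs_sec U W)" if "openin (rs_top U) W"
  using ringed_U that by (simp add: is_ringed_space_def)

lemma NM_simps: "carrier (NM W) = OU W" "a \<oplus>\<^bsub>NM W\<^esub> b = a \<oplus>\<^bsub>rs_sec U W\<^esub> b"
  "r \<odot>\<^bsub>NM W\<^esub> b = inv_image_to_struct U f W r \<otimes>\<^bsub>rs_sec U W\<^esub> b"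
  by (simp_all add: alg_module_def)

lemma pullback_tensor_closed:
  assumes W: "openin (rs_top U) W"
  shows "tensor_closed (rs_sec AR W) (ms_sec AM W) (NM W)"
proof -
  have o: "openin (rs_top AR) W" using W by (simp add: AR_simps(1))
  show ?thesis
    unfolding tensor_closed_def NM_simps
    using module_presheaf_add[OF presheaf_AR module_AM, OF o] module_presheaf_smult[OF presheaf_AR module_AM, OF o]
      ring_presheaf_ops[OF ring_U, OF W] inv_image_to_struct(1)[OF W] by blast
qed

lemma PF_simps: "carrier (ms_sec PF W) = carrier (TG W)"
  "c \<oplus>\<^bsub>ms_sec PF W\<^esub> d = c \<otimes>\<^bsub>TG W\<^esub> d"
  "b \<odot>\<^bsub>ms_sec PF W\<^esub> c = tensor_map (rs_sec AR W) (ms_sec AM W) (NM W) (\<lambda>x. x) (\<lambda>s. b \<otimes>\<^bsub>rs_sec U W\<^esub> s) c"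
  "ms_res PF W W' = tensor_map (rs_sec AR W') (ms_sec AM W') (NM W') (\<lambda>\<sigma>. restrict \<sigma> W') (rs_res U W W')"
  by (simp_all add: pullback_presheaf_def base_change_def Let_def AM_simps(2))

lemma pullback_res:
  assumes W: "openin (rs_top U) W" "openin (rs_top U) W'" "W' \<subseteq> W"
  shows "ms_res PF W W' \<in> hom (TG W) (TG W')"
    and "\<And>\<sigma> a. \<lbrakk>\<sigma> \<in> carrier (ms_sec AM W); a \<in> OU W\<rbrakk> \<Longrightarrow>
      ms_res PF W W' (pt W \<sigma> a) = pt W' (restrict \<sigma> W') (rs_res U W W' a)"
proof -
  have o: "openin (rs_top AR) W" "openin (rs_top AR) W'" using W by (simp_all add: AR_simps(1))
  note * = tensor_map[OF pullback_tensor_closed[OF W(1)] pullback_tensor_closed[OF W(2)],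
      of "\<lambda>\<sigma>. restrict \<sigma> W'" "\<lambda>\<sigma>. restrict \<sigma> W'" "rs_res U W W'"]
  have 1: "restrict \<sigma> W' \<in> carrier (rs_sec AR W')" if "\<sigma> \<in> carrier (rs_sec AR W)" for \<sigma>
    using presheaf_closed[OF presheaf_AR, OF o W(3) that] by (simp add: AR_simps(3))
  have 2: "restrict \<sigma> W' \<in> carrier (ms_sec AM W')" if "\<sigma> \<in> carrier (ms_sec AM W)" for \<sigma>
    using presheaf_closed[OF presheaf_AM, OF o W(3) that] by (simp add: AM_simps(2))
  have 3: "restrict (\<sigma> \<oplus>\<^bsub>ms_sec AM W\<^esub> \<tau>) W' = restrict \<sigma> W' \<oplus>\<^bsub>ms_sec AM W'\<^esub> restrict \<tau> W'"
    if "\<sigma> \<in> carrier (ms_sec AM W)" "\<tau> \<in> carrier (ms_sec AM W)" for \<sigma> \<tau>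
    using module_presheaf_res_add[OF presheaf_AR module_AM, OF o W(3) that] by (simp add: AM_simps(2))
  have 4: "restrict (a \<odot>\<^bsub>ms_sec AM W\<^esub> \<tau>) W' = restrict a W' \<odot>\<^bsub>ms_sec AM W'\<^esub> restrict \<tau> W'"
    if "a \<in> carrier (rs_sec AR W)" "\<tau> \<in> carrier (ms_sec AM W)" for a \<tau>
    using module_presheaf_res_smult[OF presheaf_AR module_AM, OF o W(3) that] by (simp add: AM_simps(2) AR_simps(3))
  have 5: "rs_res U W W' (r \<odot>\<^bsub>NM W\<^esub> a) = restrict r W' \<odot>\<^bsub>NM W'\<^esub> rs_res U W W' a"
    if "r \<in> carrier (rs_sec AR W)" "a \<in> OU W" for r a
    using ring_presheaf_res(2)[OF ring_U, OF W inv_image_to_struct(1)[OF W(1) that(1)] that(2)]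
      inv_image_to_struct_restrict[OF W that(1)] by (simp add: NM_simps)
  note 6 = presheaf_closed[OF presheaf_U, OF W] and 7 = ring_presheaf_res(1)[OF ring_U, OF W]
  show "ms_res PF W W' \<in> hom (TG W) (TG W')"
    unfolding PF_simps by (rule *(1)) (simp_all add: NM_simps(1,2) 1 2 3 4 5 6 7)
  show "ms_res PF W W' (pt W \<sigma> a) = pt W' (restrict \<sigma> W') (rs_res U W W' a)"
    if "\<sigma> \<in> carrier (ms_sec AM W)" "a \<in> OU W" for \<sigma> a
    unfolding PF_simps by (rule *(2)) (simp_all add: NM_simps(1,2) 1 2 3 4 5 6 7 that)
qed

lemma pullback_smult:
  assumes W: "openin (rs_top U) W" and b: "b \<in> OU W"
  shows "(\<lambda>c. b \<odot>\<^bsub>ms_sec PF W\<^esub> c) \<in> hom (TG W) (TG W)"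
    and "\<And>\<sigma> a. \<lbrakk>\<sigma> \<in> carrier (ms_sec AM W); a \<in> OU W\<rbrakk> \<Longrightarrow> b \<odot>\<^bsub>ms_sec PF W\<^esub> pt W \<sigma> a = pt W \<sigma> (b \<otimes>\<^bsub>rs_sec U W\<^esub> a)"
proof -
  interpret cring "rs_sec U W" by (rule cring_sec[OF W])
  note * = tensor_map[OF pullback_tensor_closed[OF W] pullback_tensor_closed[OF W],
      of "\<lambda>\<sigma>. \<sigma>" "\<lambda>\<sigma>. \<sigma>" "\<lambda>s. b \<otimes>\<^bsub>rs_sec U W\<^esub> s", unfolded NM_simps]
  have 1: "b \<otimes>\<^bsub>rs_sec U W\<^esub> (inv_image_to_struct U f W r \<otimes>\<^bsub>rs_sec U W\<^esub> a) =
      inv_image_to_struct U f W r \<otimes>\<^bsub>rs_sec U W\<^esub> (b \<otimes>\<^bsub>rs_sec U W\<^esub> a)"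
    if "r \<in> carrier (rs_sec AR W)" "a \<in> OU W" for r a
    using inv_image_to_struct(1)[OF W that(1)] that(2) b by (simp add: m_lcomm)
  show "(\<lambda>c. b \<odot>\<^bsub>ms_sec PF W\<^esub> c) \<in> hom (TG W) (TG W)"
    unfolding PF_simps by (rule *(1)) (use b 1 r_distr in auto)
  show "b \<odot>\<^bsub>ms_sec PF W\<^esub> pt W \<sigma> a = pt W \<sigma> (b \<otimes>\<^bsub>rs_sec U W\<^esub> a)"
    if "\<sigma> \<in> carrier (ms_sec AM W)" "a \<in> OU W" for \<sigma> a
    unfolding PF_simps by (rule *(2)) (use b 1 r_distr that in auto)
qed

lemmas pullback_comm_group = comm_group_tensor[OF pullback_tensor_closed]
lemmas pullback_hom_eqI = tensor_hom_eqI[OF pullback_tensor_closed, unfolded NM_simps]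
lemmas pullback_induct = tensor_induct[OF pullback_tensor_closed, unfolded NM_simps, consumes 2, case_names one pure mult inv]

lemma pullback_group: "group (TG W)" if "openin (rs_top U) W"
  using pullback_comm_group[OF that] by (rule comm_group.axioms(2))

text \<open>
  All identities between restriction maps and scalar multiplications are equalities of
  homomorphisms on tensor products, so they only have to be checked on pure tensors.
\<close>

lemma module_PF: "module_presheaf U PF"
proof -
  have o: "openin (rs_top AR) W" if "openin (rs_top U) W" for W using that by (simp add: AR_simps(1))
  have closed: "ms_res PF W W' c \<in> carrier (TG W')"
    if "openin (rs_top U) W" "openin (rs_top U) W'" "W' \<subseteq> W" "c \<in> carrier (TG W)" for W W' c
    using hom_in_carrier[OF pullback_res(1)[OF that(1-3)] that(4)] .
  have id: "ms_res PF W W c = c" if W: "openin (rs_top U) W" and c: "c \<in> carrier (TG W)" for W c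
  proof (rule pullback_hom_eqI[OF W pullback_group[OF W] pullback_res(1)[OF W W subset_refl] id_hom _ c])
    fix \<sigma> a assume s: "\<sigma> \<in> carrier (ms_sec AM W)" "a \<in> OU W"
    show "ms_res PF W W (pt W \<sigma> a) = pt W \<sigma> a"
      using pullback_res(2)[OF W W subset_refl s] presheaf_id[OF presheaf_AM, OF o[OF W] s(1)]
        presheaf_id[OF presheaf_U, OF W s(2)] by (simp add: AM_simps(2))
  qed
  have comp: "ms_res PF W' W'' (ms_res PF W W' c) = ms_res PF W W'' c"
    if W: "openin (rs_top U) W" "openin (rs_top U) W'" "openin (rs_top U) W''" "W'' \<subseteq> W'" "W' \<subseteq> W"
      and c: "c \<in> carrier (TG W)" for W W' W'' c
  proof (rule pullback_hom_eqI[OF W(1) pullback_group[OF W(3)]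
        comp_hom[OF pullback_res(1)[OF W(1,2,5)] pullback_res(1)[OF W(2,3,4)]]
        pullback_res(1)[OF W(1,3) order_trans[OF W(4,5)]] _ c])
    fix \<sigma> a assume s: "\<sigma> \<in> carrier (ms_sec AM W)" "a \<in> OU W"
    have s': "restrict \<sigma> W' \<in> carrier (ms_sec AM W')" "rs_res U W W' a \<in> OU W'"
      using presheaf_closed[OF presheaf_AM, OF o[OF W(1)] o[OF W(2)] W(5) s(1)] presheaf_closed[OF presheaf_U, OF W(1,2,5) s(2)]
      by (simp_all add: AM_simps(2))
    have r: "restrict (restrict \<sigma> W') W'' = restrict \<sigma> W''" using W(4) by (auto simp: restrict_def fun_eq_iff)
    have a: "rs_res U W' W'' (rs_res U W W' a) = rs_res U W W'' a"
      by (rule presheaf_comp[OF presheaf_U, OF W s(2)])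
    show "ms_res PF W' W'' (ms_res PF W W' (pt W \<sigma> a)) = ms_res PF W W'' (pt W \<sigma> a)"
      unfolding pullback_res(2)[OF W(1,2,5) s] pullback_res(2)[OF W(2,3,4) s'] pullback_res(2)[OF W(1,3) order_trans[OF W(4,5)] s]
        r a ..
  qed
  have semi: "ms_res PF W W' (b \<odot>\<^bsub>ms_sec PF W\<^esub> c) = rs_res U W W' b \<odot>\<^bsub>ms_sec PF W'\<^esub> ms_res PF W W' c"
    if W: "openin (rs_top U) W" "openin (rs_top U) W'" "W' \<subseteq> W" and b: "b \<in> OU W"
      and c: "c \<in> carrier (TG W)" for W W' b c
  proof -
    have b': "rs_res U W W' b \<in> OU W'" by (rule presheaf_closed[OF presheaf_U, OF W b])
    show ?thesis
    proof (rule pullback_hom_eqI[OF W(1) pullback_group[OF W(2)]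
          comp_hom[OF pullback_smult(1)[OF W(1) b] pullback_res(1)[OF W]]
          comp_hom[OF pullback_res(1)[OF W] pullback_smult(1)[OF W(2) b']] _ c])
      fix \<sigma> a assume s: "\<sigma> \<in> carrier (ms_sec AM W)" "a \<in> OU W"
      have s': "restrict \<sigma> W' \<in> carrier (ms_sec AM W')" "rs_res U W W' a \<in> OU W'"
        using presheaf_closed[OF presheaf_AM, OF o[OF W(1)] o[OF W(2)] W(3) s(1)] presheaf_closed[OF presheaf_U, OF W s(2)]
        by (simp_all add: AM_simps(2))
      have ba: "b \<otimes>\<^bsub>rs_sec U W\<^esub> a \<in> OU W" by (rule ring_presheaf_ops(2)[OF ring_U, OF W(1) b s(2)])
      show "ms_res PF W W' (b \<odot>\<^bsub>ms_sec PF W\<^esub> pt W \<sigma> a) = rs_res U W W' b \<odot>\<^bsub>ms_sec PF W'\<^esub> ms_res PF W W' (pt W \<sigma> a)"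
        unfolding pullback_smult(2)[OF W(1) b s] pullback_res(2)[OF W s(1) ba] pullback_res(2)[OF W s]
          pullback_smult(2)[OF W(2) b' s'] ring_presheaf_res(2)[OF ring_U, OF W b s(2)] ..
    qed
  qed
  have "presheaf (rs_top U) (\<lambda>W. carrier (ms_sec PF W)) (ms_res PF)"
    unfolding PF_simps(1) using closed id comp by (simp add: presheaf_def Pi_iff)
  moreover have "c \<otimes>\<^bsub>TG W\<^esub> d \<in> carrier (TG W)"
    if "openin (rs_top U) W" "c \<in> carrier (TG W)" "d \<in> carrier (TG W)" for W c d
    using monoid.m_closed[OF group.is_monoid[OF pullback_group[OF that(1)]] that(2,3)] .
  moreover have "b \<odot>\<^bsub>ms_sec PF W\<^esub> c \<in> carrier (TG W)"
    if "openin (rs_top U) W" "b \<in> OU W" "c \<in> carrier (TG W)" for W b c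
    using hom_in_carrier[OF pullback_smult(1)[OF that(1,2)] that(3)] .
  moreover have "ms_res PF W W' (c \<otimes>\<^bsub>TG W\<^esub> d) = ms_res PF W W' c \<otimes>\<^bsub>TG W'\<^esub> ms_res PF W W' d"
    if "openin (rs_top U) W" "openin (rs_top U) W'" "W' \<subseteq> W" "c \<in> carrier (TG W)" "d \<in> carrier (TG W)" for W W' c d
    using hom_mult[OF pullback_res(1)[OF that(1-3)] that(4,5)] .
  ultimately show ?thesis
    using semi unfolding module_presheaf_def PF_simps(1,2) by simp
qed

lemmas presheaf_PF = module_presheaf_presheaf[OF presheaf_U module_PF]

subsection \<open>The stalk of the pullback of a rank one stalk\<close>

lemma pure_sum:
  assumes W: "openin (rs_top U) W" and \<sigma>: "\<sigma> \<in> carrier (ms_sec AM W)"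
    and ab: "a \<in> OU W" "b \<in> OU W"
  shows "pt W \<sigma> (a \<oplus>\<^bsub>rs_sec U W\<^esub> b) = pt W \<sigma> a \<otimes>\<^bsub>TG W\<^esub> pt W \<sigma> b"
  using pure_tensor_biadditive[OF pullback_tensor_closed[OF W]] \<sigma> ab
  by (simp add: biadditive_balanced_def NM_simps)

lemma pure_closed:
  assumes "openin (rs_top U) W" "\<sigma> \<in> carrier (ms_sec AM W)" "a \<in> OU W"
  shows "pt W \<sigma> a \<in> carrier (TG W)"
  using pure_tensor_closed[OF pullback_tensor_closed[OF assms(1)]] assms(2,3) by (simp add: NM_simps)

lemma pure_balanced:
  assumes W: "openin (rs_top U) W" and \<sigma>: "\<sigma> \<in> carrier (ms_sec AM W)"
    and r: "r \<in> carrier (rs_sec AR W)" and a: "a \<in> OU W"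
  shows "pt W (r \<odot>\<^bsub>ms_sec AM W\<^esub> \<sigma>) a = pt W \<sigma> (inv_image_to_struct U f W r \<otimes>\<^bsub>rs_sec U W\<^esub> a)"
  using pure_tensor_biadditive[OF pullback_tensor_closed[OF W]] \<sigma> r a
  by (simp add: biadditive_balanced_def NM_simps)

lemma pure_zero_inv:
  assumes W: "openin (rs_top U) W" and \<sigma>: "\<sigma> \<in> carrier (ms_sec AM W)"
  shows "pt W \<sigma> \<zero>\<^bsub>rs_sec U W\<^esub> = \<one>\<^bsub>TG W\<^esub>"
    and "a \<in> OU W \<Longrightarrow> inv\<^bsub>TG W\<^esub> (pt W \<sigma> a) = pt W \<sigma> (\<ominus>\<^bsub>rs_sec U W\<^esub> a)"
proof -
  interpret cring "rs_sec U W" by (rule cring_sec[OF W])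
  interpret T: group "TG W" by (rule pullback_group[OF W])
  show z: "pt W \<sigma> \<zero>\<^bsub>rs_sec U W\<^esub> = \<one>\<^bsub>TG W\<^esub>"
    using pure_sum[OF W \<sigma> zero_closed zero_closed] pure_closed[OF W \<sigma> zero_closed] T.l_cancel_one by simp
  assume a: "a \<in> OU W"
  show "inv\<^bsub>TG W\<^esub> (pt W \<sigma> a) = pt W \<sigma> (\<ominus>\<^bsub>rs_sec U W\<^esub> a)"
    using pure_sum[OF W \<sigma> a_inv_closed[OF a] a] z a pure_closed[OF W \<sigma>] by (intro T.inv_equality) (simp_all add: l_neg)
qed

text \<open>
  If a section \<open>e\<close> over \<open>N\<close> generates the stalk of \<open>F\<close> at \<open>f x\<close>, then near \<open>x\<close> every section of the
  tensor product presheaf has the form \<open>e \<otimes> a\<close>: a section of the inverse image is locally a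
  multiple of \<open>e\<close>, and the factor moves to the right-hand side of the tensor product.
\<close>

lemma pullback_section_multiple_of_generator:
  assumes N: "openin (rs_top V) N" "map_pt f x \<in> N" and e: "e \<in> FV N"
    and gen: "\<And>m. m \<in> carrier (mod_stalk V F (map_pt f x)) \<Longrightarrow>
      \<exists>b\<in>carrier (stalk V (map_pt f x)). m = b \<odot>\<^bsub>mod_stalk V F (map_pt f x)\<^esub> ms_germ V F {map_pt f x} N e"
    and W: "openin (rs_top U) W" "x \<in> W" and c: "c \<in> carrier (TG W)"
  shows "\<exists>W' a. openin (rs_top U) W' \<and> x \<in> W' \<and> W' \<subseteq> W \<and> map_pt f ` W' \<subseteq> N \<and> a \<in> OU W' \<and>
    ms_res PF W W' c = pt W' (secF W' N e) a"
proof -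
  let ?good = "\<lambda>W'. openin (rs_top U) W' \<and> x \<in> W' \<and> W' \<subseteq> W \<and> map_pt f ` W' \<subseteq> N"
  have E: "secF W' N e \<in> carrier (ms_sec AM W')" if "?good W'" for W'
    unfolding AM_simps using inv_section_in[OF presheaf_F, OF _ N(1) _ e] that by blast
  have shrink: "ms_res PF W W'' c = pt W'' (secF W'' N e) (rs_res U W' W'' a)"
    if W': "?good W'" and W'': "openin (rs_top U) W''" "W'' \<subseteq> W'" and a: "a \<in> OU W'"
      and c: "c \<in> carrier (TG W)" "ms_res PF W W' c = pt W' (secF W' N e) a" for W' W'' a c
  proof -
    have o: "openin (rs_top U) W'" "W' \<subseteq> W" "map_pt f ` W' \<subseteq> N" "map_pt f ` W'' \<subseteq> N"
      using W' W''(2) by blast+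
    have "restrict (secF W' N e) W'' = secF W'' N e"
      using restrict_inv_section[OF presheaf_F, OF o(1) W'' N(1) o(3) e N(1) o(4) subset_refl]
        presheaf_id[OF presheaf_F, OF N(1) e] by simp
    then have "ms_res PF W' W'' (ms_res PF W W' c) = pt W'' (secF W'' N e) (rs_res U W' W'' a)"
      using pullback_res(2)[OF o(1) W'' E[OF W'] a] c(2) by simp
    then show ?thesis
      using presheaf_comp[OF presheaf_PF, OF W(1) o(1) W''(1,2) o(2)] c(1) by (simp add: PF_simps(1))
  qed
  have start: "?good (W \<inter> preim U f N)"
    using W N openin_subset[OF W(1)] preim_open[OF N(1)] by (auto simp: preim_def)
  show ?thesis
    using W(1) c
  proof (induction c rule: pullback_induct)
    case one
    let ?W' = "W \<inter> preim U f N"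
    have o: "openin (rs_top U) ?W'" using start by blast
    have "ms_res PF W ?W' \<one>\<^bsub>TG W\<^esub> = \<one>\<^bsub>TG ?W'\<^esub>"
      by (rule hom_one[OF pullback_res(1)[OF W(1) o Int_lower1] pullback_group[OF W(1)] pullback_group[OF o]])
    then show ?case
      using start pure_zero_inv(1)[OF o E[OF start]] cring.cring_simprules(2)[OF cring_sec[OF o]] by metis
  next
    case (pure \<sigma> a)
    obtain W1 N1 s where W1: "openin (rs_top U) W1" "x \<in> W1" "W1 \<subseteq> W"
      and N1: "openin (rs_top V) N1" "map_pt f ` W1 \<subseteq> N1" "s \<in> FV N1" and rs: "restrict \<sigma> W1 = secF W1 N1 s"
      using inv_sections_local[OF presheaf_F, OF pure(1)[unfolded AM_simps] W(2,1)] by metis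
    have fx: "map_pt f x \<in> N1" using W1(2) N1(2) by blast
    have "ms_germ V F {map_pt f x} N1 s \<in> carrier (mod_stalk V F (map_pt f x))"
      unfolding germ_module_carrier[OF presheaf_V module_F]
      by (rule germ_in_germs[where C = FV, OF N1(1) _ N1(3)]) (use fx in simp)
    then obtain b where b: "b \<in> carrier (stalk V (map_pt f x))"
      "ms_germ V F {map_pt f x} N1 s = b \<odot>\<^bsub>mod_stalk V F (map_pt f x)\<^esub> ms_germ V F {map_pt f x} N e"
      using gen by blast
    have e': "ms_germ V F {map_pt f x} N e \<in> germs (rs_top V) FV (ms_res F) {map_pt f x}"
      by (rule germ_in_germs[where C = FV, OF N(1) _ e]) (use N(2) in simp)
    obtain N2 t e2 where N2: "openin (rs_top V) N2" "{map_pt f x} \<subseteq> N2" "t \<in> OV N2" "e2 \<in> FV N2"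
      and t: "b = rs_germ V {map_pt f x} N2 t" and e2: "ms_germ V F {map_pt f x} N e = ms_germ V F {map_pt f x} N2 e2"
      using common_representatives[OF presheaf_V presheaf_F, OF b(1)[unfolded germ_ring_carrier[OF ring_V]] e'] by metis
    obtain N3 where N3: "openin (rs_top V) N3" "{map_pt f x} \<subseteq> N3" "N3 \<subseteq> N" "N3 \<subseteq> N2"
      and r3: "ms_res F N N3 e = ms_res F N2 N3 e2"
      using germ_eqD[where C = FV, OF e2 N2(1,2,4)] by metis
    have te: "t \<odot>\<^bsub>ms_sec F N2\<^esub> e2 \<in> FV N2" by (rule module_presheaf_smult[OF presheaf_V module_F, OF N2(1,3,4)])
    have "ms_germ V F {map_pt f x} N1 s = ms_germ V F {map_pt f x} N2 (t \<odot>\<^bsub>ms_sec F N2\<^esub> e2)"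
      using b(2) germ_module_smult[OF presheaf_V module_F, OF N2(1,2,3,4)] t e2 by simp
    then obtain N4 where N4: "openin (rs_top V) N4" "{map_pt f x} \<subseteq> N4" "N4 \<subseteq> N1" "N4 \<subseteq> N2"
      and r4: "ms_res F N1 N4 s = ms_res F N2 N4 (t \<odot>\<^bsub>ms_sec F N2\<^esub> e2)"
      using germ_eqD[where C = FV, OF _ N2(1,2) te] by metis
    \<comment> \<open>Here \<open>e = e2\<close> holds on \<open>N3\<close> and \<open>s = t e2\<close> on \<open>N4\<close>, hence \<open>s = t e\<close> on the intersection.\<close>
    let ?M = "N3 \<inter> N4"
    have M: "openin (rs_top V) ?M" "?M \<subseteq> N" "?M \<subseteq> N1" "?M \<subseteq> N2" "map_pt f x \<in> ?M"
      using N3 N4 by auto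
    have tM: "rs_res V N2 ?M t \<in> OV ?M" and eM: "ms_res F N ?M e \<in> FV ?M"
      using presheaf_closed[OF presheaf_V, OF N2(1) M(1,4) N2(3)] presheaf_closed[OF presheaf_F, OF N(1) M(1,2) e] .
    have "ms_res F N1 ?M s = ms_res F N4 ?M (ms_res F N1 N4 s)"
      using presheaf_comp[OF presheaf_F, OF N1(1) N4(1) M(1) Int_lower2 N4(3) N1(3)] by simp
    also have "\<dots> = ms_res F N2 ?M (t \<odot>\<^bsub>ms_sec F N2\<^esub> e2)"
      unfolding r4 by (rule presheaf_comp[OF presheaf_F, OF N2(1) N4(1) M(1) Int_lower2 N4(4) te])
    also have "\<dots> = rs_res V N2 ?M t \<odot>\<^bsub>ms_sec F ?M\<^esub> ms_res F N2 ?M e2"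
      by (rule module_presheaf_res_smult[OF presheaf_V module_F, OF N2(1) M(1,4) N2(3,4)])
    also have "ms_res F N2 ?M e2 = ms_res F N3 ?M (ms_res F N2 N3 e2)"
      using presheaf_comp[OF presheaf_F, OF N2(1) N3(1) M(1) Int_lower1 N3(4) N2(4)] by simp
    also have "\<dots> = ms_res F N ?M e"
      unfolding r3[symmetric] by (rule presheaf_comp[OF presheaf_F, OF N(1) N3(1) M(1) Int_lower1 N3(3) e])
    finally have sM: "ms_res F N1 ?M s = rs_res V N2 ?M t \<odot>\<^bsub>ms_sec F ?M\<^esub> ms_res F N ?M e" .
    let ?W' = "W1 \<inter> preim U f ?M"
    have W': "openin (rs_top U) ?W'" "x \<in> ?W'" "?W' \<subseteq> W1" "?W' \<subseteq> W" "map_pt f ` ?W' \<subseteq> ?M" "map_pt f ` ?W' \<subseteq> N"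
      using W1 M(2,5) preim_open[OF M(1)] openin_subset[OF W1(1)] by (auto simp: preim_def)
    have g: "?good ?W'" using W' by blast
    have fW': "map_pt f ` ?W' \<subseteq> N" using W'(6) .
    have "restrict \<sigma> ?W' = restrict (restrict \<sigma> W1) ?W'"
      by (auto simp: restrict_def fun_eq_iff)
    also have "\<dots> = secF ?W' ?M (ms_res F N1 ?M s)"
      unfolding rs by (rule restrict_inv_section[OF presheaf_F, OF W1(1) W'(1,3) N1(1,2,3) M(1) W'(5) M(3)])
    also have "\<dots> = secR ?W' ?M (rs_res V N2 ?M t) \<odot>\<^bsub>ms_sec AM ?W'\<^esub> secF ?W' ?M (ms_res F N ?M e)"
      unfolding sM using smult_inv_section[OF W'(1) M(1) W'(5) tM eM] by simp
    also have "secF ?W' ?M (ms_res F N ?M e) = restrict (secF ?W' N e) ?W'"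
      using restrict_inv_section[OF presheaf_F, OF W'(1) W'(1) subset_refl N(1) fW' e M(1) W'(5) M(2)] by simp
    also have "\<dots> = secF ?W' N e" by (auto simp: inv_section_def restrict_def fun_eq_iff)
    finally have r\<sigma>: "restrict \<sigma> ?W' = secR ?W' ?M (rs_res V N2 ?M t) \<odot>\<^bsub>ms_sec AM ?W'\<^esub> secF ?W' N e" .
    have rt: "secR ?W' ?M (rs_res V N2 ?M t) \<in> carrier (rs_sec AR ?W')"
      unfolding AR_simps by (rule inv_section_in[OF presheaf_V, OF W'(1) M(1) W'(5) tM])
    have a': "rs_res U W ?W' a \<in> OU ?W'" by (rule presheaf_closed[OF presheaf_U, OF W(1) W'(1,4) pure(2)])
    have "ms_res PF W ?W' (pt W \<sigma> a) = pt ?W' (secF ?W' N e)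
        (inv_image_to_struct U f ?W' (secR ?W' ?M (rs_res V N2 ?M t)) \<otimes>\<^bsub>rs_sec U ?W'\<^esub> rs_res U W ?W' a)"
      unfolding pullback_res(2)[OF W(1) W'(1,4) pure] r\<sigma> by (rule pure_balanced[OF W'(1) E[OF g] rt a'])
    then show ?case
      using g ring_presheaf_ops(2)[OF ring_U, OF W'(1) inv_image_to_struct(1)[OF W'(1) rt] a'] by blast
  next
    case (mult c d)
    obtain W1 a where W1: "?good W1" and a: "a \<in> OU W1" "ms_res PF W W1 c = pt W1 (secF W1 N e) a"
      using mult by blast
    obtain W2 b where W2: "?good W2" and b: "b \<in> OU W2" "ms_res PF W W2 d = pt W2 (secF W2 N e) b"
      using mult by blast
    let ?W' = "W1 \<inter> W2"
    have W': "openin (rs_top U) ?W'" "?W' \<subseteq> W" and g: "?good ?W'" using W1 W2 by auto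
    have o: "openin (rs_top U) W1" "openin (rs_top U) W2" using W1 W2 by auto
    have r: "rs_res U W1 ?W' a \<in> OU ?W'" "rs_res U W2 ?W' b \<in> OU ?W'"
      using presheaf_closed[OF presheaf_U, OF o(1) W'(1) Int_lower1 a(1)]
        presheaf_closed[OF presheaf_U, OF o(2) W'(1) Int_lower2 b(1)] .
    have "ms_res PF W ?W' (c \<otimes>\<^bsub>TG W\<^esub> d) = ms_res PF W ?W' c \<otimes>\<^bsub>TG ?W'\<^esub> ms_res PF W ?W' d"
      by (rule hom_mult[OF pullback_res(1)[OF W(1) W'] mult(1,2)])
    also have "\<dots> = pt ?W' (secF ?W' N e) (rs_res U W1 ?W' a \<oplus>\<^bsub>rs_sec U ?W'\<^esub> rs_res U W2 ?W' b)"
      unfolding shrink[OF W1 W'(1) Int_lower1 a(1) mult(1) a(2)] shrink[OF W2 W'(1) Int_lower2 b(1) mult(2) b(2)]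
      using pure_sum[OF W'(1) E[OF g] r] by simp
    finally show ?case
      using g ring_presheaf_ops(1)[OF ring_U, OF W'(1) r] by blast
  next
    case (inv c)
    obtain W1 a where W1: "?good W1" and a: "a \<in> OU W1" "ms_res PF W W1 c = pt W1 (secF W1 N e) a"
      using inv by blast
    have o: "openin (rs_top U) W1" "W1 \<subseteq> W" using W1 by auto
    interpret h: group_hom "TG W" "TG W1" "ms_res PF W W1"
      using pullback_res(1)[OF W(1) o] pullback_group[OF W(1)] pullback_group[OF o(1)]
      by (simp add: group_hom_def group_hom_axioms_def)
    interpret cring "rs_sec U W1" by (rule cring_sec[OF o(1)])
    have "ms_res PF W W1 (inv\<^bsub>TG W\<^esub> c) = pt W1 (secF W1 N e) (\<ominus>\<^bsub>rs_sec U W1\<^esub> a)"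
      using h.hom_inv[OF inv(1)] a(2) pure_zero_inv(2)[OF o(1) E[OF W1] a(1)] by simp
    then show ?case
      using W1 a_inv_closed[OF a(1)] by blast
  qed
qed

text \<open>
  Let \<open>y = f x\<close>, let \<open>h\<close> be an isomorphism from \<open>F\<^sub>y\<close> to \<open>\<O>\<^sub>y\<close>, and \<open>h e = 1\<close>.  The isomorphism from
  the stalk of \<open>PF\<close> to \<open>\<O>\<^sub>x\<close> is \<open>m \<otimes> a \<mapsto> \<phi> (h m) a\<close>, where \<open>\<phi>\<close> is the homomorphism of stalks.  It
  takes \<open>e \<otimes> a\<close> to \<open>a\<close>, and near \<open>x\<close> every section is some \<open>e \<otimes> a\<close>; so it is bijective.
\<close>

lemma presheaf_pullback_stalk_rank_one:
  assumes x: "x \<in> topspace (rs_top U)" and cring_x: "cring (stalk U x)" and cring_y: "cring (stalk V (map_pt f x))"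
    and sm: "stalk_map U f x \<in> ring_hom (stalk V (map_pt f x)) (stalk U x)"
    and iso: "mod_iso (stalk V (map_pt f x)) (mod_stalk V F (map_pt f x)) (self_module (stalk V (map_pt f x)))"
  shows "mod_iso (stalk U x) (mod_stalk U PF x) (self_module (stalk U x))"
proof -
  let ?y = "map_pt f x"
  let ?A = "stalk V ?y" and ?B = "stalk U x" and ?M = "mod_stalk V F ?y"
  let ?\<phi> = "stalk_map U f x" and ?G = "add_monoid ?B"
  interpret B: cring ?B by (rule cring_x)
  interpret A: cring ?A by (rule cring_y)
  interpret \<phi>: ring_hom_cring ?A ?B ?\<phi> by (unfold_locales) (rule sm)
  obtain h where h: "h \<in> mod_hom ?M (self_module ?A) ?A" and hb: "bij_betw h (carrier ?M) (carrier ?A)"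
    using iso by (auto simp: mod_iso_def self_module_def alg_module_def)
  have h_closed: "h m \<in> carrier ?A" if "m \<in> carrier ?M" for m
    using h that by (auto simp: mod_hom_def self_module_def alg_module_def)
  have h_add: "h (m \<oplus>\<^bsub>?M\<^esub> n) = h m \<oplus>\<^bsub>?A\<^esub> h n" if "m \<in> carrier ?M" "n \<in> carrier ?M" for m n
    using h that by (simp add: mod_hom_def self_module_def alg_module_def)
  have h_smult: "h (a \<odot>\<^bsub>?M\<^esub> m) = a \<otimes>\<^bsub>?A\<^esub> h m" if "a \<in> carrier ?A" "m \<in> carrier ?M" for a m
    using h that by (simp add: mod_hom_def self_module_def alg_module_def)
  have carM: "carrier ?M = germs (rs_top V) FV (ms_res F) {?y}" by (simp add: germ_module_def)
  have carA: "carrier ?A = germs (rs_top V) OV (rs_res V) {?y}" by (simp add: germ_ring_def)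
  have carB: "carrier ?B = germs (rs_top U) OU (rs_res U) {x}" by (simp add: germ_ring_def)
  have smult_closed: "a \<odot>\<^bsub>?M\<^esub> m \<in> carrier ?M" if am: "a \<in> carrier ?A" "m \<in> carrier ?M" for a m
  proof -
    obtain N s t where N: "openin (rs_top V) N" "{?y} \<subseteq> N" "s \<in> OV N" "t \<in> FV N"
      "a = rs_germ V {?y} N s" "m = ms_germ V F {?y} N t"
      using common_representatives[OF presheaf_V presheaf_F, OF am[unfolded carA carM]] by metis
    show ?thesis
      unfolding N(5,6) carM germ_module_smult[OF presheaf_V module_F, OF N(1-4)]
      by (rule germ_in_germs[where C = FV, OF N(1,2) module_presheaf_smult[OF presheaf_V module_F, OF N(1,3,4)]])
  qed

  have "\<one>\<^bsub>?A\<^esub> \<in> h ` carrier ?M"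
    by (simp add: bij_betw_imp_surj_on[OF hb])
  then obtain e where e': "\<one>\<^bsub>?A\<^esub> = h e" "e \<in> carrier ?M"
    by (rule imageE)
  note e = e'(2) e'(1)[symmetric]
  obtain N0 e0 where N0: "openin (rs_top V) N0" "{?y} \<subseteq> N0" "e0 \<in> FV N0" and e0: "e = ms_germ V F {?y} N0 e0"
    using germsE[OF e(1)[unfolded carM]] by metis
  have gen: "\<exists>b\<in>carrier ?A. m = b \<odot>\<^bsub>?M\<^esub> ms_germ V F {?y} N0 e0" if m: "m \<in> carrier ?M" for m
  proof (rule bexI[of _ "h m"])
    have "h (h m \<odot>\<^bsub>?M\<^esub> e) = h m" using h_smult[OF h_closed[OF m] e(1)] e(2) h_closed[OF m] by simp
    then show "m = h m \<odot>\<^bsub>?M\<^esub> ms_germ V F {?y} N0 e0"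
      unfolding e0[symmetric]
      using inj_onD[OF bij_betw_imp_inj_on[OF hb]] m smult_closed[OF h_closed[OF m] e(1)] by metis
  qed (rule h_closed[OF m])

  \<comment> \<open>The values on pure tensors over a neighbourhood \<open>W\<close> of \<open>x\<close>.\<close>
  define \<beta> where "\<beta> W \<sigma> a = ?\<phi> (h (stalkF x (\<sigma> x))) \<otimes>\<^bsub>?B\<^esub> rs_germ U {x} W a" for W \<sigma> a
  have germ_B: "rs_germ U {x} W a \<in> carrier ?B" if "openin (rs_top U) W" "x \<in> W" "a \<in> OU W" for W a
    unfolding carB by (rule germ_in_germs[where C = OU]) (use that in simp_all)
  have \<sigma>M: "stalkF x (\<sigma> x) \<in> carrier ?M" if "\<sigma> \<in> carrier (ms_sec AM W)" "x \<in> W" for \<sigma> W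
    by (rule stalkF_closed[OF section_AM_germ[OF that]])
  have \<beta>: "biadditive_balanced (rs_sec AR W) (ms_sec AM W) (NM W) ?G (\<beta> W)"
    if W: "openin (rs_top U) W" "x \<in> W" for W
    unfolding biadditive_balanced_def NM_simps
  proof (intro conjI ballI)
    fix \<sigma> a assume \<sigma>: "\<sigma> \<in> carrier (ms_sec AM W)" and a: "a \<in> OU W"
    note m = \<sigma>M[OF \<sigma> W(2)] and b = germ_B[OF W a]
    note hm = \<phi>.hom_closed[OF h_closed[OF m]]
    show "\<beta> W \<sigma> a \<in> carrier ?G" unfolding \<beta>_def using hm b by simp
    { fix \<tau> assume \<tau>: "\<tau> \<in> carrier (ms_sec AM W)"
      note n = \<sigma>M[OF \<tau> W(2)]
      have "stalkF x ((\<sigma> \<oplus>\<^bsub>ms_sec AM W\<^esub> \<tau>) x) = stalkF x (\<sigma> x) \<oplus>\<^bsub>?M\<^esub> stalkF x (\<tau> x)"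
        using stalkF_add[OF section_AM_germ[OF \<sigma> W(2)] section_AM_germ[OF \<tau> W(2)]] W(2) by (simp add: AM_simps(4))
      then show "\<beta> W (\<sigma> \<oplus>\<^bsub>ms_sec AM W\<^esub> \<tau>) a = \<beta> W \<sigma> a \<otimes>\<^bsub>?G\<^esub> \<beta> W \<tau> a"
        unfolding \<beta>_def using h_add[OF m n] hm \<phi>.hom_closed[OF h_closed[OF n]] b h_closed[OF m] h_closed[OF n]
        by (simp add: B.l_distr) }
    { fix c assume c: "c \<in> OU W"
      show "\<beta> W \<sigma> (a \<oplus>\<^bsub>rs_sec U W\<^esub> c) = \<beta> W \<sigma> a \<otimes>\<^bsub>?G\<^esub> \<beta> W \<sigma> c"
        unfolding \<beta>_def using germ_ring_ops(1)[OF ring_U, OF W(1) _ a c, of "{x}"] W(2) hm b germ_B[OF W c]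
        by (simp add: B.r_distr[symmetric]) }
    { fix r assume r: "r \<in> carrier (rs_sec AR W)"
      note q = stalkR_closed[OF section_AR_germ[OF r W(2)]] and s = inv_image_to_struct[OF W(1) r]
      have "stalkF x ((r \<odot>\<^bsub>ms_sec AM W\<^esub> \<sigma>) x) = stalkR x (r x) \<odot>\<^bsub>?M\<^esub> stalkF x (\<sigma> x)"
        using stalkF_smult[OF section_AR_germ[OF r W(2)] section_AM_germ[OF \<sigma> W(2)]] W(2) by (simp add: AM_simps(3))
      moreover have "rs_germ U {x} W (inv_image_to_struct U f W r \<otimes>\<^bsub>rs_sec U W\<^esub> a) = ?\<phi> (stalkR x (r x)) \<otimes>\<^bsub>?B\<^esub> rs_germ U {x} W a"
        using germ_ring_ops(2)[OF ring_U, OF W(1) _ s(1) a, of "{x}"] s(2)[OF W(2)] W(2) by simp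
      ultimately show "\<beta> W (r \<odot>\<^bsub>ms_sec AM W\<^esub> \<sigma>) a = \<beta> W \<sigma> (inv_image_to_struct U f W r \<otimes>\<^bsub>rs_sec U W\<^esub> a)"
        unfolding \<beta>_def using h_smult[OF q m] hm b h_closed[OF m] q \<phi>.hom_closed[OF q]
        by (simp add: B.m_assoc B.m_lcomm) }
  qed
  have G: "comm_group ?G" by (rule B.a_comm_group)
  then have Gg: "group ?G" by (rule comm_group.axioms(2))
  define \<Psi> where "\<Psi> W = (SOME \<Phi>. \<Phi> \<in> hom (TG W) ?G \<and>
      (\<forall>\<sigma>\<in>carrier (ms_sec AM W). \<forall>a\<in>OU W. \<Phi> (pt W \<sigma> a) = \<beta> W \<sigma> a))" for W
  have \<Psi>: "\<Psi> W \<in> hom (TG W) ?G"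
    and \<Psi>_pure: "\<And>\<sigma> a. \<lbrakk>\<sigma> \<in> carrier (ms_sec AM W); a \<in> OU W\<rbrakk> \<Longrightarrow> \<Psi> W (pt W \<sigma> a) = \<beta> W \<sigma> a"
    if W: "openin (rs_top U) W" "x \<in> W" for W
  proof -
    obtain \<Phi> where "\<Phi> \<in> hom (TG W) ?G"
      "\<And>\<sigma> a. \<lbrakk>\<sigma> \<in> carrier (ms_sec AM W); a \<in> carrier (NM W)\<rbrakk> \<Longrightarrow> \<Phi> (pt W \<sigma> a) = \<beta> W \<sigma> a"
      using tensor_lift[OF pullback_tensor_closed[OF W(1)] G \<beta>[OF W]] by blast
    then have "\<exists>\<Phi>. \<Phi> \<in> hom (TG W) ?G \<and> (\<forall>\<sigma>\<in>carrier (ms_sec AM W). \<forall>a\<in>OU W. \<Phi> (pt W \<sigma> a) = \<beta> W \<sigma> a)"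
      unfolding NM_simps by blast
    from someI_ex[OF this, folded \<Psi>_def]
    show "\<Psi> W \<in> hom (TG W) ?G"
      "\<And>\<sigma> a. \<lbrakk>\<sigma> \<in> carrier (ms_sec AM W); a \<in> OU W\<rbrakk> \<Longrightarrow> \<Psi> W (pt W \<sigma> a) = \<beta> W \<sigma> a" by blast+
  qed
  have \<Psi>_res: "\<Psi> W c = \<Psi> W' (ms_res PF W W' c)"
    if W: "openin (rs_top U) W" "openin (rs_top U) W'" "{x} \<subseteq> W'" "W' \<subseteq> W" and c: "c \<in> carrier (ms_sec PF W)" for W W' c
  proof -
    have x: "x \<in> W" "x \<in> W'" using W by auto
    show ?thesis
    proof (rule pullback_hom_eqI[OF W(1) Gg \<Psi>[OF W(1) x(1)]
          comp_hom[OF pullback_res(1)[OF W(1,2,4)] \<Psi>[OF W(2) x(2)]] _ c[unfolded PF_simps(1)]])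
      fix \<sigma> a assume s: "\<sigma> \<in> carrier (ms_sec AM W)" "a \<in> OU W"
      have s': "restrict \<sigma> W' \<in> carrier (ms_sec AM W')" "rs_res U W W' a \<in> OU W'"
        using presheaf_closed[OF presheaf_AM, OF _ _ W(4) s(1)] W(1,2) presheaf_closed[OF presheaf_U, OF W(1,2,4) s(2)]
        by (simp_all add: AM_simps(2) AR_simps(1))
      show "\<Psi> W (pt W \<sigma> a) = \<Psi> W' (ms_res PF W W' (pt W \<sigma> a))"
        unfolding pullback_res(2)[OF W(1,2,4) s] \<Psi>_pure[OF W(1) x(1) s] \<Psi>_pure[OF W(2) x(2) s'] \<beta>_def
        using germ_restrict[OF presheaf_U, OF W s(2)] x(2) by simp
    qed
  qed
  have \<Psi>_smult: "\<Psi> W (b \<odot>\<^bsub>ms_sec PF W\<^esub> c) = rs_germ U {x} W b \<otimes>\<^bsub>?B\<^esub> \<Psi> W c"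
    if W: "openin (rs_top U) W" "x \<in> W" and b: "b \<in> OU W" and c: "c \<in> carrier (TG W)" for W b c
  proof -
    have bm: "rs_germ U {x} W b \<in> carrier ?B" by (rule germ_B[OF W b])
    have "(\<lambda>z. rs_germ U {x} W b \<otimes>\<^bsub>?B\<^esub> z) \<in> hom ?G ?G"
      using bm by (auto simp: hom_def B.r_distr)
    then show ?thesis
    proof (rule pullback_hom_eqI[OF W(1) Gg comp_hom[OF pullback_smult(1)[OF W(1) b] \<Psi>[OF W]] comp_hom[OF \<Psi>[OF W]] _ c])
      fix \<sigma> a assume s: "\<sigma> \<in> carrier (ms_sec AM W)" "a \<in> OU W"
      have ba: "b \<otimes>\<^bsub>rs_sec U W\<^esub> a \<in> OU W" by (rule ring_presheaf_ops(2)[OF ring_U, OF W(1) b s(2)])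
      show "\<Psi> W (b \<odot>\<^bsub>ms_sec PF W\<^esub> pt W \<sigma> a) = rs_germ U {x} W b \<otimes>\<^bsub>?B\<^esub> \<Psi> W (pt W \<sigma> a)"
        unfolding pullback_smult(2)[OF W(1) b s] \<Psi>_pure[OF W s(1) ba] \<Psi>_pure[OF W s] \<beta>_def
        using germ_ring_ops(2)[OF ring_U, OF W(1) _ b s(2), of "{x}", symmetric] W(2) bm germ_B[OF W s(2)]
          \<phi>.hom_closed[OF h_closed[OF \<sigma>M[OF s(1) W(2)]]] by (simp add: B.m_lcomm)
    qed
  qed

  \<comment> \<open>Compatible with restriction, the maps \<open>\<Psi> W\<close> induce the isomorphism \<open>\<Theta>\<close> on germs.\<close>
  define \<Theta> where "\<Theta> c = (\<Union>(W, z)\<in>c. \<Psi> W z)" for c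
  have \<Theta>: "\<Theta> (ms_germ U PF {x} W c) = \<Psi> W c"
    if W: "openin (rs_top U) W" "x \<in> W" and c: "c \<in> carrier (ms_sec PF W)" for W c
    unfolding \<Theta>_def
    by (rule UN_germ_cong[OF presheaf_PF, OF W(1) _ c \<Psi>_res]) (use W(2) in simp_all)

  \<comment> \<open>Every germ is that of some \<open>e \<otimes> a\<close>, and \<open>\<Theta>\<close> takes it to the germ of \<open>a\<close>.\<close>
  let ?E = "\<lambda>W. secF W N0 e0"
  have E: "?E W \<in> carrier (ms_sec AM W)" if "openin (rs_top U) W" "map_pt f ` W \<subseteq> N0" for W
    unfolding AM_simps by (rule inv_section_in[OF presheaf_F, OF that(1) N0(1) that(2) N0(3)])
  have Ept: "pt W (?E W) a \<in> carrier (ms_sec PF W)"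
    if "openin (rs_top U) W" "map_pt f ` W \<subseteq> N0" "a \<in> OU W" for W a
    unfolding PF_simps(1) by (rule pure_closed[OF that(1) E[OF that(1,2)] that(3)])
  have \<Theta>_E: "\<Theta> (ms_germ U PF {x} W (pt W (?E W) a)) = rs_germ U {x} W a"
    if W: "openin (rs_top U) W" "x \<in> W" "map_pt f ` W \<subseteq> N0" and a: "a \<in> OU W" for W a
  proof -
    have "stalkF x (?E W x) = e"
      using inv_stalk_germ[OF presheaf_F, OF W(1,2) N0(1) W(3) N0(3)] W(2) e0 by (simp add: inv_section_def)
    then show ?thesis
      unfolding \<Theta>[OF W(1,2) Ept[OF W(1,3) a]] \<Psi>_pure[OF W(1,2) E[OF W(1,3)] a] \<beta>_def
      using e(2) \<phi>.hom_one germ_B[OF W(1,2) a] by simp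
  qed
  have E_res: "ms_res PF W W' (pt W (?E W) a) = pt W' (?E W') (rs_res U W W' a)"
    if W: "openin (rs_top U) W" "openin (rs_top U) W'" "W' \<subseteq> W" "map_pt f ` W \<subseteq> N0" and a: "a \<in> OU W" for W W' a
  proof -
    have fW': "map_pt f ` W' \<subseteq> N0" using W(3,4) by blast
    have "restrict (?E W) W' = ?E W'"
      using restrict_inv_section[OF presheaf_F, OF W(1,2,3) N0(1) W(4) N0(3) N0(1) fW' subset_refl]
        presheaf_id[OF presheaf_F, OF N0(1,3)] by simp
    then show ?thesis using pullback_res(2)[OF W(1,2,3) E[OF W(1,4)] a] by simp
  qed
  have normal_form: "\<exists>W a. openin (rs_top U) W \<and> x \<in> W \<and> map_pt f ` W \<subseteq> N0 \<and> a \<in> OU W \<and>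
      c = ms_germ U PF {x} W (pt W (?E W) a)" if c: "c \<in> carrier (mod_stalk U PF x)" for c
  proof -
    obtain W z where W: "openin (rs_top U) W" "{x} \<subseteq> W" and z: "z \<in> carrier (ms_sec PF W)" "c = ms_germ U PF {x} W z"
      using germsE[OF c[unfolded germ_module_carrier[OF presheaf_U module_PF]]] by metis
    obtain W' a where W': "openin (rs_top U) W'" "x \<in> W'" "W' \<subseteq> W" "map_pt f ` W' \<subseteq> N0" "a \<in> OU W'"
      "ms_res PF W W' z = pt W' (?E W') a"
      using pullback_section_multiple_of_generator[OF N0(1) _ N0(3) gen W(1) _ z(1)[unfolded PF_simps(1)]] N0(2) W(2) by auto
    have "c = ms_germ U PF {x} W' (pt W' (?E W') a)"
      unfolding z(2) W'(6)[symmetric]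
      using germ_restrict[OF presheaf_PF, OF W(1) W'(1) _ W'(3) z(1), of "{x}"] W'(2) by simp
    then show ?thesis using W' by blast
  qed

  have inj: "inj_on \<Theta> (carrier (mod_stalk U PF x))"
  proof (rule inj_onI)
    fix c d assume c: "c \<in> carrier (mod_stalk U PF x)" and d: "d \<in> carrier (mod_stalk U PF x)" and eq: "\<Theta> c = \<Theta> d"
    obtain W a where W: "openin (rs_top U) W" "x \<in> W" "map_pt f ` W \<subseteq> N0" "a \<in> OU W"
      "c = ms_germ U PF {x} W (pt W (?E W) a)" using normal_form[OF c] by blast
    obtain W' b where W': "openin (rs_top U) W'" "x \<in> W'" "map_pt f ` W' \<subseteq> N0" "b \<in> OU W'"
      "d = ms_germ U PF {x} W' (pt W' (?E W') b)" using normal_form[OF d] by blast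
    have "rs_germ U {x} W a = rs_germ U {x} W' b"
      using eq \<Theta>_E[OF W(1-4)] \<Theta>_E[OF W'(1-4)] W(5) W'(5) by simp
    then obtain W'' where W'': "openin (rs_top U) W''" "{x} \<subseteq> W''" "W'' \<subseteq> W" "W'' \<subseteq> W'"
      and ab: "rs_res U W W'' a = rs_res U W' W'' b"
      using germ_eqD[where C = OU, OF _ W'(1) _ W'(4)] W'(2) by (metis empty_subsetI insert_subset)
    have "ms_res PF W W'' (pt W (?E W) a) = ms_res PF W' W'' (pt W' (?E W') b)"
      unfolding E_res[OF W(1) W''(1,3) W(3,4)] E_res[OF W'(1) W''(1,4) W'(3,4)] ab ..
    then show "c = d"
      unfolding W(5) W'(5)
      using germ_eqI[OF presheaf_PF, OF W(1) Ept[OF W(1,3,4)] W'(1) Ept[OF W'(1,3,4)] W''] by blast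
  qed
  have onto: "\<Theta> ` carrier (mod_stalk U PF x) = carrier ?B"
  proof
    show "\<Theta> ` carrier (mod_stalk U PF x) \<subseteq> carrier ?B"
      using normal_form \<Theta>_E germ_B by fastforce
    show "carrier ?B \<subseteq> \<Theta> ` carrier (mod_stalk U PF x)"
    proof
      fix b assume "b \<in> carrier ?B"
      then obtain W a where W: "openin (rs_top U) W" "{x} \<subseteq> W" "a \<in> OU W" "b = rs_germ U {x} W a"
        unfolding carB using germsE by metis
      let ?W = "W \<inter> preim U f N0"
      have W': "openin (rs_top U) ?W" "x \<in> ?W" "map_pt f ` ?W \<subseteq> N0"
        using W N0 x preim_open[OF N0(1)] by (auto simp: preim_def)
      have a: "rs_res U W ?W a \<in> OU ?W" by (rule presheaf_closed[OF presheaf_U, OF W(1) W'(1) Int_lower1 W(3)])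
      have "b = \<Theta> (ms_germ U PF {x} ?W (pt ?W (?E ?W) (rs_res U W ?W a)))"
        unfolding \<Theta>_E[OF W' a] W(4)
        using germ_restrict[OF presheaf_U, OF W(1) W'(1) _ Int_lower1 W(3), of "{x}"] W'(2) by simp
      moreover have "ms_germ U PF {x} ?W (pt ?W (?E ?W) (rs_res U W ?W a)) \<in> carrier (mod_stalk U PF x)"
        unfolding germ_module_carrier[OF presheaf_U module_PF]
        by (rule germ_in_germs[where C = "\<lambda>W. carrier (ms_sec PF W)", OF W'(1) _ Ept[OF W'(1,3) a]]) (use W'(2) in simp)
      ultimately show "b \<in> \<Theta> ` carrier (mod_stalk U PF x)" by (rule image_eqI)
    qed
  qed
  have "\<Theta> (c \<oplus>\<^bsub>mod_stalk U PF x\<^esub> d) = \<Theta> c \<oplus>\<^bsub>?B\<^esub> \<Theta> d"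
    if cd: "c \<in> carrier (mod_stalk U PF x)" "d \<in> carrier (mod_stalk U PF x)" for c d
  proof -
    obtain W z w where W: "openin (rs_top U) W" "{x} \<subseteq> W" and zw: "z \<in> carrier (ms_sec PF W)" "w \<in> carrier (ms_sec PF W)"
      and e: "c = ms_germ U PF {x} W z" "d = ms_germ U PF {x} W w"
      using common_representatives[OF presheaf_PF presheaf_PF] cd
      unfolding germ_module_carrier[OF presheaf_U module_PF] by metis
    have xW: "x \<in> W" using W by simp
    show ?thesis
      unfolding e germ_module_add[OF presheaf_U module_PF, OF W zw] \<Theta>[OF W(1) xW zw(1)] \<Theta>[OF W(1) xW zw(2)]
        \<Theta>[OF W(1) xW module_presheaf_add[OF presheaf_U module_PF, OF W(1) zw]]
      using hom_mult[OF \<Psi>[OF W(1) xW]] zw by (simp add: PF_simps)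
  qed
  moreover have "\<Theta> (b \<odot>\<^bsub>mod_stalk U PF x\<^esub> d) = b \<otimes>\<^bsub>?B\<^esub> \<Theta> d"
    if cd: "b \<in> carrier ?B" "d \<in> carrier (mod_stalk U PF x)" for b d
  proof -
    obtain W z w where W: "openin (rs_top U) W" "{x} \<subseteq> W" and zw: "z \<in> OU W" "w \<in> carrier (ms_sec PF W)"
      and e: "b = rs_germ U {x} W z" "d = ms_germ U PF {x} W w"
      using common_representatives[OF presheaf_U presheaf_PF] cd
      unfolding germ_module_carrier[OF presheaf_U module_PF] carB by metis
    have xW: "x \<in> W" using W by simp
    show ?thesis
      unfolding e germ_module_smult[OF presheaf_U module_PF, OF W zw] \<Theta>[OF W(1) xW zw(2)]
        \<Theta>[OF W(1) xW module_presheaf_smult[OF presheaf_U module_PF, OF W(1) zw]]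
      by (rule \<Psi>_smult[OF W(1) xW zw(1) zw(2)[unfolded PF_simps(1)]])
  qed
  ultimately have "\<Theta> \<in> mod_hom (mod_stalk U PF x) (self_module ?B) ?B"
    using onto by (auto simp: mod_hom_def self_module_def alg_module_def)
  moreover have "bij_betw \<Theta> (carrier (mod_stalk U PF x)) (carrier (self_module ?B))"
    using inj onto by (simp add: bij_betw_def self_module_def alg_module_def)
  ultimately show ?thesis
    unfolding mod_iso_def by blast
qed

lemma pullback_stalk_rank_one:
  assumes "x \<in> topspace (rs_top U)" "cring (stalk U x)" "cring (stalk V (map_pt f x))"
    "stalk_map U f x \<in> ring_hom (stalk V (map_pt f x)) (stalk U x)"
    "mod_iso (stalk V (map_pt f x)) (mod_stalk V F (map_pt f x)) (self_module (stalk V (map_pt f x)))"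
  shows "mod_iso (stalk U x) (mod_stalk U (pullback U V f F) x) (self_module (stalk U x))"
  unfolding pullback_def
  by (rule mod_iso_trans[OF mod_stalk_assoc_mod_sheaf[OF presheaf_U module_PF] presheaf_pullback_stalk_rank_one[OF assms]])

end

section \<open>Prime and maximal ideals\<close>

lemma (in cring) maximal_ideal_avoiding:
  assumes I: "ideal I R" "I \<inter> S = {}" and S: "S \<noteq> {}"
  obtains P where "ideal P R" "I \<subseteq> P" "P \<inter> S = {}"
    "\<And>J. \<lbrakk>ideal J R; P \<subseteq> J; J \<inter> S = {}\<rbrakk> \<Longrightarrow> J = P"
proof -
  let ?A = "{J. ideal J R \<and> I \<subseteq> J \<and> J \<inter> S = {}}"
  have "\<exists>M\<in>?A. \<forall>J\<in>?A. M \<subseteq> J \<longrightarrow> J = M"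
  proof (rule subset_Zorn_nonempty)
    show "?A \<noteq> {}" using I by blast
    fix C assume C: "C \<noteq> {}" "subset.chain ?A C"
    have sub: "C \<subseteq> ?A" using C(2) by (auto simp: pred_on.chain_def)
    have "subset.chain {I. ideal I R} C" using C(2) by (auto simp: pred_on.chain_def)
    then have "ideal (\<Union>C) R" using chain_Union_is_ideal[of C] C(1) by simp
    then show "\<Union>C \<in> ?A" using sub C(1) by blast
  qed
  then obtain M where M: "M \<in> ?A" "\<forall>J\<in>?A. M \<subseteq> J \<longrightarrow> J = M" by blast
  show ?thesis
  proof (rule that[of M])
    show "J = M" if "ideal J R" "M \<subseteq> J" "J \<inter> S = {}" for J
      using M(2)[rule_format, of J] that M(1) by blast
  qed (use M(1) in blast)+
qed

text \<open>
  An ideal \<open>P\<close> that is maximal among the ideals avoiding a multiplicative set \<open>S\<close> is prime: if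
  neither \<open>a\<close> nor \<open>b\<close> is in \<open>P\<close>, then \<open>P + (a)\<close> and \<open>P + (b)\<close> meet \<open>S\<close>, so \<open>P + (a b)\<close> does and
  \<open>a b\<close> is not in \<open>P\<close>.
\<close>

lemma (in cring) prime_ideal_avoiding:
  assumes I: "ideal I R" "I \<inter> S = {}" and S: "S \<subseteq> carrier R" "\<one> \<in> S" "\<And>a b. \<lbrakk>a \<in> S; b \<in> S\<rbrakk> \<Longrightarrow> a \<otimes> b \<in> S"
  obtains P where "primeideal P R" "I \<subseteq> P" "P \<inter> S = {}"
proof -
  obtain P where P: "ideal P R" "I \<subseteq> P" "P \<inter> S = {}"
    and max: "\<And>J. \<lbrakk>ideal J R; P \<subseteq> J; J \<inter> S = {}\<rbrakk> \<Longrightarrow> J = P"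
    using maximal_ideal_avoiding[OF I] S(2) by blast
  interpret P: ideal P R by (rule P(1))
  have meet: "\<exists>p\<in>P. \<exists>r\<in>carrier R. p \<oplus> r \<otimes> a \<in> S" if a: "a \<in> carrier R" "a \<notin> P" for a
  proof -
    have J: "ideal (P <+>\<^bsub>R\<^esub> PIdl a) R" by (rule add_ideals[OF P(1) cgenideal_ideal[OF a(1)]])
    have sub: "P \<subseteq> P <+>\<^bsub>R\<^esub> PIdl a"
    proof
      fix p assume p: "p \<in> P"
      have "\<zero> \<in> PIdl a" using additive_subgroup.zero_closed[OF ideal.axioms(1)[OF cgenideal_ideal[OF a(1)]]] .
      then show "p \<in> P <+>\<^bsub>R\<^esub> PIdl a"
        unfolding set_add_def' using p P.Icarr[OF p] r_zero by fastforce
    qed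
    have "a = \<zero> \<oplus> a" using a(1) by simp
    then have "a \<in> P <+>\<^bsub>R\<^esub> PIdl a"
      unfolding set_add_def' using P.zero_closed cgenideal_self[OF a(1)] by blast
    then have "(P <+>\<^bsub>R\<^esub> PIdl a) \<inter> S \<noteq> {}" using max[OF J sub] a(2) by auto
    then show ?thesis
      unfolding set_add_def' cgenideal_def by auto
  qed
  have "primeideal P R"
  proof (rule primeidealI[OF P(1) is_cring])
    show "carrier R \<noteq> P" using S(1,2) P(3) by blast
    fix a b assume ab: "a \<in> carrier R" "b \<in> carrier R" "a \<otimes> b \<in> P"
    show "a \<in> P \<or> b \<in> P"
    proof (rule ccontr)
      assume "\<not> (a \<in> P \<or> b \<in> P)"
      then obtain p r q s where p: "p \<in> P" "r \<in> carrier R" "p \<oplus> r \<otimes> a \<in> S"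
        and q: "q \<in> P" "s \<in> carrier R" "q \<oplus> s \<otimes> b \<in> S"
        using meet ab by meson
      have pq: "p \<in> carrier R" "q \<in> carrier R" using p(1) q(1) P.Icarr by auto
      have "(p \<oplus> r \<otimes> a) \<otimes> (q \<oplus> s \<otimes> b) = p \<otimes> (q \<oplus> s \<otimes> b) \<oplus> ((r \<otimes> a) \<otimes> q \<oplus> (r \<otimes> s) \<otimes> (a \<otimes> b))"
        using ab pq p(2) q(2) by algebra
      also have "\<dots> \<in> P"
        using ab pq p q by (intro P.a_closed P.I_r_closed[OF p(1)] P.I_l_closed[OF q(1)] P.I_l_closed[OF ab(3)]) auto
      finally show False using S(3)[OF p(3) q(3)] P(3) by blast
    qed
  qed
  then show ?thesis using that P by blast
qed

text \<open>
  Otherwise the multiplicative set of all \<open>t a\<^sup>n\<close> avoids 0, and a prime avoiding it would be contained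
  in \<open>p\<close> without containing \<open>a\<close>.
\<close>

lemma (in cring) minimal_prime_nilpotent:
  assumes p: "primeideal p R" and min: "\<And>q. \<lbrakk>primeideal q R; q \<subseteq> p\<rbrakk> \<Longrightarrow> q = p" and a: "a \<in> p"
  shows "\<exists>t\<in>carrier R - p. \<exists>n::nat. t \<otimes> a [^] n = \<zero>"
proof (rule ccontr)
  assume no: "\<not> ?thesis"
  interpret p: primeideal p R by (rule p)
  have aR: "a \<in> carrier R" using p.Icarr[OF a] .
  have one: "\<one> \<notin> p" using p.one_imp_carrier p.I_notcarr by blast
  define S where "S = {t \<otimes> a [^] (n::nat) | t n. t \<in> carrier R - p}"
  have S1: "S \<subseteq> carrier R" using aR by (auto simp: S_def)
  have sub: "carrier R - p \<subseteq> S"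
    unfolding S_def by (force intro: exI[of _ "0::nat"])
  have S2: "\<one> \<in> S" using sub one by blast
  have S3: "u \<otimes> v \<in> S" if uv: "u \<in> S" "v \<in> S" for u v
  proof -
    obtain t n where t: "u = t \<otimes> a [^] (n::nat)" "t \<in> carrier R - p" using uv(1) by (auto simp: S_def)
    obtain t' n' where t': "v = t' \<otimes> a [^] (n'::nat)" "t' \<in> carrier R - p" using uv(2) by (auto simp: S_def)
    have "u \<otimes> v = (t \<otimes> t') \<otimes> a [^] (n + n')"
      unfolding t(1) t'(1) nat_pow_mult[OF aR, symmetric] using t(2) t'(2) aR by (simp add: m_ac)
    moreover have "t \<otimes> t' \<in> carrier R - p" using t(2) t'(2) p.I_prime by auto
    ultimately show ?thesis unfolding S_def by blast
  qed
  have "z \<noteq> \<zero>" if "z \<in> S" for z using that no by (auto simp: S_def)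
  then have "{\<zero>} \<inter> S = {}" by blast
  then obtain q where q: "primeideal q R" "q \<inter> S = {}"
    using prime_ideal_avoiding[OF zeroideal _ S1 S2 S3] by metis
  interpret q: primeideal q R by (rule q(1))
  have "q \<subseteq> p" using q(2) sub q.Icarr by blast
  then have "a \<in> q" using min[OF q(1)] a by blast
  moreover have "a \<in> S"
    unfolding S_def using one aR by (auto intro!: exI[of _ "\<one>"] exI[of _ "1::nat"])
  ultimately show False using q(2) by blast
qed

lemma maximalideal_max_ideal: "local_ring R \<Longrightarrow> maximalideal (max_ideal R) R"
  using theI'[of "\<lambda>I. maximalideal I R"] by (simp add: local_ring_def max_ideal_def)

text \<open>
  An ideal that is maximal among those avoiding 1 is a maximal ideal, so every nonunit lies in the
  only maximal ideal.
\<close>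

lemma mem_max_ideal_iff:
  fixes R (structure)
  assumes R: "local_ring R" and a: "a \<in> carrier R"
  shows "a \<in> max_ideal R \<longleftrightarrow> a \<notin> Units R"
proof
  interpret cring R using R by (simp add: local_ring_def)
  interpret m: maximalideal "max_ideal R" R by (rule maximalideal_max_ideal[OF R])
  { assume "a \<in> max_ideal R"
    show "a \<notin> Units R"
    proof
      assume u: "a \<in> Units R"
      have "inv a \<otimes> a \<in> max_ideal R"
        by (rule m.I_l_closed[OF \<open>a \<in> max_ideal R\<close> Units_inv_closed[OF u]])
      then show False
        using Units_l_inv[OF u] m.one_imp_carrier m.I_notcarr by simp
    qed }
  assume u: "a \<notin> Units R"
  have "PIdl a \<inter> {\<one>} = {}"
    using u a by (auto simp: cgenideal_def Units_def m_comm)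
  then obtain P where P: "ideal P R" "PIdl a \<subseteq> P" "P \<inter> {\<one>} = {}"
    and max: "\<And>J. \<lbrakk>ideal J R; P \<subseteq> J; J \<inter> {\<one>} = {}\<rbrakk> \<Longrightarrow> J = P"
    using maximal_ideal_avoiding[OF cgenideal_ideal[OF a]] by blast
  have "maximalideal P R"
  proof (rule maximalidealI[OF P(1)])
    show "carrier R \<noteq> P" using P(3) by auto
    show "J = P \<or> J = carrier R" if "ideal J R" "P \<subseteq> J" "J \<subseteq> carrier R" for J
      using max[OF that(1,2)] ideal.one_imp_carrier[OF that(1)] by blast
  qed
  then have "P = max_ideal R" using R maximalideal_max_ideal[OF R] by (auto simp: local_ring_def)
  then show "a \<in> max_ideal R" using P(2) cgenideal_self[OF a] by blast
qed

section \<open>Localization\<close>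

context
  fixes R :: "'a ring" (structure) and S
  assumes R: "cring R" and S: "S \<subseteq> carrier R" "\<one> \<in> S" "\<And>a b. \<lbrakk>a \<in> S; b \<in> S\<rbrakk> \<Longrightarrow> a \<otimes> b \<in> S"
begin

interpretation cring R by (rule R)

private lemma inR: "s \<in> S \<Longrightarrow> s \<in> carrier R" using S(1) by blast

lemma frac_mem:
  assumes "a \<in> carrier R" "s \<in> S"
  shows "(b, t) \<in> frac R S a s \<longleftrightarrow> b \<in> carrier R \<and> t \<in> S \<and>
    (\<exists>u\<in>S. u \<otimes> (t \<otimes> a) = u \<otimes> (s \<otimes> b))"
proof -
  have "u \<otimes> (t \<otimes> a \<ominus> s \<otimes> b) = \<zero> \<longleftrightarrow> u \<otimes> (t \<otimes> a) = u \<otimes> (s \<otimes> b)"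
    if "u \<in> S" "t \<in> S" "b \<in> carrier R" for u
  proof -
    have "u \<otimes> (t \<otimes> a \<ominus> s \<otimes> b) = u \<otimes> (t \<otimes> a) \<ominus> u \<otimes> (s \<otimes> b)"
      using that assms inR by algebra
    then show ?thesis using that assms inR by (simp add: r_right_minus_eq)
  qed
  then show ?thesis by (auto simp: frac_def)
qed

private lemma rel_trans:
  assumes "a \<in> carrier R" "s \<in> S" "b \<in> carrier R" "t \<in> S" "c \<in> carrier R" "v \<in> S"
    and u: "u \<in> S" "u \<otimes> (t \<otimes> a) = u \<otimes> (s \<otimes> b)"
    and w: "w \<in> S" "w \<otimes> (v \<otimes> b) = w \<otimes> (t \<otimes> c)"
  shows "\<exists>u\<in>S. u \<otimes> (v \<otimes> a) = u \<otimes> (s \<otimes> c)"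
proof (rule bexI[of _ "u \<otimes> w \<otimes> t"])
  note cl = assms(1,3,5) inR[OF assms(2)] inR[OF assms(4)] inR[OF assms(6)] inR[OF u(1)] inR[OF w(1)]
  have "(u \<otimes> w \<otimes> t) \<otimes> (v \<otimes> a) = (w \<otimes> v) \<otimes> (u \<otimes> (t \<otimes> a))"
    using cl by algebra
  also have "\<dots> = (u \<otimes> s) \<otimes> (w \<otimes> (v \<otimes> b))"
    unfolding u(2) using cl by algebra
  also have "\<dots> = (u \<otimes> w \<otimes> t) \<otimes> (s \<otimes> c)"
    unfolding w(2) using cl by algebra
  finally show "(u \<otimes> w \<otimes> t) \<otimes> (v \<otimes> a) = (u \<otimes> w \<otimes> t) \<otimes> (s \<otimes> c)" .
qed (use assms S(3) in blast)

lemma frac_eq_iff: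
  assumes a: "a \<in> carrier R" "s \<in> S" and b: "b \<in> carrier R" "t \<in> S"
  shows "frac R S a s = frac R S b t \<longleftrightarrow> (\<exists>u\<in>S. u \<otimes> (t \<otimes> a) = u \<otimes> (s \<otimes> b))"
proof
  assume "frac R S a s = frac R S b t"
  moreover have "(b, t) \<in> frac R S b t" using frac_mem[OF b] b S(2) by blast
  ultimately show "\<exists>u\<in>S. u \<otimes> (t \<otimes> a) = u \<otimes> (s \<otimes> b)"
    using frac_mem[OF a] by blast
next
  assume "\<exists>u\<in>S. u \<otimes> (t \<otimes> a) = u \<otimes> (s \<otimes> b)"
  then obtain u where u: "u \<in> S" "u \<otimes> (t \<otimes> a) = u \<otimes> (s \<otimes> b)" by blast
  have "(c, v) \<in> frac R S a s \<longleftrightarrow> (c, v) \<in> frac R S b t" for c v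
    unfolding frac_mem[OF a] frac_mem[OF b]
    using rel_trans[OF a b, of c v u] rel_trans[OF b a, of c v u] u by metis
  then show "frac R S a s = frac R S b t" by auto
qed

text \<open>As for germs, a union over representatives is evaluated at any of them.\<close>

lemma UN_frac:
  assumes a: "a \<in> carrier R" "s \<in> S"
    and H: "\<And>b t. \<lbrakk>b \<in> carrier R; t \<in> S; frac R S b t = frac R S a s\<rbrakk> \<Longrightarrow> H b t = c"
  shows "(\<Union>(b, t)\<in>frac R S a s. H b t) = c"
proof -
  have "H b t = c" if m: "(b, t) \<in> frac R S a s" for b t
  proof (rule H)
    show b: "b \<in> carrier R" "t \<in> S" using m frac_mem[OF a] by blast+
    show "frac R S b t = frac R S a s" using m frac_mem[OF a] frac_eq_iff[OF a b] by blast
  qed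
  moreover have "(a, s) \<in> frac R S a s" using frac_mem[OF a] a S(2) by blast
  ultimately show ?thesis by (auto split: prod.splits)
qed

lemma frac_mult:
  assumes a: "a \<in> carrier R" "s \<in> S" and b: "b \<in> carrier R" "t \<in> S"
  shows "frac R S a s \<otimes>\<^bsub>localization R S\<^esub> frac R S b t = frac R S (a \<otimes> b) (s \<otimes> t)"
proof -
  have "frac R S (a' \<otimes> b') (s' \<otimes> t') = frac R S (a \<otimes> b) (s \<otimes> t)"
    if a': "a' \<in> carrier R" "s' \<in> S" "frac R S a' s' = frac R S a s"
      and b': "b' \<in> carrier R" "t' \<in> S" "frac R S b' t' = frac R S b t" for a' s' b' t'
  proof -
    obtain u where u: "u \<in> S" "u \<otimes> (s \<otimes> a') = u \<otimes> (s' \<otimes> a)"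
      using a' frac_eq_iff[OF a'(1,2) a] by blast
    obtain w where w: "w \<in> S" "w \<otimes> (t \<otimes> b') = w \<otimes> (t' \<otimes> b)"
      using b' frac_eq_iff[OF b'(1,2) b] by blast
    note cl = a(1) b(1) a'(1) b'(1) inR[OF a(2)] inR[OF b(2)] inR[OF a'(2)] inR[OF b'(2)] inR[OF u(1)] inR[OF w(1)]
    have "(u \<otimes> w) \<otimes> ((s \<otimes> t) \<otimes> (a' \<otimes> b')) = (u \<otimes> (s \<otimes> a')) \<otimes> (w \<otimes> (t \<otimes> b'))"
      using cl by algebra
    also have "\<dots> = (u \<otimes> w) \<otimes> ((s' \<otimes> t') \<otimes> (a \<otimes> b))"
      unfolding u(2) w(2) using cl by algebra
    finally show ?thesis
      using a b a' b' u(1) w(1) S(3) by (subst frac_eq_iff) blast+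
  qed
  then have "(\<Union>(a', s')\<in>frac R S a s. \<Union>(b', t')\<in>frac R S b t. frac R S (a' \<otimes> b') (s' \<otimes> t')) =
      frac R S (a \<otimes> b) (s \<otimes> t)"
    by (intro UN_frac[OF a] UN_frac[OF b])
  then show ?thesis by (simp add: localization_def)
qed

end

section \<open>Flat local homomorphisms\<close>

text \<open>
  Flatness quantifies over modules on the type \<open>'r large\<close>, so the ideal is copied to it along
  \<open>r \<mapsto> {(0, r)}\<close>.
\<close>

definition ideal_module :: "'r ring \<Rightarrow> 'r set \<Rightarrow> ('r, 'r large) module"
  where "ideal_module R I =
    (let i = (\<lambda>r. {(0, r)}); j = (\<lambda>c. snd (the_elem c)) in
     \<lparr>carrier = i ` I, monoid.mult = undefined, monoid.one = undefined,
      ring.zero = i \<zero>\<^bsub>R\<^esub>, ring.add = (\<lambda>c d. i (j c \<oplus>\<^bsub>R\<^esub> j d)), smult = (\<lambda>r c. i (r \<otimes>\<^bsub>R\<^esub> j c))\<rparr>)"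

lemma ideal_module_simps:
  "carrier (ideal_module R I) = (\<lambda>r. {(0, r)}) ` I"
  "{(0, r)} \<oplus>\<^bsub>ideal_module R I\<^esub> {(0, s)} = {(0, r \<oplus>\<^bsub>R\<^esub> s)}"
  "a \<odot>\<^bsub>ideal_module R I\<^esub> {(0, r)} = {(0, a \<otimes>\<^bsub>R\<^esub> r)}"
  "\<zero>\<^bsub>ideal_module R I\<^esub> = {(0, \<zero>\<^bsub>R\<^esub>)}"
  by (simp_all add: ideal_module_def Let_def)

lemma module_ideal_module:
  assumes R: "cring R" and I: "ideal I R"
  shows "module R (ideal_module R I)"
proof -
  interpret cring R by (rule R)
  interpret I: ideal I R by (rule I)
  show ?thesis
  proof (rule moduleI[OF R])
    show "abelian_group (ideal_module R I)"
    proof (rule abelian_groupI)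
      fix x assume "x \<in> carrier (ideal_module R I)"
      then obtain r where r: "r \<in> I" "x = {(0, r)}" by (auto simp: ideal_module_simps)
      show "\<exists>y\<in>carrier (ideal_module R I). y \<oplus>\<^bsub>ideal_module R I\<^esub> x = \<zero>\<^bsub>ideal_module R I\<^esub>"
        using r I.a_inv_closed[OF r(1)] I.Icarr[OF r(1)]
        by (intro bexI[of _ "{(0, \<ominus>\<^bsub>R\<^esub> r)}"]) (auto simp: ideal_module_simps l_neg)
    qed (auto simp: ideal_module_simps I.Icarr add.m_ac I.zero_closed)
  qed (auto simp: ideal_module_simps I.Icarr I.I_l_closed l_distr r_distr m_assoc)
qed

text \<open>
  Suppose \<open>c \<noteq> 0\<close> is killed by \<open>\<phi>\<close>.  In \<open>A \<otimes> B = B\<close> the tensor \<open>c \<otimes> 1\<close> vanishes, hence by flatness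
  it vanishes in \<open>(c) \<otimes> B\<close>.  But \<open>(c) \<otimes> B\<close> maps onto the residue field of \<open>B\<close> by
  \<open>r c \<otimes> b \<mapsto> \<phi>(r) b\<close>, which is well-defined because the annihilator of \<open>c\<close> consists of nonunits
  and \<open>\<phi>\<close> is local.
\<close>

lemma flat_local_hom_injective:
  assumes A: "local_ring A" and B: "local_ring B" and \<phi>: "local_hom \<phi> A B"
    and flat: "flat_module A (alg_module \<phi> B)"
    and c: "c \<in> carrier A" "\<phi> c = \<zero>\<^bsub>B\<^esub>"
  shows "c = \<zero>\<^bsub>A\<^esub>"
proof (rule ccontr)
  assume nz: "c \<noteq> \<zero>\<^bsub>A\<^esub>"
  have cA: "cring A" and cB: "cring B" using A B by (simp_all add: local_ring_def)
  interpret A: cring A by (rule cA)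
  interpret B: cring B by (rule cB)
  interpret \<phi>: ring_hom_cring A B \<phi> using \<phi> by (unfold_locales) (simp add: local_hom_def)
  interpret m: maximalideal "max_ideal B" B by (rule maximalideal_max_ideal[OF B])
  let ?i = "\<lambda>r. {(0::nat, r)}" and ?\<pi> = "\<lambda>b. max_ideal B +>\<^bsub>B\<^esub> b"
  let ?N = "ideal_module A (PIdl\<^bsub>A\<^esub> c)" and ?N' = "ideal_module A (carrier A)" and ?M = "alg_module \<phi> B"
  let ?K = "residue_field B"
  have K0: "\<zero>\<^bsub>?K\<^esub> = max_ideal B" by (simp only: residue_field_def FactRing_def ring.simps)
  interpret K: cring ?K unfolding residue_field_def by (rule m.quotient_is_cring[OF cB])
  have \<pi>: "?\<pi> \<in> ring_hom B ?K" unfolding residue_field_def by (rule m.rcos_ring_hom)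
  interpret \<pi>: ring_hom_cring B ?K ?\<pi> using \<pi> by unfold_locales
  have PI: "ideal (PIdl\<^bsub>A\<^esub> c) A" by (rule A.cgenideal_ideal[OF c(1)])
  have modN: "module A ?N" and modN': "module A ?N'"
    using module_ideal_module[OF cA PI] module_ideal_module[OF cA A.oneideal] .
  have M_simps: "carrier ?M = carrier B" "x \<oplus>\<^bsub>?M\<^esub> y = x \<oplus>\<^bsub>B\<^esub> y" "r \<odot>\<^bsub>?M\<^esub> x = \<phi> r \<otimes>\<^bsub>B\<^esub> x" for x y r
    by (simp_all add: alg_module_def)
  interpret PI: ideal "PIdl\<^bsub>A\<^esub> c" A by (rule PI)
  have tc: "tensor_closed A ?N ?M" "tensor_closed A ?N' ?M"
    unfolding tensor_closed_def M_simps by (auto simp: ideal_module_simps PI.I_l_closed)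
  have incl: "(\<lambda>x. x) \<in> mod_hom ?N ?N' A"
    using PI.Icarr by (auto simp: mod_hom_def ideal_module_simps)
  have inj: "inj_on (tensor_map A ?N' ?M (\<lambda>x. x) (\<lambda>x. x)) (carrier (tensor_group A ?N ?M))"
    using flat[unfolded flat_module_def, THEN conjunct2, rule_format, of ?N ?N' "\<lambda>x. x"] incl modN modN' by simp
  have tm: "tensor_map A ?N' ?M (\<lambda>x. x) (\<lambda>x. x) (pure_tensor A ?N ?M x y) = pure_tensor A ?N' ?M x y"
    if "x \<in> carrier ?N" "y \<in> carrier ?M" for x y
    by (rule tensor_map(2)[OF tc, where \<rho> = "\<lambda>r. r"])
      (use that PI.Icarr in \<open>auto simp: ideal_module_simps M_simps\<close>)
  have cI: "c \<in> PIdl\<^bsub>A\<^esub> c" by (rule A.cgenideal_self[OF c(1)])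
  have ic: "?i c \<in> carrier ?N" using cI by (simp add: ideal_module_simps)
  have pure': "pure_tensor A ?N' ?M (?i c) b = pure_tensor A ?N' ?M (?i \<one>\<^bsub>A\<^esub>) \<zero>\<^bsub>B\<^esub>" if b: "b \<in> carrier B" for b
  proof -
    have "pure_tensor A ?N' ?M (c \<odot>\<^bsub>?N'\<^esub> ?i \<one>\<^bsub>A\<^esub>) b = pure_tensor A ?N' ?M (?i \<one>\<^bsub>A\<^esub>) (c \<odot>\<^bsub>?M\<^esub> b)"
      using pure_tensor_biadditive[OF tc(2)] b c(1) by (simp add: biadditive_balanced_def M_simps(1) ideal_module_simps(1))
    then show ?thesis using c b by (simp add: ideal_module_simps M_simps)
  qed
  have "pure_tensor A ?N ?M (?i c) \<one>\<^bsub>B\<^esub> = pure_tensor A ?N ?M (?i c) \<zero>\<^bsub>B\<^esub>"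
  proof (rule inj_onD[OF inj])
    show "pure_tensor A ?N ?M (?i c) \<one>\<^bsub>B\<^esub> \<in> carrier (tensor_group A ?N ?M)"
      "pure_tensor A ?N ?M (?i c) \<zero>\<^bsub>B\<^esub> \<in> carrier (tensor_group A ?N ?M)"
      using pure_tensor_closed[OF tc(1) ic] M_simps(1) by auto
    show "tensor_map A ?N' ?M (\<lambda>x. x) (\<lambda>x. x) (pure_tensor A ?N ?M (?i c) \<one>\<^bsub>B\<^esub>) =
        tensor_map A ?N' ?M (\<lambda>x. x) (\<lambda>x. x) (pure_tensor A ?N ?M (?i c) \<zero>\<^bsub>B\<^esub>)"
      unfolding tm[OF ic, unfolded M_simps(1), OF B.one_closed] tm[OF ic, unfolded M_simps(1), OF B.zero_closed]
        pure'[OF B.one_closed] pure'[OF B.zero_closed] ..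
  qed
  moreover
  define \<rho> where "\<rho> x = (SOME r. r \<in> carrier A \<and> x = ?i (r \<otimes>\<^bsub>A\<^esub> c))" for x
  have \<rho>: "\<rho> x \<in> carrier A" "x = ?i (\<rho> x \<otimes>\<^bsub>A\<^esub> c)" if x: "x \<in> carrier ?N" for x
  proof -
    obtain y where "y \<in> PIdl\<^bsub>A\<^esub> c" "x = ?i y"
      using x unfolding ideal_module_simps(1) by blast
    then have "\<exists>r. r \<in> carrier A \<and> x = ?i (r \<otimes>\<^bsub>A\<^esub> c)"
      unfolding cgenideal_def by blast
    note * = someI_ex[OF this, folded \<rho>_def]
    show "\<rho> x \<in> carrier A" by (rule conjunct1[OF *])
    show "x = ?i (\<rho> x \<otimes>\<^bsub>A\<^esub> c)" by (rule conjunct2[OF *])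
  qed
  have well: "?\<pi> (\<phi> r) = ?\<pi> (\<phi> s)" if rs: "r \<in> carrier A" "s \<in> carrier A" "r \<otimes>\<^bsub>A\<^esub> c = s \<otimes>\<^bsub>A\<^esub> c" for r s
  proof -
    have d: "r \<ominus>\<^bsub>A\<^esub> s \<in> carrier A" using rs by simp
    have "(r \<ominus>\<^bsub>A\<^esub> s) \<otimes>\<^bsub>A\<^esub> c = r \<otimes>\<^bsub>A\<^esub> c \<ominus>\<^bsub>A\<^esub> s \<otimes>\<^bsub>A\<^esub> c" using rs(1,2) c(1) by algebra
    also have "\<dots> = \<zero>\<^bsub>A\<^esub>" using rs c(1) by (simp add: A.r_right_minus_eq)
    finally have z: "(r \<ominus>\<^bsub>A\<^esub> s) \<otimes>\<^bsub>A\<^esub> c = \<zero>\<^bsub>A\<^esub>" .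
    have "r \<ominus>\<^bsub>A\<^esub> s \<notin> Units A"
    proof
      assume u: "r \<ominus>\<^bsub>A\<^esub> s \<in> Units A"
      have "c = inv\<^bsub>A\<^esub> (r \<ominus>\<^bsub>A\<^esub> s) \<otimes>\<^bsub>A\<^esub> ((r \<ominus>\<^bsub>A\<^esub> s) \<otimes>\<^bsub>A\<^esub> c)"
        using A.m_assoc[OF A.Units_inv_closed[OF u] d c(1)] A.Units_l_inv[OF u] c(1) by simp
      then show False using z nz A.Units_inv_closed[OF u] by simp
    qed
    then have "r \<ominus>\<^bsub>A\<^esub> s \<in> max_ideal A" using mem_max_ideal_iff[OF A d] by simp
    then have m: "\<phi> (r \<ominus>\<^bsub>A\<^esub> s) \<in> max_ideal B" using \<phi> by (auto simp: local_hom_def)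
    have "?\<pi> (\<phi> (r \<ominus>\<^bsub>A\<^esub> s)) = \<zero>\<^bsub>?K\<^esub>"
      unfolding K0 by (rule m.a_rcos_const[OF m])
    moreover have "r = (r \<ominus>\<^bsub>A\<^esub> s) \<oplus>\<^bsub>A\<^esub> s" using rs(1,2) by algebra
    ultimately show ?thesis
      using \<pi>.hom_add[OF \<phi>.hom_closed[OF d] \<phi>.hom_closed[OF rs(2)]] \<phi>.hom_add[OF d rs(2)]
        \<pi>.hom_closed[OF \<phi>.hom_closed[OF rs(2)]] by simp
  qed
  define \<beta> where "\<beta> x b = ?\<pi> (\<phi> (\<rho> x)) \<otimes>\<^bsub>?K\<^esub> ?\<pi> b" for x b
  have "biadditive_balanced A ?N ?M (add_monoid ?K) \<beta>"
    unfolding biadditive_balanced_def M_simps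
  proof (intro conjI ballI)
    fix x b assume x: "x \<in> carrier ?N" and b: "b \<in> carrier B"
    note rx = \<rho>(1)[OF x] and pb = \<pi>.hom_closed[OF b]
    note px = \<pi>.hom_closed[OF \<phi>.hom_closed[OF rx]]
    show "\<beta> x b \<in> carrier (add_monoid ?K)" unfolding \<beta>_def using px pb by simp
    { fix y assume y: "y \<in> carrier ?N"
      note ry = \<rho>(1)[OF y]
      note py = \<pi>.hom_closed[OF \<phi>.hom_closed[OF ry]]
      have xy: "x \<oplus>\<^bsub>?N\<^esub> y \<in> carrier ?N" using tc(1) x y by (simp add: tensor_closed_def)
      have "?i (\<rho> (x \<oplus>\<^bsub>?N\<^esub> y) \<otimes>\<^bsub>A\<^esub> c) = ?i (\<rho> x \<otimes>\<^bsub>A\<^esub> c) \<oplus>\<^bsub>?N\<^esub> ?i (\<rho> y \<otimes>\<^bsub>A\<^esub> c)"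
        using \<rho>(2)[OF xy] \<rho>(2)[OF x] \<rho>(2)[OF y] by metis
      then have "\<rho> (x \<oplus>\<^bsub>?N\<^esub> y) \<otimes>\<^bsub>A\<^esub> c = (\<rho> x \<oplus>\<^bsub>A\<^esub> \<rho> y) \<otimes>\<^bsub>A\<^esub> c"
        using rx ry c(1) by (simp add: ideal_module_simps A.l_distr)
      from well[OF \<rho>(1)[OF xy] _ this]
      show "\<beta> (x \<oplus>\<^bsub>?N\<^esub> y) b = \<beta> x b \<otimes>\<^bsub>add_monoid ?K\<^esub> \<beta> y b"
        unfolding \<beta>_def using rx ry px py pb by (simp add: K.l_distr) }
    { fix b' assume b': "b' \<in> carrier B"
      show "\<beta> x (b \<oplus>\<^bsub>B\<^esub> b') = \<beta> x b \<otimes>\<^bsub>add_monoid ?K\<^esub> \<beta> x b'"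
        unfolding \<beta>_def using px pb b b' \<pi>.hom_closed[OF b'] by (simp add: K.r_distr) }
    { fix r assume r: "r \<in> carrier A"
      have xy: "r \<odot>\<^bsub>?N\<^esub> x \<in> carrier ?N" using tc(1) x r by (simp add: tensor_closed_def)
      have "?i (\<rho> (r \<odot>\<^bsub>?N\<^esub> x) \<otimes>\<^bsub>A\<^esub> c) = r \<odot>\<^bsub>?N\<^esub> ?i (\<rho> x \<otimes>\<^bsub>A\<^esub> c)"
        using \<rho>(2)[OF xy] \<rho>(2)[OF x] by metis
      then have "\<rho> (r \<odot>\<^bsub>?N\<^esub> x) \<otimes>\<^bsub>A\<^esub> c = (r \<otimes>\<^bsub>A\<^esub> \<rho> x) \<otimes>\<^bsub>A\<^esub> c"
        using rx r c(1) by (simp add: ideal_module_simps A.m_assoc)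
      from well[OF \<rho>(1)[OF xy] _ this]
      show "\<beta> (r \<odot>\<^bsub>?N\<^esub> x) b = \<beta> x (\<phi> r \<otimes>\<^bsub>B\<^esub> b)"
        unfolding \<beta>_def using rx px pb b r \<pi>.hom_closed[OF \<phi>.hom_closed[OF r]]
        by (simp add: K.m_assoc K.m_lcomm) }
  qed
  then obtain \<Phi> where \<Phi>: "\<And>x b. \<lbrakk>x \<in> carrier ?N; b \<in> carrier ?M\<rbrakk> \<Longrightarrow> \<Phi> (pure_tensor A ?N ?M x b) = \<beta> x b"
    using tensor_lift[OF tc(1) K.a_comm_group] by metis
  ultimately have "\<beta> (?i c) \<one>\<^bsub>B\<^esub> = \<beta> (?i c) \<zero>\<^bsub>B\<^esub>"
    using \<Phi>[OF ic] M_simps(1) by (metis B.one_closed B.zero_closed)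
  moreover have "?\<pi> (\<phi> (\<rho> (?i c))) = \<one>\<^bsub>?K\<^esub>"
  proof -
    have "\<rho> (?i c) \<otimes>\<^bsub>A\<^esub> c = \<one>\<^bsub>A\<^esub> \<otimes>\<^bsub>A\<^esub> c" using \<rho>(2)[OF ic] c(1) by simp
    from well[OF \<rho>(1)[OF ic] A.one_closed this] show ?thesis using \<pi>.hom_one by simp
  qed
  ultimately have "\<one>\<^bsub>?K\<^esub> = \<zero>\<^bsub>?K\<^esub>"
    unfolding \<beta>_def using \<pi>.hom_one \<pi>.hom_zero by simp
  then have "\<one>\<^bsub>B\<^esub> \<in> max_ideal B"
    using m.a_rcos_self[OF B.one_closed] \<pi>.hom_one K0 by simp
  then show False using m.one_imp_carrier m.I_notcarr by simp
qed

section \<open>Spectra\<close>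

lemma prime_complement:
  fixes R (structure)
  assumes "primeideal p R"
  shows "carrier R - p \<subseteq> carrier R" "\<one> \<in> carrier R - p"
    "\<And>a b. \<lbrakk>a \<in> carrier R - p; b \<in> carrier R - p\<rbrakk> \<Longrightarrow> a \<otimes> b \<in> carrier R - p"
proof -
  interpret primeideal p R by (rule assms)
  show "\<one> \<in> carrier R - p" using one_imp_carrier I_notcarr by auto
  show "\<And>a b. \<lbrakk>a \<in> carrier R - p; b \<in> carrier R - p\<rbrakk> \<Longrightarrow> a \<otimes> b \<in> carrier R - p"
    using I_prime by auto
qed blast

lemma frac_eq_iff_prime:
  fixes R (structure)
  assumes "cring R" "primeideal p R" "a \<in> carrier R" "s \<in> carrier R - p" "b \<in> carrier R" "t \<in> carrier R - p"
  shows "frac R (carrier R - p) a s = frac R (carrier R - p) b t \<longleftrightarrow>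
    (\<exists>u\<in>carrier R - p. u \<otimes> (t \<otimes> a) = u \<otimes> (s \<otimes> b))"
  by (rule frac_eq_iff[OF assms(1) prime_complement[OF assms(2)] assms(3-6)])

lemma frac_mult_prime:
  fixes R (structure)
  assumes "cring R" "primeideal p R" "a \<in> carrier R" "s \<in> carrier R - p" "b \<in> carrier R" "t \<in> carrier R - p"
  shows "frac R (carrier R - p) a s \<otimes>\<^bsub>localization_at R p\<^esub> frac R (carrier R - p) b t =
    frac R (carrier R - p) (a \<otimes> b) (s \<otimes> t)"
  by (rule frac_mult[OF assms(1) prime_complement[OF assms(2)] assms(3-6)])

lemma openin_zariski:
  fixes R (structure)
  assumes R: "cring R"
  shows "openin (zariski_topology R) U \<longleftrightarrow> (\<exists>I. ideal I R \<and> U = {p. primeideal p R \<and> \<not> I \<subseteq> p})"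
proof -
  interpret cring R by (rule R)
  let ?D = "\<lambda>I. {p. primeideal p R \<and> \<not> I \<subseteq> p}"
  have "istopology (\<lambda>U. \<exists>I. ideal I R \<and> U = ?D I)"
    unfolding istopology_def
  proof (intro conjI allI impI)
    fix A B assume "\<exists>I. ideal I R \<and> A = ?D I" "\<exists>I. ideal I R \<and> B = ?D I"
    then obtain I J where I: "ideal I R" "A = ?D I" and J: "ideal J R" "B = ?D J" by blast
    have "?D I \<inter> ?D J = ?D (I \<inter> J)"
    proof (intro equalityI subsetI)
      fix p assume p: "p \<in> ?D I \<inter> ?D J"
      then interpret p: primeideal p R by simp
      obtain a b where ab: "a \<in> I" "a \<notin> p" "b \<in> J" "b \<notin> p" using p by blast
      have c: "a \<in> carrier R" "b \<in> carrier R" using ideal.Icarr I(1) J(1) ab by metis+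
      have "a \<otimes> b \<in> I \<inter> J"
        using ideal.I_r_closed[OF I(1) ab(1) c(2)] ideal.I_l_closed[OF J(1) ab(3) c(1)] by blast
      moreover have "a \<otimes> b \<notin> p" using p.I_prime[OF c] ab by blast
      ultimately show "p \<in> ?D (I \<inter> J)" using p by blast
    qed blast
    then have "A \<inter> B = ?D (I \<inter> J)" using I(2) J(2) by simp
    then show "\<exists>I. ideal I R \<and> A \<inter> B = ?D I" using i_intersect[OF I(1) J(1)] by (intro exI[of _ "I \<inter> J"] conjI)
  next
    fix K assume K: "\<forall>A\<in>K. \<exists>I. ideal I R \<and> A = ?D I"
    let ?J = "\<Union>{I. ideal I R \<and> ?D I \<in> K}"
    have J: "?J \<subseteq> carrier R"
    proof
      fix a assume "a \<in> ?J"
      then obtain I where "ideal I R" "a \<in> I" by blast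
      then show "a \<in> carrier R" by (rule ideal.Icarr)
    qed
    have "\<Union>K = ?D (Idl ?J)"
    proof (intro equalityI subsetI)
      fix p assume "p \<in> \<Union>K"
      then obtain B where B: "B \<in> K" "p \<in> B" by blast
      obtain I where I: "ideal I R" "B = ?D I" using K[rule_format, OF B(1)] by (elim exE conjE)
      have "I \<subseteq> ?J" using I B(1) by (intro Union_upper) simp
      then have "primeideal p R" "\<not> ?J \<subseteq> p" using B(2) unfolding I(2) by blast+
      then show "p \<in> ?D (Idl ?J)" using genideal_self[OF J] by blast
    next
      fix p assume p: "p \<in> ?D (Idl ?J)"
      then have prime: "primeideal p R" by simp
      have "\<not> ?J \<subseteq> p" using genideal_minimal[OF primeideal.axioms(1)[OF prime]] p by blast
      then obtain I a where I: "ideal I R" "?D I \<in> K" "a \<in> I" "a \<notin> p" by blast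
      have "p \<in> ?D I" using prime I(3,4) by blast
      then show "p \<in> \<Union>K" using I(2) by (rule UnionI[rotated])
    qed
    then show "\<exists>I. ideal I R \<and> \<Union>K = ?D I" using genideal_ideal[OF J] by (intro exI[of _ "Idl ?J"] conjI)
  qed
  then show ?thesis unfolding zariski_topology_def by (simp add: topology_inverse')
qed

lemma topspace_zariski:
  fixes R (structure)
  assumes R: "cring R"
  shows "topspace (zariski_topology R) = {p. primeideal p R}"
proof -
  interpret cring R by (rule R)
  have "\<not> carrier R \<subseteq> p" if "primeideal p R" for p
    using prime_complement(2)[OF that] by blast
  then have "{p. primeideal p R} = {p. primeideal p R \<and> \<not> carrier R \<subseteq> p}" by blast
  then have "openin (zariski_topology R) {p. primeideal p R}"
    unfolding openin_zariski[OF R] by (intro exI[of _ "carrier R"] conjI oneideal)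
  moreover have "topspace (zariski_topology R) \<subseteq> {p. primeideal p R}"
  proof -
    obtain I where "topspace (zariski_topology R) = {p. primeideal p R \<and> \<not> I \<subseteq> p}"
      using openin_topspace[of "zariski_topology R", unfolded openin_zariski[OF R]] by (elim exE conjE)
    then show ?thesis by auto
  qed
  ultimately show ?thesis by (intro equalityI openin_subset)
qed

lemma openin_zariski_basic:
  fixes R (structure)
  assumes R: "cring R" and a: "a \<in> carrier R"
  shows "openin (zariski_topology R) {p. primeideal p R \<and> a \<notin> p}"
proof -
  interpret cring R by (rule R)
  have "a \<in> p \<longleftrightarrow> PIdl a \<subseteq> p" if "primeideal p R" for p
    using cgenideal_self[OF a] cgenideal_minimal[OF primeideal.axioms(1)[OF that]] by blast
  then have "{p. primeideal p R \<and> a \<notin> p} = {p. primeideal p R \<and> \<not> PIdl a \<subseteq> p}" by blast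
  then show ?thesis unfolding openin_zariski[OF R] by (intro exI[of _ "PIdl a"] conjI cgenideal_ideal[OF a])
qed

lemma Spec_simps:
  "rs_top (Spec R) = zariski_topology R"
  "rs_res (Spec R) V V' \<sigma> = restrict \<sigma> V'"
  "\<sigma> \<otimes>\<^bsub>rs_sec (Spec R) V\<^esub> \<tau> = (\<lambda>p\<in>V. \<sigma> p \<otimes>\<^bsub>localization_at R p\<^esub> \<tau> p)"
  by (simp_all add: Spec_def pointwise_ring_def)

lemma Spec_section_iff:
  "\<sigma> \<in> carrier (rs_sec (Spec R) V) \<longleftrightarrow> \<sigma> \<in> (\<Pi>\<^sub>E p\<in>V. carrier (localization_at R p)) \<and>
     (\<forall>p\<in>V. \<exists>V'. openin (zariski_topology R) V' \<and> p \<in> V' \<and> V' \<subseteq> V \<and>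
        (\<exists>a\<in>carrier R. \<exists>b\<in>carrier R. \<forall>q\<in>V'. b \<notin> q \<and> \<sigma> q = frac R (carrier R - q) a b))"
  by (simp add: Spec_def pointwise_ring_def)

lemma localization_carrier: "carrier (localization R S) = {frac R S a s | a s. a \<in> carrier R \<and> s \<in> S}"
  by (simp add: localization_def)

lemma Spec_sectionI:
  fixes R (structure)
  assumes "\<And>p. p \<in> V \<Longrightarrow> \<exists>V' a b. openin (zariski_topology R) V' \<and> p \<in> V' \<and> V' \<subseteq> V \<and>
      a \<in> carrier R \<and> b \<in> carrier R \<and> (\<forall>q\<in>V'. b \<notin> q \<and> \<sigma> q = frac R (carrier R - q) a b)"
    and "\<And>p. p \<notin> V \<Longrightarrow> \<sigma> p = undefined"
  shows "\<sigma> \<in> carrier (rs_sec (Spec R) V)"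
proof -
  have "\<sigma> p \<in> carrier (localization_at R p)" if p: "p \<in> V" for p
  proof -
    obtain V' a b where "p \<in> V'" "a \<in> carrier R" "b \<in> carrier R" "\<forall>q\<in>V'. b \<notin> q \<and> \<sigma> q = frac R (carrier R - q) a b"
      using assms(1)[OF p] by (elim exE conjE)
    then show ?thesis unfolding localization_carrier by blast
  qed
  then have "\<sigma> \<in> (\<Pi>\<^sub>E p\<in>V. carrier (localization_at R p))" using assms(2) by (rule PiE_I)
  then show ?thesis
    unfolding Spec_section_iff
  proof (intro conjI ballI)
    fix p assume p: "p \<in> V"
    obtain V' a b where V': "openin (zariski_topology R) V' \<and> p \<in> V' \<and> V' \<subseteq> V"
      and ab: "a \<in> carrier R" "b \<in> carrier R" "\<forall>q\<in>V'. b \<notin> q \<and> \<sigma> q = frac R (carrier R - q) a b"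
      using assms(1)[OF p] by (elim exE conjE) simp
    show "\<exists>V'. openin (zariski_topology R) V' \<and> p \<in> V' \<and> V' \<subseteq> V \<and>
        (\<exists>a\<in>carrier R. \<exists>b\<in>carrier R. \<forall>q\<in>V'. b \<notin> q \<and> \<sigma> q = frac R (carrier R - q) a b)"
      using V' ab by (intro exI[of _ V'] conjI bexI[of _ a] bexI[of _ b]) simp_all
  qed
qed

lemma Spec_sectionE:
  fixes R (structure)
  assumes "\<sigma> \<in> carrier (rs_sec (Spec R) V)" "p \<in> V"
  obtains V' a b where "openin (zariski_topology R) V'" "p \<in> V'" "V' \<subseteq> V" "a \<in> carrier R" "b \<in> carrier R"
    "\<And>q. q \<in> V' \<Longrightarrow> b \<notin> q \<and> \<sigma> q = frac R (carrier R - q) a b"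
proof -
  have "\<exists>V'. openin (zariski_topology R) V' \<and> p \<in> V' \<and> V' \<subseteq> V \<and>
      (\<exists>a\<in>carrier R. \<exists>b\<in>carrier R. \<forall>q\<in>V'. b \<notin> q \<and> \<sigma> q = frac R (carrier R - q) a b)"
    using assms(1)[unfolded Spec_section_iff, THEN conjunct2] assms(2) by (rule bspec)
  then show ?thesis using that by (elim exE conjE bexE) simp
qed

lemma Spec_section_restrict:
  fixes R (structure)
  assumes \<sigma>: "\<sigma> \<in> carrier (rs_sec (Spec R) V)" and V': "openin (zariski_topology R) V'" "V' \<subseteq> V"
  shows "restrict \<sigma> V' \<in> carrier (rs_sec (Spec R) V')"
proof (rule Spec_sectionI)
  fix p assume p: "p \<in> V'"
  obtain V'' a b where V'': "openin (zariski_topology R) V''" "p \<in> V''" "V'' \<subseteq> V" "a \<in> carrier R" "b \<in> carrier R"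
    and eq: "\<And>q. q \<in> V'' \<Longrightarrow> b \<notin> q \<and> \<sigma> q = frac R (carrier R - q) a b"
    using Spec_sectionE[OF \<sigma>] p V'(2) by blast
  have o: "openin (zariski_topology R) (V'' \<inter> V')" using V''(1) V'(1) by blast
  show "\<exists>V'' a b. openin (zariski_topology R) V'' \<and> p \<in> V'' \<and> V'' \<subseteq> V' \<and>
      a \<in> carrier R \<and> b \<in> carrier R \<and> (\<forall>q\<in>V''. b \<notin> q \<and> restrict \<sigma> V' q = frac R (carrier R - q) a b)"
    using o p V'' eq by (intro exI[of _ "V'' \<inter> V'"] exI[of _ a] exI[of _ b]) simp
qed simp

lemma Spec_section_mult:
  fixes R (structure)
  assumes R: "cring R" and V: "openin (zariski_topology R) V"
    and \<sigma>: "\<sigma> \<in> carrier (rs_sec (Spec R) V)" and \<tau>: "\<tau> \<in> carrier (rs_sec (Spec R) V)"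
  shows "\<sigma> \<otimes>\<^bsub>rs_sec (Spec R) V\<^esub> \<tau> \<in> carrier (rs_sec (Spec R) V)"
proof (rule Spec_sectionI)
  interpret cring R by (rule R)
  fix p assume p: "p \<in> V"
  obtain V1 a b where V1: "openin (zariski_topology R) V1" "p \<in> V1" "V1 \<subseteq> V" "a \<in> carrier R" "b \<in> carrier R"
    and eq1: "\<And>q. q \<in> V1 \<Longrightarrow> b \<notin> q \<and> \<sigma> q = frac R (carrier R - q) a b"
    using Spec_sectionE[OF \<sigma> p] by blast
  obtain V2 c d where V2: "openin (zariski_topology R) V2" "p \<in> V2" "V2 \<subseteq> V" "c \<in> carrier R" "d \<in> carrier R"
    and eq2: "\<And>q. q \<in> V2 \<Longrightarrow> d \<notin> q \<and> \<tau> q = frac R (carrier R - q) c d"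
    using Spec_sectionE[OF \<tau> p] by blast
  have o: "openin (zariski_topology R) (V1 \<inter> V2)" using V1(1) V2(1) by blast
  have "b \<otimes> d \<notin> q \<and> (\<sigma> \<otimes>\<^bsub>rs_sec (Spec R) V\<^esub> \<tau>) q = frac R (carrier R - q) (a \<otimes> c) (b \<otimes> d)"
    if q: "q \<in> V1 \<inter> V2" for q
  proof -
    have prime: "primeideal q R"
      using q openin_subset[OF o] topspace_zariski[OF R] by blast
    have bd: "b \<in> carrier R - q" "d \<in> carrier R - q" using q eq1 eq2 V1(5) V2(5) by auto
    have qV: "q \<in> V" using q V1(3) by blast
    have "(\<sigma> \<otimes>\<^bsub>rs_sec (Spec R) V\<^esub> \<tau>) q =
        frac R (carrier R - q) a b \<otimes>\<^bsub>localization_at R q\<^esub> frac R (carrier R - q) c d"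
      unfolding Spec_simps using qV q eq1[of q] eq2[of q] by simp
    also have "\<dots> = frac R (carrier R - q) (a \<otimes> c) (b \<otimes> d)"
      by (rule frac_mult_prime[OF R prime V1(4) bd(1) V2(4) bd(2)])
    finally show ?thesis using prime_complement(3)[OF prime bd] by simp
  qed
  then show "\<exists>V' a b. openin (zariski_topology R) V' \<and> p \<in> V' \<and> V' \<subseteq> V \<and> a \<in> carrier R \<and> b \<in> carrier R \<and>
      (\<forall>q\<in>V'. b \<notin> q \<and> (\<sigma> \<otimes>\<^bsub>rs_sec (Spec R) V\<^esub> \<tau>) q = frac R (carrier R - q) a b)"
    using o V1(2-5) V2(2,4,5)
    by (intro exI[of _ "V1 \<inter> V2"] exI[of _ "a \<otimes> c"] exI[of _ "b \<otimes> d"] conjI ballI) auto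
qed (simp add: Spec_simps)

section \<open>Affine charts\<close>

lemma irreducible_closure_of_point:
  assumes "w \<in> topspace T"
  shows "irreducible_subset T (T closure_of {w})"
  unfolding irreducible_subset_def
proof (intro conjI allI impI)
  have w: "w \<in> T closure_of {w}" using closure_of_subset[of "{w}" T] assms by blast
  show "T closure_of {w} \<subseteq> topspace T" by (rule closure_of_subset_topspace)
  show "T closure_of {w} \<noteq> {}" using w by blast
  fix A B assume AB: "closedin T A \<and> closedin T B \<and> T closure_of {w} \<subseteq> A \<union> B"
  then have "w \<in> A \<or> w \<in> B" using w by blast
  then show "T closure_of {w} \<subseteq> A \<or> T closure_of {w} \<subseteq> B"
    using AB closure_of_minimal[of "{w}" _ T] by blast
qed

locale affine_chart =
  fixes S :: "('p, 'a) ringed_space" and W :: "'p set" and R :: "'a ring" (structure)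
    and g :: "('p, 'a, 'a set, 'a set \<Rightarrow> ('a \<times> 'a) set) rs_map"
  assumes ringed: "is_ringed_space S" and open_W: "openin (rs_top S) W" and cring: "cring R"
    and iso: "rs_isomorphism (open_subspace S W) (Spec R) g"
begin

abbreviation Z where "Z \<equiv> zariski_topology R"
abbreviation pr where "pr \<equiv> map_pt g"
abbreviation chart where "chart V \<equiv> preim (open_subspace S W) g V"

sublocale R: cring R by (rule cring)

lemma ring_S: "ring_presheaf S" by (rule ringed_space_imp_ring_presheaf[OF ringed])

lemmas presheaf_S = ring_presheaf_presheaf[OF ring_S]

lemma homeo: "homeomorphic_map (subtopology (rs_top S) W) Z pr"
  using iso by (simp add: rs_isomorphism_def open_subspace_def Spec_simps)

lemma topspace_W: "topspace (subtopology (rs_top S) W) = W"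
  using openin_subset[OF open_W] by (simp add: Int_absorb1)

lemma chart_eq: "chart V = {x \<in> W. pr x \<in> V}"
  using topspace_W by (simp add: preim_def open_subspace_def)

lemma pr_image: "pr ` W = {p. primeideal p R}"
  using homeomorphic_imp_surjective_map[OF homeo] topspace_W topspace_zariski[OF cring] by simp

lemma pr_inj: "inj_on pr W"
  using homeomorphic_imp_injective_map[OF homeo] topspace_W by simp

lemma prime_pr: "x \<in> W \<Longrightarrow> primeideal (pr x) R"
  using pr_image by blast

lemma chart_open: "openin (rs_top S) (chart V)" if "openin Z V"
proof -
  have "openin (subtopology (rs_top S) W) {x \<in> W. pr x \<in> V}"
    using openin_continuous_map_preimage[OF homeomorphic_imp_continuous_map[OF homeo] that]
    unfolding topspace_W .
  then show ?thesis
    unfolding chart_eq using openin_trans_full open_W by blast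
qed

lemma open_chart:
  assumes "openin (rs_top S) N" "N \<subseteq> W"
  shows "openin Z (pr ` N)" "chart (pr ` N) = N"
proof -
  have "openin (subtopology (rs_top S) W) N"
    using assms by (simp add: openin_open_subtopology[OF open_W])
  then show "openin Z (pr ` N)"
    using homeomorphic_imp_open_map[OF homeo] by (simp add: open_map_def)
  show "chart (pr ` N) = N"
    unfolding chart_eq using assms(2) pr_inj by (auto simp: inj_on_def)
qed

lemma chart_sec_hom: "openin Z V \<Longrightarrow> map_sec g V \<in> ring_hom (rs_sec (Spec R) V) (rs_sec S (chart V))"
  using iso by (simp add: rs_isomorphism_def rs_morphism_def Spec_simps open_subspace_def)

lemma chart_sec_bij: "openin Z V \<Longrightarrow>
    bij_betw (map_sec g V) (carrier (rs_sec (Spec R) V)) (carrier (rs_sec S (chart V)))"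
  using iso by (simp add: rs_isomorphism_def rs_morphism_def Spec_simps open_subspace_def)

lemma chart_sec_closed: "openin Z V \<Longrightarrow> \<sigma> \<in> carrier (rs_sec (Spec R) V) \<Longrightarrow> map_sec g V \<sigma> \<in> carrier (rs_sec S (chart V))"
  using chart_sec_hom by (auto simp: ring_hom_def)

lemma chart_sec_restrict:
  assumes "openin Z V" "openin Z V'" "V' \<subseteq> V" "\<sigma> \<in> carrier (rs_sec (Spec R) V)"
  shows "map_sec g V' (restrict \<sigma> V') = rs_res S (chart V) (chart V') (map_sec g V \<sigma>)"
  using iso assms by (simp add: rs_isomorphism_def rs_morphism_def Spec_simps open_subspace_def)

subsection \<open>Specialization and generic points\<close>

text \<open>
  The basic open set of \<open>a\<close> detects whether \<open>a\<close> belongs to a prime; conversely, the complement of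
  \<open>V(I)\<close> is stable under passing to smaller primes.
\<close>

lemma closure_of_iff_subset:
  assumes x: "x \<in> W" and w: "w \<in> W"
  shows "w \<in> rs_top S closure_of {x} \<longleftrightarrow> pr x \<subseteq> pr w"
proof
  assume cl: "w \<in> rs_top S closure_of {x}"
  show "pr x \<subseteq> pr w"
  proof
    fix a assume a: "a \<in> pr x"
    have aR: "a \<in> carrier R" using ideal.Icarr[OF primeideal.axioms(1)[OF prime_pr[OF x]] a] .
    show "a \<in> pr w"
    proof (rule ccontr)
      assume "a \<notin> pr w"
      then have "w \<in> chart {p. primeideal p R \<and> a \<notin> p}" using w prime_pr[OF w] by (simp add: chart_eq)
      then have "x \<in> chart {p. primeideal p R \<and> a \<notin> p}"
        using cl chart_open[OF openin_zariski_basic[OF cring aR]] unfolding in_closure_of by blast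
      then show False using a by (simp add: chart_eq)
    qed
  qed
next
  assume sub: "pr x \<subseteq> pr w"
  show "w \<in> rs_top S closure_of {x}"
    unfolding in_closure_of
  proof (intro conjI allI impI)
    show "w \<in> topspace (rs_top S)" using w openin_subset[OF open_W] by blast
    fix N assume N: "w \<in> N \<and> openin (rs_top S) N"
    then have o: "openin (rs_top S) (N \<inter> W)" using open_W by blast
    obtain I where I: "pr ` (N \<inter> W) = {p. primeideal p R \<and> \<not> I \<subseteq> p}"
      using open_chart(1)[OF o Int_lower2, unfolded openin_zariski[OF cring]] by (elim exE conjE)
    have "pr w \<in> pr ` (N \<inter> W)" using N w by blast
    then have "pr x \<in> pr ` (N \<inter> W)" unfolding I using sub prime_pr[OF x] by blast
    then have "x \<in> N" using pr_inj x by (auto simp: inj_on_def)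
    then show "\<exists>y. y \<in> {x} \<and> y \<in> N" by blast
  qed
qed

text \<open>A smaller prime would be a point whose closure is a larger irreducible closed set.\<close>

lemma generic_point_minimal_prime:
  assumes gen: "generic_point S x" and x: "x \<in> W" and q: "primeideal q R" "q \<subseteq> pr x"
  shows "q = pr x"
proof -
  have "q \<in> pr ` W" using q(1) pr_image by simp
  then obtain w where w: "w \<in> W" "pr w = q" by (elim imageE) simp
  let ?c = "\<lambda>x. rs_top S closure_of {x}"
  have wt: "w \<in> topspace (rs_top S)" using w(1) openin_subset[OF open_W] by blast
  have irr: "irreducible_subset (rs_top S) (?c w)"
    by (rule irreducible_closure_of_point[OF wt])
  have "x \<in> ?c w" using closure_of_iff_subset[OF w(1) x] w(2) q(2) by simp
  then have "?c x \<subseteq> ?c w" using closure_of_minimal[of "{x}" "?c w" "rs_top S"] by simp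
  then have "?c w = ?c x" using gen irr unfolding generic_point_def irreducible_component_def by blast
  then have "w \<in> ?c x" using closure_of_subset[of "{w}" "rs_top S"] wt by blast
  then show ?thesis using closure_of_iff_subset[OF x w(1)] w(2) q(2) by blast
qed

text \<open>
  If the prime \<open>p\<close> of \<open>x\<close> is finitely generated and its elements become nilpotent after inverting
  an element outside \<open>p\<close>, one such element \<open>t\<close> serves all generators.  Then \<open>D(t)\<close> is a
  neighbourhood of \<open>x\<close> contained in the closure of \<open>x\<close>, and a larger irreducible closed set would
  be covered by this closure and the complement of the neighbourhood, neither of which contains it.
\<close>

lemma generic_point_if_locally_nilpotent:
  assumes noeth: "noetherian_ring R" and x: "x \<in> W"
    and nil: "\<And>a. a \<in> pr x \<Longrightarrow> \<exists>t\<in>carrier R - pr x. \<exists>n::nat. t \<otimes> a [^] n = \<zero>"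
  shows "generic_point S x"
proof -
  interpret p: primeideal "pr x" R by (rule prime_pr[OF x])
  obtain A where A: "A \<subseteq> carrier R" "finite A" "pr x = Idl A"
    using noetherian_ring.finetely_gen[OF noeth p.is_ideal] by blast
  have Ap: "A \<subseteq> pr x" using R.genideal_self[OF A(1)] A(3) by simp
  have "\<exists>t\<in>carrier R - pr x. \<forall>a\<in>A. \<exists>n::nat. t \<otimes> a [^] n = \<zero>"
    using A(2) Ap A(1)
  proof (induction A rule: finite_induct)
    case empty
    then show ?case using prime_complement(2)[OF prime_pr[OF x]] by blast
  next
    case (insert a A)
    obtain t where t: "t \<in> carrier R - pr x" "\<forall>a\<in>A. \<exists>n::nat. t \<otimes> a [^] n = \<zero>"
      using insert by blast
    obtain s n where s: "s \<in> carrier R - pr x" "s \<otimes> a [^] (n::nat) = \<zero>"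
      using nil[of a] insert(4) by blast
    have ts: "t \<otimes> s \<in> carrier R - pr x" by (rule prime_complement(3)[OF prime_pr[OF x] t(1) s(1)])
    have "\<exists>n::nat. (t \<otimes> s) \<otimes> b [^] n = \<zero>" if b: "b \<in> insert a A" for b
    proof (cases "b = a")
      case True
      have "(t \<otimes> s) \<otimes> a [^] n = t \<otimes> (s \<otimes> a [^] n)"
        using t(1) s(1) insert(5) by (simp add: R.m_assoc)
      then show ?thesis using True s(2) t(1) by auto
    next
      case False
      then obtain k where k: "t \<otimes> b [^] (k::nat) = \<zero>" using t(2) b by blast
      have "b \<in> carrier R" using b insert(5) by blast
      then have "(t \<otimes> s) \<otimes> b [^] k = s \<otimes> (t \<otimes> b [^] k)"
        using t(1) s(1) by (simp add: R.m_ac)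
      then show ?thesis using k s(1) by auto
    qed
    then show ?case using ts by blast
  qed
  then obtain t where t: "t \<in> carrier R - pr x" "\<And>a. a \<in> A \<Longrightarrow> \<exists>n::nat. t \<otimes> a [^] n = \<zero>"
    by blast
  let ?D = "{p. primeideal p R \<and> t \<notin> p}"
  have sub: "pr x \<subseteq> q" if q: "q \<in> ?D" for q
  proof -
    interpret q: primeideal q R using q by simp
    have "a \<in> q" if a: "a \<in> A" for a
    proof -
      obtain n where n: "t \<otimes> a [^] (n::nat) = \<zero>" using t(2)[OF a] by blast
      have aR: "a \<in> carrier R" using a A(1) by blast
      have "a [^] n \<in> q"
        using q.I_prime[of t "a [^] n"] n q.zero_closed t(1) aR q by auto
      moreover have "a \<in> q" if "a [^] (m::nat) \<in> q" for m
        using that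
      proof (induction m)
        case 0
        then show ?case using q.one_imp_carrier q.I_notcarr by simp
      next
        case (Suc m)
        then show ?case using q.I_prime[of "a [^] m" a] aR by auto
      qed
      ultimately show ?thesis by blast
    qed
    then show ?thesis unfolding A(3) using R.genideal_minimal[OF q.is_ideal] by blast
  qed
  let ?N = "chart ?D" and ?C = "rs_top S closure_of {x}"
  have N: "openin (rs_top S) ?N" using chart_open[OF openin_zariski_basic[OF cring]] t(1) by blast
  have xN: "x \<in> ?N" using x t(1) prime_pr[OF x] by (simp add: chart_eq)
  have NC: "?N \<subseteq> ?C" using closure_of_iff_subset[OF x] sub by (auto simp: chart_eq)
  have xt: "x \<in> topspace (rs_top S)" using x openin_subset[OF open_W] by blast
  have xC: "x \<in> ?C" using xN NC by blast
  show ?thesis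
    unfolding generic_point_def irreducible_component_def
  proof (intro conjI allI impI)
    show "irreducible_subset (rs_top S) ?C"
      by (rule irreducible_closure_of_point[OF xt])
    fix Z' assume Z': "irreducible_subset (rs_top S) Z' \<and> ?C \<subseteq> Z'"
    have "closedin (rs_top S) (topspace (rs_top S) - ?N)" using N by blast
    moreover have "Z' \<subseteq> ?C \<union> (topspace (rs_top S) - ?N)"
      using Z' NC unfolding irreducible_subset_def by blast
    ultimately have "Z' \<subseteq> ?C \<or> Z' \<subseteq> topspace (rs_top S) - ?N"
      using Z' closedin_closure_of[of "rs_top S" "{x}"] unfolding irreducible_subset_def by blast
    then show "Z' = ?C" using Z' xC xN by blast
  qed (rule xt)
qed

subsection \<open>The stalk as a localization\<close>

abbreviation SpecS where "SpecS V \<equiv> carrier (rs_sec (Spec R) V)"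
abbreviation chart_germ where "chart_germ x V \<sigma> \<equiv> rs_germ S {x} (chart V) (map_sec g V \<sigma>)"

lemma chart_germ_restrict:
  assumes V: "openin Z V" "openin Z V'" "V' \<subseteq> V" and x: "x \<in> W" "pr x \<in> V'" and \<sigma>: "\<sigma> \<in> SpecS V"
  shows "chart_germ x V' (restrict \<sigma> V') = chart_germ x V \<sigma>"
proof -
  have sub: "chart V' \<subseteq> chart V" "{x} \<subseteq> chart V'" using V(3) x by (auto simp: chart_eq)
  show ?thesis
    unfolding chart_sec_restrict[OF V \<sigma>]
    by (rule germ_restrict[OF presheaf_S, OF chart_open[OF V(1)] chart_open[OF V(2)] sub(2,1) chart_sec_closed[OF V(1) \<sigma>]])
qed

lemma chart_germE:
  assumes c: "c \<in> carrier (stalk S x)" and x: "x \<in> W"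
  obtains V \<sigma> where "openin Z V" "pr x \<in> V" "\<sigma> \<in> SpecS V" "c = chart_germ x V \<sigma>"
proof -
  obtain N s where N: "openin (rs_top S) N" "{x} \<subseteq> N" "s \<in> carrier (rs_sec S N)" "c = rs_germ S {x} N s"
    using germsE[OF c[unfolded germ_ring_carrier[OF ring_S]]] by metis
  let ?N = "N \<inter> W" and ?V = "pr ` (N \<inter> W)"
  have o: "openin (rs_top S) ?N" using N(1) open_W by blast
  note V = open_chart[OF o Int_lower2]
  have s: "rs_res S N ?N s \<in> carrier (rs_sec S (chart ?V))"
    unfolding V(2) by (rule presheaf_closed[OF presheaf_S, OF N(1) o Int_lower1 N(3)])
  then have "rs_res S N ?N s \<in> map_sec g ?V ` SpecS ?V"
    unfolding bij_betw_imp_surj_on[OF chart_sec_bij[OF V(1)]] .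
  then obtain \<sigma> where \<sigma>: "\<sigma> \<in> SpecS ?V" "map_sec g ?V \<sigma> = rs_res S N ?N s"
    by (elim imageE) simp
  have xN: "{x} \<subseteq> ?N" using N(2) x by blast
  have "c = chart_germ x ?V \<sigma>"
    unfolding \<sigma>(2) V(2) N(4) using germ_restrict[OF presheaf_S, OF N(1) o xN Int_lower1 N(3)] by simp
  then show ?thesis using that[OF V(1) _ \<sigma>(1)] xN by blast
qed

lemma chart_germE2:
  assumes c: "c \<in> carrier (stalk S x)" and d: "d \<in> carrier (stalk S x)" and x: "x \<in> W"
  obtains V \<sigma> \<tau> where "openin Z V" "pr x \<in> V" "\<sigma> \<in> SpecS V" "\<tau> \<in> SpecS V"
    "c = chart_germ x V \<sigma>" "d = chart_germ x V \<tau>"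
proof -
  obtain V1 \<sigma> where V1: "openin Z V1" "pr x \<in> V1" "\<sigma> \<in> SpecS V1" "c = chart_germ x V1 \<sigma>"
    by (rule chart_germE[OF c x])
  obtain V2 \<tau> where V2: "openin Z V2" "pr x \<in> V2" "\<tau> \<in> SpecS V2" "d = chart_germ x V2 \<tau>"
    by (rule chart_germE[OF d x])
  have o: "openin Z (V1 \<inter> V2)" using V1(1) V2(1) by blast
  have p: "pr x \<in> V1 \<inter> V2" using V1(2) V2(2) by blast
  show ?thesis
    by (rule that[OF o p Spec_section_restrict[OF V1(3) o Int_lower1] Spec_section_restrict[OF V2(3) o Int_lower2]])
      (simp_all add: V1(4) V2(4) chart_germ_restrict[OF V1(1) o Int_lower1 x p V1(3)]
        chart_germ_restrict[OF V2(1) o Int_lower2 x p V2(3)])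
qed

text \<open>
  If two fractions agree in the local ring of \<open>p\<close>, the equation \<open>u d a = u b c\<close> with \<open>u \<notin> p\<close> makes
  them agree wherever \<open>u\<close> does not vanish.
\<close>

lemma chart_germ_eq_iff:
  assumes x: "x \<in> W" and V: "openin Z V" "pr x \<in> V" and \<sigma>: "\<sigma> \<in> SpecS V" and \<tau>: "\<tau> \<in> SpecS V"
  shows "chart_germ x V \<sigma> = chart_germ x V \<tau> \<longleftrightarrow> \<sigma> (pr x) = \<tau> (pr x)"
proof
  assume eq: "chart_germ x V \<sigma> = chart_germ x V \<tau>"
  have xV: "{x} \<subseteq> chart V" using x V(2) by (simp add: chart_eq)
  obtain N where N: "openin (rs_top S) N" "{x} \<subseteq> N" "N \<subseteq> chart V"
    and r: "rs_res S (chart V) N (map_sec g V \<sigma>) = rs_res S (chart V) N (map_sec g V \<tau>)"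
    using germ_eqD[where C = "\<lambda>U. carrier (rs_sec S U)", OF eq chart_open[OF V(1)] xV chart_sec_closed[OF V(1) \<tau>]] by metis
  have NW: "N \<subseteq> W" using N(3) by (auto simp: chart_eq)
  note V' = open_chart[OF N(1) NW]
  have sub: "pr ` N \<subseteq> V" using N(3) by (auto simp: chart_eq)
  have "map_sec g (pr ` N) (restrict \<sigma> (pr ` N)) = map_sec g (pr ` N) (restrict \<tau> (pr ` N))"
    unfolding chart_sec_restrict[OF V(1) V'(1) sub \<sigma>] chart_sec_restrict[OF V(1) V'(1) sub \<tau>] V'(2) by (rule r)
  then have "restrict \<sigma> (pr ` N) = restrict \<tau> (pr ` N)"
    by (rule inj_onD[OF bij_betw_imp_inj_on[OF chart_sec_bij[OF V'(1)]]])
      (rule Spec_section_restrict[OF _ V'(1) sub], (rule \<sigma> \<tau>))+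
  from fun_cong[OF this, of "pr x"] show "\<sigma> (pr x) = \<tau> (pr x)" using N(2) by simp
next
  let ?p = "pr x"
  assume eq: "\<sigma> ?p = \<tau> ?p"
  obtain V1 a b where V1: "openin Z V1" "?p \<in> V1" "V1 \<subseteq> V" "a \<in> carrier R" "b \<in> carrier R"
    and eq1: "\<And>q. q \<in> V1 \<Longrightarrow> b \<notin> q \<and> \<sigma> q = frac R (carrier R - q) a b"
    using Spec_sectionE[OF \<sigma> V(2)] by blast
  obtain V2 c d where V2: "openin Z V2" "?p \<in> V2" "V2 \<subseteq> V" "c \<in> carrier R" "d \<in> carrier R"
    and eq2: "\<And>q. q \<in> V2 \<Longrightarrow> d \<notin> q \<and> \<tau> q = frac R (carrier R - q) c d"
    using Spec_sectionE[OF \<tau> V(2)] by blast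
  note fe = frac_eq_iff_prime[OF cring]
  have bd: "b \<in> carrier R - q" "d \<in> carrier R - q" if "q \<in> V1 \<inter> V2" for q
    using eq1 eq2 V1(5) V2(5) that by auto
  have p12: "?p \<in> V1 \<inter> V2" using V1(2) V2(2) by blast
  obtain u where u: "u \<in> carrier R - ?p" "u \<otimes> (d \<otimes> a) = u \<otimes> (b \<otimes> c)"
    using eq eq1[OF V1(2)] eq2[OF V2(2)] fe[OF prime_pr[OF x] V1(4) bd(1)[OF p12] V2(4) bd(2)[OF p12]] by auto
  let ?V = "V1 \<inter> V2 \<inter> {q. primeideal q R \<and> u \<notin> q}"
  have uR: "u \<in> carrier R" using u(1) by blast
  have o: "openin Z ?V"
    using openin_Int[OF openin_Int[OF V1(1) V2(1)] openin_zariski_basic[OF cring uR]] .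
  have pV: "?p \<in> ?V" using p12 prime_pr[OF x] u(1) by blast
  have sub: "?V \<subseteq> V" using V1(3) by blast
  have "\<sigma> q = \<tau> q" if q: "q \<in> ?V" for q
  proof -
    have prime: "primeideal q R" and q12: "q \<in> V1 \<inter> V2" and uq: "u \<in> carrier R - q" using q uR by auto
    have "frac R (carrier R - q) a b = frac R (carrier R - q) c d"
      using fe[OF prime V1(4) bd(1)[OF q12] V2(4) bd(2)[OF q12]] u(2) uq by blast
    then show ?thesis using eq1 eq2 q12 by simp
  qed
  then have "restrict \<sigma> ?V = restrict \<tau> ?V" by (intro restrict_ext)
  then show "chart_germ x V \<sigma> = chart_germ x V \<tau>"
    using chart_germ_restrict[OF V(1) o sub x pV \<sigma>] chart_germ_restrict[OF V(1) o sub x pV \<tau>] by simp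
qed

text \<open>
  The isomorphism from the stalk at \<open>x\<close> to the local ring of the prime of \<open>x\<close>.  It is determined by
  \<open>chart_value_germ\<close>: the germ of a section goes to the value of that section at the prime.
\<close>

definition chart_value :: "'p \<Rightarrow> ('p set \<times> 'a) set \<Rightarrow> ('a \<times> 'a) set"
  where "chart_value x c = (SOME v. \<exists>V \<sigma>. openin Z V \<and> pr x \<in> V \<and> \<sigma> \<in> SpecS V \<and> c = chart_germ x V \<sigma> \<and> v = \<sigma> (pr x))"

lemma chart_value_germ:
  assumes x: "x \<in> W" and V: "openin Z V" "pr x \<in> V" and \<sigma>: "\<sigma> \<in> SpecS V"
  shows "chart_value x (chart_germ x V \<sigma>) = \<sigma> (pr x)"
  unfolding chart_value_def
proof (rule some_equality)
  show "\<exists>V' \<tau>. openin Z V' \<and> pr x \<in> V' \<and> \<tau> \<in> SpecS V' \<and> chart_germ x V \<sigma> = chart_germ x V' \<tau> \<and> \<sigma> (pr x) = \<tau> (pr x)"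
    using V \<sigma> by blast
next
  fix v assume "\<exists>V' \<tau>. openin Z V' \<and> pr x \<in> V' \<and> \<tau> \<in> SpecS V' \<and> chart_germ x V \<sigma> = chart_germ x V' \<tau> \<and> v = \<tau> (pr x)"
  then obtain V' \<tau> where V': "openin Z V'" "pr x \<in> V'" and \<tau>: "\<tau> \<in> SpecS V'" and eq: "chart_germ x V \<sigma> = chart_germ x V' \<tau>"
    and v: "v = \<tau> (pr x)" by (elim exE conjE)
  have o: "openin Z (V \<inter> V')" using V(1) V'(1) by blast
  have p: "pr x \<in> V \<inter> V'" using V(2) V'(2) by blast
  have "restrict \<sigma> (V \<inter> V') (pr x) = restrict \<tau> (V \<inter> V') (pr x)"
    using chart_germ_eq_iff[OF x o p Spec_section_restrict[OF \<sigma> o Int_lower1] Spec_section_restrict[OF \<tau> o Int_lower2]]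
      chart_germ_restrict[OF V(1) o Int_lower1 x p \<sigma>] chart_germ_restrict[OF V'(1) o Int_lower2 x p \<tau>] eq by simp
  then show "v = \<sigma> (pr x)" using p v by simp
qed

lemma chart_value_mult:
  assumes x: "x \<in> W" and c: "c \<in> carrier (stalk S x)" and d: "d \<in> carrier (stalk S x)"
  shows "chart_value x (c \<otimes>\<^bsub>stalk S x\<^esub> d) = chart_value x c \<otimes>\<^bsub>localization_at R (pr x)\<^esub> chart_value x d"
proof -
  obtain V \<sigma> \<tau> where V: "openin Z V" "pr x \<in> V" and s: "\<sigma> \<in> SpecS V" "\<tau> \<in> SpecS V"
    and cd: "c = chart_germ x V \<sigma>" "d = chart_germ x V \<tau>"
    by (rule chart_germE2[OF c d x])
  have xV: "{x} \<subseteq> chart V" using x V(2) by (simp add: chart_eq)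
  have "c \<otimes>\<^bsub>stalk S x\<^esub> d = chart_germ x V (\<sigma> \<otimes>\<^bsub>rs_sec (Spec R) V\<^esub> \<tau>)"
    unfolding cd germ_ring_ops(2)[OF ring_S, OF chart_open[OF V(1)] xV chart_sec_closed[OF V(1) s(1)] chart_sec_closed[OF V(1) s(2)]]
      ring_hom_mult[OF chart_sec_hom[OF V(1)] s] ..
  then show ?thesis
    using chart_value_germ[OF x V Spec_section_mult[OF cring V(1) s]] V(2)
    unfolding cd chart_value_germ[OF x V s(1)] chart_value_germ[OF x V s(2)] by (simp add: Spec_simps)
qed

lemma chart_value_inj:
  assumes x: "x \<in> W" and c: "c \<in> carrier (stalk S x)" and d: "d \<in> carrier (stalk S x)"
    and eq: "chart_value x c = chart_value x d"
  shows "c = d"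
proof -
  obtain V \<sigma> \<tau> where V: "openin Z V" "pr x \<in> V" and s: "\<sigma> \<in> SpecS V" "\<tau> \<in> SpecS V"
    and cd: "c = chart_germ x V \<sigma>" "d = chart_germ x V \<tau>"
    by (rule chart_germE2[OF c d x])
  show ?thesis
    using eq chart_germ_eq_iff[OF x V s] unfolding cd chart_value_germ[OF x V s(1)] chart_value_germ[OF x V s(2)] by simp
qed

lemma chart_value_frac:
  assumes x: "x \<in> W" and c: "c \<in> carrier (stalk S x)"
  obtains a s where "a \<in> carrier R" "s \<in> carrier R - pr x" "chart_value x c = frac R (carrier R - pr x) a s"
proof -
  obtain V \<sigma> where V: "openin Z V" "pr x \<in> V" "\<sigma> \<in> SpecS V" "c = chart_germ x V \<sigma>"
    by (rule chart_germE[OF c x])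
  obtain V' a b where V': "pr x \<in> V'" "a \<in> carrier R" "b \<in> carrier R"
    "\<And>q. q \<in> V' \<Longrightarrow> b \<notin> q \<and> \<sigma> q = frac R (carrier R - q) a b"
    using Spec_sectionE[OF V(3,2)] by metis
  show ?thesis
    using that[of a b] V'(2,3) V'(4)[OF V'(1)] chart_value_germ[OF x V(1,2,3)] V(4) by simp
qed

lemma chart_value_onto:
  assumes x: "x \<in> W" and a: "a \<in> carrier R" and s: "s \<in> carrier R - pr x"
  obtains c where "c \<in> carrier (stalk S x)" "chart_value x c = frac R (carrier R - pr x) a s"
proof -
  let ?V = "{q. primeideal q R \<and> s \<notin> q}"
  let ?\<sigma> = "\<lambda>q\<in>?V. frac R (carrier R - q) a s"
  have sR: "s \<in> carrier R" using s by blast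
  have V: "openin Z ?V" by (rule openin_zariski_basic[OF cring sR])
  have p: "pr x \<in> ?V" using prime_pr[OF x] s by blast
  have \<sigma>: "?\<sigma> \<in> SpecS ?V"
  proof (rule Spec_sectionI)
    fix p assume "p \<in> ?V"
    then show "\<exists>V' a' b. openin Z V' \<and> p \<in> V' \<and> V' \<subseteq> ?V \<and> a' \<in> carrier R \<and> b \<in> carrier R \<and>
        (\<forall>q\<in>V'. b \<notin> q \<and> ?\<sigma> q = frac R (carrier R - q) a' b)"
      using V a sR by (intro exI[of _ ?V] exI[of _ a] exI[of _ s] conjI ballI) simp_all
  qed auto
  have xV: "{x} \<subseteq> chart ?V" using x p by (simp add: chart_eq)
  show ?thesis
  proof (rule that)
    show "chart_germ x ?V ?\<sigma> \<in> carrier (stalk S x)"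
      unfolding germ_ring_carrier[OF ring_S]
      by (rule germ_in_germs[where C = "\<lambda>U. carrier (rs_sec S U)", OF chart_open[OF V] xV chart_sec_closed[OF V \<sigma>]])
    show "chart_value x (chart_germ x ?V ?\<sigma>) = frac R (carrier R - pr x) a s"
      unfolding chart_value_germ[OF x V p \<sigma>] using p by simp
  qed
qed

context
  fixes x
  assumes x: "x \<in> W" and cring_x: "cring (stalk S x)"
begin

interpretation B: cring "stalk S x" by (rule cring_x)

private abbreviation p where "p \<equiv> pr x"
private abbreviation "C \<equiv> carrier R - p"

private lemmas fe = frac_eq_iff_prime[OF cring prime_pr[OF x]]
private lemmas fm = frac_mult_prime[OF cring prime_pr[OF x]]
private lemmas one_C = prime_complement(2)[OF prime_pr[OF x]]
private lemmas mult_C = prime_complement(3)[OF prime_pr[OF x]]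

text \<open>
  As the map is multiplicative and bijective, the elements 1 and 0 of the stalk are recognized by
  their multiplicative properties.
\<close>

lemma chart_value_one: "chart_value x \<one>\<^bsub>stalk S x\<^esub> = frac R C \<one> \<one>"
proof -
  obtain u where u: "u \<in> carrier (stalk S x)" "chart_value x u = frac R C \<one> \<one>"
    by (rule chart_value_onto[OF x R.one_closed one_C])
  obtain a s where a: "a \<in> carrier R" "s \<in> C" and e: "chart_value x \<one>\<^bsub>stalk S x\<^esub> = frac R C a s"
    by (rule chart_value_frac[OF x B.one_closed])
  have "chart_value x (u \<otimes>\<^bsub>stalk S x\<^esub> \<one>\<^bsub>stalk S x\<^esub>) = frac R C a s"
    unfolding chart_value_mult[OF x u(1) B.one_closed] u(2) e fm[OF R.one_closed one_C a] using a by simp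
  then show ?thesis using u e by simp
qed

lemma chart_value_zero: "chart_value x \<zero>\<^bsub>stalk S x\<^esub> = frac R C \<zero> \<one>"
proof -
  obtain u where u: "u \<in> carrier (stalk S x)" "chart_value x u = frac R C \<zero> \<one>"
    by (rule chart_value_onto[OF x R.zero_closed one_C])
  obtain a s where a: "a \<in> carrier R" "s \<in> C" and e: "chart_value x \<zero>\<^bsub>stalk S x\<^esub> = frac R C a s"
    by (rule chart_value_frac[OF x B.zero_closed])
  have "chart_value x (u \<otimes>\<^bsub>stalk S x\<^esub> \<zero>\<^bsub>stalk S x\<^esub>) = frac R C \<zero> s"
    unfolding chart_value_mult[OF x u(1) B.zero_closed] u(2) e fm[OF R.zero_closed one_C a] using a by simp
  also have "\<dots> = frac R C \<zero> \<one>"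
    using fe[OF R.zero_closed a(2) R.zero_closed one_C] one_C a(2) by auto
  finally show ?thesis using u by simp
qed

lemma chart_value_pow:
  assumes c: "c \<in> carrier (stalk S x)" and a: "a \<in> carrier R" "s \<in> C" and e: "chart_value x c = frac R C a s"
  shows "chart_value x (c [^]\<^bsub>stalk S x\<^esub> (n::nat)) = frac R C (a [^] n) (s [^] n) \<and> s [^] n \<in> C"
proof (induction n)
  case 0
  then show ?case using chart_value_one one_C by simp
next
  case (Suc n)
  then show ?case
    using chart_value_mult[OF x B.nat_pow_closed[OF c, of n] c] e fm[OF R.nat_pow_closed[OF a(1)] _ a, of "s [^] n" n]
      mult_C[OF _ a(2)] by simp
qed

lemma nilpotent_iff:
  assumes c: "c \<in> carrier (stalk S x)" and a: "a \<in> carrier R" "s \<in> C" and e: "chart_value x c = frac R C a s"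
  shows "c [^]\<^bsub>stalk S x\<^esub> (n::nat) = \<zero>\<^bsub>stalk S x\<^esub> \<longleftrightarrow> (\<exists>t\<in>C. t \<otimes> a [^] n = \<zero>)"
proof -
  note p = chart_value_pow[OF assms, of n]
  have aR: "a [^] n \<in> carrier R" using a(1) by simp
  have "c [^]\<^bsub>stalk S x\<^esub> n = \<zero>\<^bsub>stalk S x\<^esub> \<longleftrightarrow> frac R C (a [^] n) (s [^] n) = frac R C \<zero> \<one>"
    using chart_value_inj[OF x B.nat_pow_closed[OF c, of n] B.zero_closed] chart_value_zero p by auto
  also have "\<dots> \<longleftrightarrow> (\<exists>t\<in>C. t \<otimes> a [^] n = \<zero>)"
    using fe[OF aR _ R.zero_closed one_C, of "s [^] n"] p aR by auto
  finally show ?thesis .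
qed

lemma nonunit_if_numerator_in_prime:
  assumes c: "c \<in> carrier (stalk S x)" and a: "a \<in> p" "s \<in> C" and e: "chart_value x c = frac R C a s"
  shows "c \<notin> Units (stalk S x)"
proof
  interpret p: primeideal p R by (rule prime_pr[OF x])
  have aR: "a \<in> carrier R" by (rule p.Icarr[OF a(1)])
  assume "c \<in> Units (stalk S x)"
  then obtain d where d: "d \<in> carrier (stalk S x)" "c \<otimes>\<^bsub>stalk S x\<^esub> d = \<one>\<^bsub>stalk S x\<^esub>"
    by (auto simp: Units_def)
  obtain b t where b: "b \<in> carrier R" "t \<in> C" "chart_value x d = frac R C b t"
    by (rule chart_value_frac[OF x d(1)])
  have st: "s \<otimes> t \<in> C" by (rule mult_C[OF a(2) b(2)])
  have "frac R C (a \<otimes> b) (s \<otimes> t) = frac R C \<one> \<one>"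
    using chart_value_mult[OF x c d(1)] unfolding d(2) e b(3) chart_value_one fm[OF aR a(2) b(1,2)] by simp
  then obtain u where u: "u \<in> C" "u \<otimes> (\<one> \<otimes> (a \<otimes> b)) = u \<otimes> ((s \<otimes> t) \<otimes> \<one>)"
    using fe[OF R.m_closed[OF aR b(1)] st R.one_closed one_C] by auto
  have "u \<otimes> (\<one> \<otimes> (a \<otimes> b)) \<in> p"
    using u(1) aR a(1) b(1) by (intro p.I_l_closed p.I_r_closed) auto
  moreover have "u \<otimes> ((s \<otimes> t) \<otimes> \<one>) \<in> C" using mult_C[OF u(1) mult_C[OF st one_C]] .
  ultimately show False using u(2) by simp
qed

lemma numerator_in_prime_if_nonunit:
  assumes c: "c \<in> carrier (stalk S x)" "c \<notin> Units (stalk S x)"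
    and a: "a \<in> carrier R" "s \<in> C" and e: "chart_value x c = frac R C a s"
  shows "a \<in> p"
proof (rule ccontr)
  assume "a \<notin> p"
  then have aC: "a \<in> C" using a(1) by blast
  have sR: "s \<in> carrier R" using a(2) by blast
  obtain d where d: "d \<in> carrier (stalk S x)" "chart_value x d = frac R C s a"
    by (rule chart_value_onto[OF x sR aC])
  have "chart_value x (c \<otimes>\<^bsub>stalk S x\<^esub> d) = frac R C (a \<otimes> s) (s \<otimes> a)"
    unfolding chart_value_mult[OF x c(1) d(1)] e d(2) by (rule fm[OF a sR aC])
  also have "\<dots> = frac R C \<one> \<one>"
    using fe[OF R.m_closed[OF a(1) sR] mult_C[OF a(2) aC] R.one_closed one_C] one_C a(1) sR
    by (auto intro!: bexI[of _ "\<one>"] simp: R.m_comm)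
  finally have "c \<otimes>\<^bsub>stalk S x\<^esub> d = \<one>\<^bsub>stalk S x\<^esub>"
    using chart_value_inj[OF x B.m_closed[OF c(1) d(1)] B.one_closed] chart_value_one by simp
  then show False using c d(1) B.m_comm[OF c(1) d(1)] by (auto simp: Units_def)
qed

lemma generic_stalk_nilpotent:
  assumes gen: "generic_point S x" and c: "c \<in> carrier (stalk S x)" "c \<notin> Units (stalk S x)"
  shows "\<exists>n::nat. c [^]\<^bsub>stalk S x\<^esub> n = \<zero>\<^bsub>stalk S x\<^esub>"
proof -
  obtain a s where a: "a \<in> carrier R" "s \<in> C" "chart_value x c = frac R C a s"
    by (rule chart_value_frac[OF x c(1)])
  have "a \<in> p" by (rule numerator_in_prime_if_nonunit[OF c a])
  from R.minimal_prime_nilpotent[OF prime_pr[OF x] generic_point_minimal_prime[OF gen x] this]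
  show ?thesis using nilpotent_iff[OF c(1) a] by blast
qed

lemma generic_if_stalk_nilpotent:
  assumes noeth: "noetherian_ring R"
    and nil: "\<And>c. \<lbrakk>c \<in> carrier (stalk S x); c \<notin> Units (stalk S x)\<rbrakk> \<Longrightarrow> \<exists>n::nat. c [^]\<^bsub>stalk S x\<^esub> n = \<zero>\<^bsub>stalk S x\<^esub>"
  shows "generic_point S x"
proof (rule generic_point_if_locally_nilpotent[OF noeth x])
  fix a assume a: "a \<in> p"
  have aR: "a \<in> carrier R" using ideal.Icarr[OF primeideal.axioms(1)[OF prime_pr[OF x]] a] .
  obtain c where c: "c \<in> carrier (stalk S x)" "chart_value x c = frac R C a \<one>"
    by (rule chart_value_onto[OF x aR one_C])
  obtain n where "c [^]\<^bsub>stalk S x\<^esub> (n::nat) = \<zero>\<^bsub>stalk S x\<^esub>"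
    using nil[OF c(1) nonunit_if_numerator_in_prime[OF c(1) a one_C c(2)]] by blast
  then show "\<exists>t\<in>C. \<exists>n::nat. t \<otimes> a [^] n = \<zero>"
    using nilpotent_iff[OF c(1) aR one_C c(2)] by blast
qed

end

end

section \<open>Generic points under flat morphisms\<close>

text \<open>
  Along the injective local homomorphism of stalks, nilpotency of the nonunits descends from \<open>x\<close> to
  \<open>f x\<close>.
\<close>

lemma flat_morphism_generic_point:
  assumes U: "is_scheme U" and V: "noetherian_scheme V" and f: "scheme_morphism U V f" and flat: "flat_morphism U V f"
    and x: "generic_point U x"
  shows "generic_point V (map_pt f x)"
proof -
  let ?y = "map_pt f x" and ?\<phi> = "stalk_map U f x"
  have xt: "x \<in> topspace (rs_top U)" using x by (simp add: generic_point_def)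
  have lrsU: "is_locally_ringed_space U" and lrsV: "is_locally_ringed_space V"
    using U V by (simp_all add: is_scheme_def noetherian_scheme_def)
  have rU: "is_ringed_space U" and rV: "is_ringed_space V"
    using lrsU lrsV by (simp_all add: is_locally_ringed_space_def)
  have "continuous_map (rs_top U) (rs_top V) (map_pt f)"
    using f by (simp add: scheme_morphism_def rs_morphism_def)
  then have yt: "?y \<in> topspace (rs_top V)" using xt by (rule continuous_map_image_subset_topspace[THEN subsetD, OF _ imageI])
  have lx: "local_ring (stalk U x)" and ly: "local_ring (stalk V ?y)"
    using lrsU lrsV xt yt by (simp_all add: is_locally_ringed_space_def)
  have cx: "cring (stalk U x)" and cy: "cring (stalk V ?y)" using lx ly by (simp_all add: local_ring_def)
  have loc: "local_hom ?\<phi> (stalk V ?y) (stalk U x)" using f xt by (simp add: scheme_morphism_def)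
  have fl: "flat_module (stalk V ?y) (alg_module ?\<phi> (stalk U x))" using flat xt by (simp add: flat_morphism_def)
  interpret A: cring "stalk V ?y" by (rule cy)
  interpret \<phi>: ring_hom_cring "stalk V ?y" "stalk U x" ?\<phi>
    by (intro ring_hom_cring.intro cx cy ring_hom_cring_axioms.intro) (use loc in \<open>simp add: local_hom_def\<close>)

  obtain W R where W: "x \<in> W" "affine_open U W R"
    using U xt unfolding is_scheme_def by blast
  then obtain g where "affine_chart U W R g"
    using rU unfolding affine_open_def affine_chart_def by blast
  then interpret X: affine_chart U W R g .
  obtain W' R' where W': "?y \<in> W'" "affine_open V W' R'" "noetherian_ring R'"
    using V yt unfolding noetherian_scheme_def by blast
  then obtain g' where "affine_chart V W' R' g'"
    using rV unfolding affine_open_def affine_chart_def by blast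
  then interpret Y: affine_chart V W' R' g' .

  show ?thesis
  proof (rule Y.generic_if_stalk_nilpotent[OF W'(1) cy W'(3)])
    fix c assume c: "c \<in> carrier (stalk V ?y)" "c \<notin> Units (stalk V ?y)"
    then have "c \<in> max_ideal (stalk V ?y)" using mem_max_ideal_iff[OF ly c(1)] by simp
    then have "?\<phi> c \<in> max_ideal (stalk U x)" using loc by (auto simp: local_hom_def)
    then have "?\<phi> c \<notin> Units (stalk U x)" using mem_max_ideal_iff[OF lx \<phi>.hom_closed[OF c(1)]] by simp
    then obtain n where n: "?\<phi> c [^]\<^bsub>stalk U x\<^esub> (n::nat) = \<zero>\<^bsub>stalk U x\<^esub>"
      using X.generic_stalk_nilpotent[OF W(1) cx x \<phi>.hom_closed[OF c(1)]] by blast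
    have "?\<phi> (c [^]\<^bsub>stalk V ?y\<^esub> n) = \<zero>\<^bsub>stalk U x\<^esub>"
      using \<phi>.ring.hom_nat_pow[OF c(1)] n by simp
    then have "c [^]\<^bsub>stalk V ?y\<^esub> n = \<zero>\<^bsub>stalk V ?y\<^esub>"
      by (rule flat_local_hom_injective[OF ly lx loc fl A.nat_pow_closed[OF c(1)]])
    then show "\<exists>n::nat. c [^]\<^bsub>stalk V ?y\<^esub> n = \<zero>\<^bsub>stalk V ?y\<^esub>" ..
  qed
qed

theorem proposition3p7:
  fixes U :: "('p, 'a) ringed_space"
    and V :: "('q, 'b) ringed_space"
    and f :: "('p, 'a, 'q, 'b) rs_map"
    and F :: "('q, 'b, 'm) mod_presheaf"
  assumes "noetherian_scheme U" "satisfies_G1 U" "satisfies_S2 U"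
    and "noetherian_scheme V" "satisfies_G1 V" "satisfies_S2 V"
    and "etale_morphism U V f"
    and "is_O_module V F"
    and "generically_rank_one V F"
  shows "generically_rank_one U (pullback U V f F)"
  unfolding generically_rank_one_def
proof (intro allI impI)
  fix \<eta> assume \<eta>: "generic_point U \<eta>"
  have sU: "is_scheme U" and sV: "is_scheme V"
    using assms(1,4) by (simp_all add: noetherian_scheme_def)
  have f: "scheme_morphism U V f" and flat: "flat_morphism U V f"
    using assms(7) by (simp_all add: etale_morphism_def)
  have generic: "generic_point V (map_pt f \<eta>)"
    by (rule flat_morphism_generic_point[OF sU assms(4) f flat \<eta>])
  have top: "\<eta> \<in> topspace (rs_top U)" "map_pt f \<eta> \<in> topspace (rs_top V)"
    using \<eta> generic by (simp_all add: generic_point_def)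
  have lrs: "is_locally_ringed_space U" "is_locally_ringed_space V"
    using sU sV by (simp_all add: is_scheme_def)
  interpret pulled_back_module U V f F
    using lrs f assms(8) by unfold_locales (simp_all add: is_locally_ringed_space_def scheme_morphism_def)
  show "mod_iso (stalk U \<eta>) (mod_stalk U (pullback U V f F) \<eta>) (self_module (stalk U \<eta>))"
  proof (rule pullback_stalk_rank_one[OF top(1)])
    show "cring (stalk U \<eta>)" "cring (stalk V (map_pt f \<eta>))"
      using lrs top by (simp_all add: is_locally_ringed_space_def local_ring_def)
    show "stalk_map U f \<eta> \<in> ring_hom (stalk V (map_pt f \<eta>)) (stalk U \<eta>)"
      using f top(1) by (simp add: scheme_morphism_def local_hom_def)
    show "mod_iso (stalk V (map_pt f \<eta>)) (mod_stalk V F (map_pt f \<eta>)) (self_module (stalk V (map_pt f \<eta>)))"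
      using assms(9) generic by (simp add: generically_rank_one_def)
  qed
qed

end
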